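(* Let $\mathfrak{H}$ and $\mathfrak{H}_n$, $n\in\mathbb{N}$, be separable Hilbert spaces, let $J_n\in\mathcal{B}(\mathfrak{H},\mathfrak{H}_n)$ be bounded operators, and let $A$ in $\mathfrak{H}$ and $A_n$ in $\mathfrak{H}_n$ be self-adjoint operators. If $A_n$ converges to $A$ in generalized norm resolvent sense, then $$\sigma_{ess}(A)=\lim_{n\to\infty}\sigma_{ess}(A_n),$$ where $\lim_{n\to\infty}\sigma_{ess}(A_n)$ denotes the set of all $\lambda$ for which there is a sequence $\lambda_n\in\sigma_{ess}(A_n)$ converging to $\lambda$.
   Context: Resolvent: $R_A(z)=(A-z)^{-1}$. Put $\Gamma:=\mathbb{C}\setminus\overline{\sigma(A)\cup\bigcup_n\sigma(A_n)}$. For a self-adjoint operator $A$ with spectral projections $P_A(\cdot)$, $\sigma_{ess}(A)$ is the set of $\lambda\in\mathbb{R}$ with $\dim\operatorname{Ran}P_A((\lambda-\varepsilon,\lambda+\varepsilon))=\infty$ for every $\varepsilon>0$. Generalized norm resolvent convergence of $A_n$ to $A$ means: $\|J_n\|\le C$ for some constant $C>0$ and all $n$, $\|J_n^*J_n-\mathbb{I}\|=\|J_nJ_n^*-\mathbb{I}\|\to0$, and $\lim_{n\to\infty}\|J_n^*R_{A_n}(z)J_n-R_A(z)\|=0$ for one $z\in\Gamma$.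
   Formalization: In the limit of the essential spectra, λ_n ∈ σ_ess(A_n) is required only for all sufficiently large n, since finitely many σ_ess(A_n) may be empty; the spaces H_n are realized as closed subspaces of one common Hilbert space. *)

theory Defs
  imports "HOL-Analysis.Analysis"
begin

section \<open>Complex Hilbert spaces\<close>

text \<open>
  The inner product is linear in its second argument. Norm, topology and completeness are those
  of the library class \<^class>\<open>banach\<close>.
\<close>

class chilbert_space = banach +
  fixes scaleC :: "complex \<Rightarrow> 'a \<Rightarrow> 'a"  (infixr \<open>*\<^sub>C\<close> 75)
    and cinner :: "'a \<Rightarrow> 'a \<Rightarrow> complex"
  assumes scaleC_add_right: "a *\<^sub>C (x + y) = a *\<^sub>C x + a *\<^sub>C y"
    and scaleC_add_left: "(a + b) *\<^sub>C x = a *\<^sub>C x + b *\<^sub>C x"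
    and scaleC_scaleC: "a *\<^sub>C b *\<^sub>C x = (a * b) *\<^sub>C x"
    and scaleR_scaleC: "r *\<^sub>R x = complex_of_real r *\<^sub>C x"
    and cinner_commute: "cinner x y = cnj (cinner y x)"
    and cinner_add_right: "cinner x (y + z) = cinner x y + cinner x z"
    and cinner_scaleC_right: "cinner x (a *\<^sub>C y) = a * cinner x y"
    and cinner_self: "cinner x x = complex_of_real ((norm x)\<^sup>2)"

global_interpretation cvec: vector_space "scaleC :: complex \<Rightarrow> 'a::chilbert_space \<Rightarrow> 'a"
proof
  show "1 *\<^sub>C x = x" for x :: 'a
    using scaleR_scaleC[of 1 x] by simp
qed (simp_all add: scaleC_add_right scaleC_add_left scaleC_scaleC)

text \<open>
  A sequence of Hilbert spaces cannot be a sequence of types, so a Hilbert space is a closed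
  complex subspace of a type of class \<^class>\<open>chilbert_space\<close> (with the inherited inner product).
  This is no restriction up to unitary equivalence: the spaces \<open>H\<^sub>n\<close> of any sequence are closed
  subspaces of their Hilbert direct sum, and the subspaces in a sequence need not be related to
  each other in any way. All notions below are relative to the space \<open>H\<close>; an operator on \<open>H\<close>
  may take arbitrary values outside \<open>H\<close>.
\<close>

definition hilbert_space :: "'a::chilbert_space set \<Rightarrow> bool" where
  "hilbert_space H \<longleftrightarrow> cvec.subspace H \<and> closed H"

definition separable_hilbert_space :: "'a::chilbert_space set \<Rightarrow> bool" where
  "separable_hilbert_space H \<longleftrightarrow> hilbert_space H \<and> separable_space (top_of_set H)"

definition infinite_dimensional :: "'a::chilbert_space set \<Rightarrow> bool" where
  "infinite_dimensional V \<longleftrightarrow> \<not> (\<exists>B. finite B \<and> V \<subseteq> cvec.span B)"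

section \<open>Bounded operators\<close>

definition clinear_on ::
    "'a::chilbert_space set \<Rightarrow> ('a \<Rightarrow> 'b::chilbert_space) \<Rightarrow> bool" where
  "clinear_on V f \<longleftrightarrow>
     (\<forall>x\<in>V. \<forall>y\<in>V. f (x + y) = f x + f y) \<and> (\<forall>c. \<forall>x\<in>V. f (c *\<^sub>C x) = c *\<^sub>C f x)"

definition bounded_operators ::
    "'a::chilbert_space set \<Rightarrow> 'b::chilbert_space set \<Rightarrow> ('a \<Rightarrow> 'b) set" where
  "bounded_operators H K =
     {T. T ` H \<subseteq> K \<and> clinear_on H T \<and> (\<exists>C. \<forall>x\<in>H. norm (T x) \<le> C * norm x)}"

text \<open>For \<open>H = UNIV\<close> this is \<^const>\<open>onorm\<close>.\<close>

definition onorm_on ::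
    "'a::chilbert_space set \<Rightarrow> ('a \<Rightarrow> 'b::chilbert_space) \<Rightarrow> real" where
  "onorm_on H T = (SUP x\<in>H. norm (T x) / norm x)"

text \<open>The adjoint \<open>K \<rightarrow> H\<close> of a bounded operator \<open>T : H \<rightarrow> K\<close>; meaningful on \<open>K\<close> only.\<close>

definition adjoint_on ::
    "'a::chilbert_space set \<Rightarrow> ('a \<Rightarrow> 'b::chilbert_space) \<Rightarrow> 'b \<Rightarrow> 'a" where
  "adjoint_on H T y = (THE w. w \<in> H \<and> (\<forall>x\<in>H. cinner (T x) y = cinner x w))"

section \<open>Unbounded self-adjoint operators, resolvent and spectrum\<close>

text \<open>The values of \<open>op_app\<close> outside the domain \<open>op_dom\<close> are irrelevant.\<close>

record 'a unbounded_op =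
  op_dom :: "'a set"
  op_app :: "'a \<Rightarrow> 'a"

definition densely_defined :: "'a::chilbert_space set \<Rightarrow> 'a unbounded_op \<Rightarrow> bool" where
  "densely_defined H A \<longleftrightarrow>
     cvec.subspace (op_dom A) \<and> op_dom A \<subseteq> H \<and> H \<subseteq> closure (op_dom A) \<and>
     op_app A ` op_dom A \<subseteq> H \<and> clinear_on (op_dom A) (op_app A)"

definition op_graph :: "'a::chilbert_space unbounded_op \<Rightarrow> ('a \<times> 'a) set" where
  "op_graph A = {(x, op_app A x) | x. x \<in> op_dom A}"

text \<open>The graph of the Hilbert space adjoint of \<open>A\<close>.\<close>

definition adjoint_graph ::
    "'a::chilbert_space set \<Rightarrow> 'a unbounded_op \<Rightarrow> ('a \<times> 'a) set" where
  "adjoint_graph H A =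
     {(y, w). y \<in> H \<and> w \<in> H \<and> (\<forall>x\<in>op_dom A. cinner y (op_app A x) = cinner w x)}"

definition self_adjoint :: "'a::chilbert_space set \<Rightarrow> 'a unbounded_op \<Rightarrow> bool" where
  "self_adjoint H A \<longleftrightarrow> densely_defined H A \<and> adjoint_graph H A = op_graph A"

text \<open>\<open>R\<^sub>A(z) = (A - z)\<^sup>-\<^sup>1\<close>\<close>

definition resolvent :: "'a::chilbert_space unbounded_op \<Rightarrow> complex \<Rightarrow> 'a \<Rightarrow> 'a" where
  "resolvent A z = inv_into (op_dom A) (\<lambda>x. op_app A x - z *\<^sub>C x)"

definition resolvent_set ::
    "'a::chilbert_space set \<Rightarrow> 'a unbounded_op \<Rightarrow> complex set" where
  "resolvent_set H A =
     {z. bij_betw (\<lambda>x. op_app A x - z *\<^sub>C x) (op_dom A) H \<and>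
         resolvent A z \<in> bounded_operators H H}"

definition spectrum :: "'a::chilbert_space set \<Rightarrow> 'a unbounded_op \<Rightarrow> complex set" where
  "spectrum H A = - resolvent_set H A"

section \<open>Spectral projections and the essential spectrum\<close>

definition orthogonal_projection ::
    "'a::chilbert_space set \<Rightarrow> ('a \<Rightarrow> 'a) \<Rightarrow> bool" where
  "orthogonal_projection H Q \<longleftrightarrow>
     Q \<in> bounded_operators H H \<and> (\<forall>x\<in>H. Q (Q x) = Q x) \<and>
     (\<forall>x\<in>H. \<forall>y\<in>H. cinner (Q x) y = cinner x (Q y))"

text \<open>Only the values on Borel sets matter.\<close>

definition projection_valued_measure ::
    "'a::chilbert_space set \<Rightarrow> (real set \<Rightarrow> 'a \<Rightarrow> 'a) \<Rightarrow> bool" where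
  "projection_valued_measure H P \<longleftrightarrow>
     (\<forall>\<Omega>\<in>sets borel. orthogonal_projection H (P \<Omega>)) \<and>
     (\<forall>x\<in>H. P UNIV x = x) \<and>
     (\<forall>\<Omega>. range \<Omega> \<subseteq> sets borel \<longrightarrow> disjoint_family \<Omega> \<longrightarrow>
        (\<forall>x\<in>H. (\<lambda>k. P (\<Omega> k) x) sums P (\<Union>k::nat. \<Omega> k) x))"

text \<open>The scalar measure \<open>\<mu>\<^sub>x(\<Omega>) = \<langle>x, P(\<Omega>) x\<rangle>\<close>.\<close>

definition scalar_measure ::
    "(real set \<Rightarrow> 'a \<Rightarrow> 'a) \<Rightarrow> 'a::chilbert_space \<Rightarrow> real measure" where
  "scalar_measure P x =
     measure_of UNIV (sets borel) (\<lambda>\<Omega>. ennreal (Re (cinner x (P \<Omega> x))))"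

text \<open>
  \<open>A = \<integral> \<lambda> dP(\<lambda>)\<close> in the usual sense: the domain of \<open>A\<close> consists of the \<open>x\<close> with
  \<open>\<integral> \<lambda>\<^sup>2 d\<mu>\<^sub>x < \<infinity>\<close>, and \<open>\<langle>x, A x\<rangle> = \<integral> \<lambda> d\<mu>\<^sub>x\<close> for these \<open>x\<close>.
\<close>

definition is_spectral_measure ::
    "'a::chilbert_space set \<Rightarrow> 'a unbounded_op \<Rightarrow> (real set \<Rightarrow> 'a \<Rightarrow> 'a) \<Rightarrow> bool" where
  "is_spectral_measure H A P \<longleftrightarrow>
     projection_valued_measure H P \<and>
     op_dom A = {x\<in>H. (\<integral>\<^sup>+ t. ennreal (t\<^sup>2) \<partial>scalar_measure P x) < \<infinity>} \<and>
     (\<forall>x\<in>op_dom A.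
        cinner x (op_app A x) = complex_of_real (\<integral> t. t \<partial>scalar_measure P x))"

text \<open>
  For self-adjoint \<open>A\<close> the spectral theorem says that such a \<open>P\<close> exists, and that it is unique on
  Borel sets and vectors of \<open>H\<close>. The choice operator (rather than a definite description) is used
  because the values of \<open>P\<close> elsewhere are arbitrary.
\<close>

definition spectral_projection ::
    "'a::chilbert_space set \<Rightarrow> 'a unbounded_op \<Rightarrow> real set \<Rightarrow> 'a \<Rightarrow> 'a" where
  "spectral_projection H A = (SOME P. is_spectral_measure H A P)"

definition essential_spectrum ::
    "'a::chilbert_space set \<Rightarrow> 'a unbounded_op \<Rightarrow> real set" where
  "essential_spectrum H A =
     {l. \<forall>\<epsilon>>0. infinite_dimensional (spectral_projection H A {l - \<epsilon><..<l + \<epsilon>} ` H)}"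

section \<open>Generalized norm resolvent convergence\<close>

definition resolvent_region ::
    "'a::chilbert_space set \<Rightarrow> 'a unbounded_op \<Rightarrow>
     (nat \<Rightarrow> 'b::chilbert_space set) \<Rightarrow> (nat \<Rightarrow> 'b unbounded_op) \<Rightarrow> complex set" where
  "resolvent_region H A Hn An = - closure (spectrum H A \<union> (\<Union>n. spectrum (Hn n) (An n)))"

text \<open>
  \<open>\<parallel>J\<^sub>n\<^sup>*J\<^sub>n - I\<parallel> = \<parallel>J\<^sub>nJ\<^sub>n\<^sup>* - I\<parallel> \<rightarrow> 0\<close> is read as: both norms tend to zero. They then
  coincide automatically as soon as they are less than one; equality is not demanded for the
  remaining finitely many \<open>n\<close>.
\<close>

definition generalized_norm_resolvent_convergent ::
    "'a::chilbert_space set \<Rightarrow> 'a unbounded_op \<Rightarrow>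
     (nat \<Rightarrow> 'b::chilbert_space set) \<Rightarrow> (nat \<Rightarrow> 'b unbounded_op) \<Rightarrow>
     (nat \<Rightarrow> 'a \<Rightarrow> 'b) \<Rightarrow> bool" where
  "generalized_norm_resolvent_convergent H A Hn An J \<longleftrightarrow>
     (\<exists>C>0. \<forall>n. onorm_on H (J n) \<le> C) \<and>
     (\<lambda>n. onorm_on H (\<lambda>x. adjoint_on H (J n) (J n x) - x)) \<longlonglongrightarrow> 0 \<and>
     (\<lambda>n. onorm_on (Hn n) (\<lambda>y. J n (adjoint_on H (J n) y) - y)) \<longlonglongrightarrow> 0 \<and>
     (\<exists>z\<in>resolvent_region H A Hn An.
        (\<lambda>n. onorm_on H (\<lambda>x. adjoint_on H (J n) (resolvent (An n) z (J n x)) - resolvent A z x))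
          \<longlonglongrightarrow> 0)"

text \<open>
  Limits of sequences \<open>\<lambda>\<^sub>n \<in> S\<^sub>n\<close>, where membership is required for all sufficiently large \<open>n\<close>:
  finitely many of the sets may be empty without affecting the limit.
\<close>

definition lim_sets :: "(nat \<Rightarrow> real set) \<Rightarrow> real set" where
  "lim_sets S = {l. \<exists>s. (\<forall>\<^sub>F n in sequentially. s n \<in> S n) \<and> s \<longlonglongrightarrow> l}"

end

theory Submission
  imports Defs "HOL-Probability.Probability"
begin

text \<open>
  If \<open>s\<close> is in the essential spectrum of \<open>A\<close>, the spectral subspaces of \<open>A\<close> near \<open>s\<close> are
  infinite-dimensional spaces of approximate eigenvectors of \<open>R\<^sub>A(z)\<close>; an almost unitary map that almost
  intertwines \<open>R\<^sub>A(z)\<close> with \<open>R\<^sub>B(z)\<close> carries them to approximate eigenvectors of \<open>R\<^sub>B(z)\<close>, which is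
  impossible if the spectral projection of \<open>B\<close> near \<open>s\<close> has finite rank. This is applied to \<open>J\<^sub>n\<close> for one
  inclusion and to \<open>J\<^sub>n\<^sup>*\<close> for the other.

  The spectral projections are accessible only through the existence of a spectral measure, i.e. the spectral
  theorem. The moments \<open>\<langle>x, U\<^sup>k x\<rangle>\<close> of the Cayley transform \<open>U = (A - i)(A + i)\<^sup>-\<^sup>1\<close> are
  approximated by those of finite measures with Fejer weights, so Helly's theorem provides a measure
  \<open>\<mu>\<^sub>x\<close> on the circle. It has no mass at \<open>1\<close> by the mean ergodic theorem, which allows to transport it to
  the real line. The map from Laurent polynomials \<open>p\<close> to \<open>p(U)x\<close> is then isometric for \<open>L\<^sup>2(\<mu>\<^sub>x)\<close>:
  spectral projections of closed sets are strong limits of \<open>p\<^sub>j(U)\<close>, and a Dynkin argument gives those of Borel sets.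
\<close>

section \<open>Geometry of complex Hilbert spaces\<close>

text \<open>The forward inclusion is arranged so that only the resolvent of \<open>A\<close> has to
  be bounded; the backward one extracts a uniform bound for the resolvents of \<open>An n\<close>
  from the convergence itself, by absorbing a small multiple of the unknown norm. Both inclusions
  rest on one inequality at a fixed index, "1 is at most a quantity that tends to 0", so no limit of
  spectral projections in \<open>n\<close> is taken. \<open>spectral_projection\<close> is a choice
  and gives access to \<open>A\<close> only through its domain and quadratic form. Invariance of
  spectral subspaces and norm bounds for \<open>A - l\<close> are therefore derived from the form by
  polarization, for an arbitrary spectral measure; the measure constructed here only shows that the
  choice succeeds. Mass at the point 1 of the circle would be mass at infinity on the line. It is
  excluded because \<open>U - 1 = -2 i (A + i)^-1\<close> has the dense range
  \<open>op_dom A\<close>. The same L2 limit argument serves bounded functions (indicators) and the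
  unbounded \<open>s + i\<close>, which recovers the domain of \<open>A\<close>.\<close>

lemma cinner_add_left: "cinner (x + y) z = cinner x z + cinner y (z :: 'a::chilbert_space)"
  by (metis cinner_add_right cinner_commute complex_cnj_add)

lemma cinner_scaleC_left: "cinner (a *\<^sub>C x) y = cnj a * cinner x (y :: 'a::chilbert_space)"
  by (metis cinner_commute cinner_scaleC_right complex_cnj_mult)

lemma norm_scaleC: "norm (a *\<^sub>C x) = cmod a * norm (x :: 'a::chilbert_space)"
proof -
  have "complex_of_real ((norm (a *\<^sub>C x))\<^sup>2) = cnj a * a * complex_of_real ((norm x)\<^sup>2)"
    unfolding cinner_self[symmetric] by (simp add: cinner_scaleC_left cinner_scaleC_right)
  also have "\<dots> = complex_of_real ((cmod a * norm x)\<^sup>2)"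
    by (metis complex_norm_square mult.commute of_real_mult power_mult_distrib)
  finally have "(norm (a *\<^sub>C x))\<^sup>2 = (cmod a * norm x)\<^sup>2"
    unfolding of_real_eq_iff .
  thus ?thesis
    by (simp add: power2_eq_iff_nonneg)
qed

lemma norm_sq_diff:
  "(norm (x - y))\<^sup>2 = (norm x)\<^sup>2 - 2 * Re (cinner x y) + (norm (y :: 'a::chilbert_space))\<^sup>2"
proof -
  have neg: "cinner u (- v) = - cinner u v" "cinner (- v) u = - cinner v u" for u v :: 'a
    using cinner_scaleC_right[of u "-1" v] cinner_scaleC_left[of "-1" v u] by simp_all
  have "complex_of_real ((norm (x - y))\<^sup>2) = cinner (x + - y) (x + - y)"
    by (simp add: cinner_self)
  also have "\<dots> = cinner x x - cinner x y - cinner y x + cinner y y"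
    by (simp only: cinner_add_left cinner_add_right neg) (simp add: algebra_simps)
  finally have "(norm (x - y))\<^sup>2 = Re (cinner x x - cinner x y - cinner y x + cinner y y)"
    by (metis Re_complex_of_real)
  moreover have "Re (cinner y x) = Re (cinner x y)"
    by (subst cinner_commute) simp
  ultimately show ?thesis
    by (simp add: cinner_self)
qed

lemma cinner_cauchy_schwarz: "cmod (cinner x y) \<le> norm x * norm (y :: 'a::chilbert_space)"
proof (cases "y = 0")
  case True
  then show ?thesis
    using cinner_scaleC_right[of x 0 y] by simp
next
  case False
  define a where "a = cinner y x / complex_of_real ((norm y)\<^sup>2)"
  have ny: "(norm y)\<^sup>2 > 0"
    using False by simp
  have c: "cinner x (a *\<^sub>C y) = complex_of_real ((cmod (cinner x y))\<^sup>2 / (norm y)\<^sup>2)"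
    using complex_norm_square[of "cinner x y"] cinner_commute[of y x]
    by (simp add: cinner_scaleC_right a_def mult.commute)
  have n: "(norm (a *\<^sub>C y))\<^sup>2 = (cmod (cinner x y))\<^sup>2 / (norm y)\<^sup>2"
  proof -
    have "cmod a = cmod (cinner x y) / (norm y)\<^sup>2"
      using cinner_commute[of y x] by (simp add: a_def norm_divide norm_power)
    thus ?thesis
      using False by (simp add: norm_scaleC power2_eq_square)
  qed
  have "0 \<le> (norm (x - a *\<^sub>C y))\<^sup>2"
    by simp
  also have "\<dots> = (norm x)\<^sup>2 - (cmod (cinner x y))\<^sup>2 / (norm y)\<^sup>2"
    unfolding norm_sq_diff c n by simp
  finally have "(cmod (cinner x y))\<^sup>2 \<le> (norm x * norm y)\<^sup>2"
    using ny by (simp add: field_simps power_mult_distrib)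
  thus ?thesis
    by (meson mult_nonneg_nonneg norm_ge_zero power2_le_imp_le)
qed

interpretation cinner: bounded_bilinear "cinner :: 'a::chilbert_space \<Rightarrow> 'a \<Rightarrow> complex"
proof
  show "\<exists>K. \<forall>a b. cmod (cinner a b) \<le> norm (a::'a) * norm b * K"
    by (intro exI[of _ 1]) (simp add: cinner_cauchy_schwarz)
qed (simp_all add: cinner_add_left cinner_add_right scaleR_scaleC cinner_scaleC_left
    cinner_scaleC_right scaleR_conv_of_real)

interpretation scaleC: bounded_bilinear "scaleC :: complex \<Rightarrow> 'a::chilbert_space \<Rightarrow> 'a"
proof
  show "\<exists>K. \<forall>a b. norm (a *\<^sub>C b) \<le> norm a * norm (b::'a) * K"
    by (intro exI[of _ 1]) (simp add: norm_scaleC)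
qed (simp_all add: scaleC_add_left scaleC_add_right scaleR_scaleC scaleC_scaleC
    scaleR_conv_of_real mult.commute)

declare cinner.zero_left [simp] cinner.zero_right [simp] scaleC.zero_left [simp] scaleC.zero_right [simp]

lemma scaleC_one [simp]: "1 *\<^sub>C x = (x :: 'a::chilbert_space)"
  using scaleR_scaleC[of 1 x] by simp

lemma scaleC_minus_one [simp]: "(-1) *\<^sub>C x = - (x :: 'a::chilbert_space)"
  using scaleR_scaleC[of "-1" x] by simp

lemma norm_sq_add:
  "(norm (x + y))\<^sup>2 = (norm x)\<^sup>2 + 2 * Re (cinner x y) + (norm (y :: 'a::chilbert_space))\<^sup>2"
  using norm_sq_diff[of x "- y"] by (simp add: cinner.minus_right)

lemma Re_cinner_commute: "Re (cinner y x) = Re (cinner x (y :: 'a::chilbert_space))"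
  by (subst cinner_commute) simp

lemma Re_cinner_self: "Re (cinner x x) = (norm (x :: 'a::chilbert_space))\<^sup>2"
  by (simp add: cinner_self)

lemma cinner_eq_zero_commute: "cinner x y = 0 \<longleftrightarrow> cinner y (x :: 'a::chilbert_space) = 0"
  by (metis cinner_commute complex_cnj_zero_iff)

lemma cinner_self_eq_zero [simp]: "cinner x x = 0 \<longleftrightarrow> x = (0 :: 'a::chilbert_space)"
  by (simp add: cinner_self)

text \<open>Squared distances are what the Hilbert space identities control: for minimizing
  sequences, for L2 limits and for orthogonal series.\<close>

lemma convergent_if_sq_dist_le:
  fixes X :: "nat \<Rightarrow> 'a::chilbert_space"
  assumes le: "\<And>m n. (norm (X m - X n))\<^sup>2 \<le> E m + E n" and E: "E \<longlonglongrightarrow> 0"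
  shows "convergent X"
proof (intro Cauchy_convergent metric_CauchyI)
  fix e :: real assume e: "e > 0"
  hence "\<forall>\<^sub>F n in sequentially. E n < e\<^sup>2 / 2"
    by (intro order_tendstoD(2)[OF E]) simp
  then obtain N where N: "\<And>n. n \<ge> N \<Longrightarrow> E n < e\<^sup>2 / 2"
    by (auto simp: eventually_sequentially)
  have "dist (X m) (X n) < e" if "m \<ge> N" "n \<ge> N" for m n
  proof -
    have "(norm (X m - X n))\<^sup>2 < e\<^sup>2"
      using le[of m n] N[OF that(1)] N[OF that(2)] by argo
    thus ?thesis
      using e by (simp add: dist_norm power2_less_imp_less)
  qed
  thus "\<exists>N. \<forall>m\<ge>N. \<forall>n\<ge>N. dist (X m) (X n) < e"
    by blast
qed

lemma closed_subspace_projection: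
  fixes M :: "'a::chilbert_space set"
  assumes M: "cvec.subspace M" "closed M"
  obtains m where "m \<in> M" "\<And>y. y \<in> M \<Longrightarrow> cinner y (x - m) = 0"
proof -
  define d where "d = infdist x M"
  have ne: "M \<noteq> {}"
    using M(1) cvec.subspace_0 by blast
  have dle: "d \<le> norm (x - y)" if "y \<in> M" for y
    using infdist_le[OF that, of x] by (simp add: d_def dist_norm)
  have d0: "d \<ge> 0"
    by (simp add: d_def infdist_nonneg)
  have "\<exists>y\<in>M. norm (x - y) < d + inverse (Suc n)" for n :: nat
  proof (rule ccontr)
    assume "\<not> ?thesis"
    hence "d + inverse (real (Suc n)) \<le> infdist x M"
      unfolding infdist_notempty[OF ne] by (intro cINF_greatest ne) (auto simp: dist_norm not_less)
    thus False
      by (simp add: d_def)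
  qed
  then obtain m where m: "m n \<in> M" "norm (x - m n) < d + inverse (Suc n)" for n :: nat
    by metis
  have par: "(norm (m i - m j))\<^sup>2 \<le>
      2 * ((norm (x - m i))\<^sup>2 - d\<^sup>2) + 2 * ((norm (x - m j))\<^sup>2 - d\<^sup>2)" for i j
  proof -
    define u v where "u = x - m i" and "v = x - m j"
    \<comment> \<open>Parallelogram law for \<open>u\<close> and \<open>v\<close>: the midpoint of
      \<open>m i\<close> and \<open>m j\<close> lies in \<open>M\<close>, so \<open>|u + v|\<close>
      is at least \<open>2 d\<close>.\<close>
    have mid: "(1/2) *\<^sub>C (m i + m j) \<in> M"
      using M(1) m(1) by (simp add: cvec.subspace_add cvec.subspace_scale)
    have "x - (1/2) *\<^sub>C (m i + m j) = (1/2) *\<^sub>R (u + v)"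
      using scaleR_scaleC[of "1/2" "m i + m j"]
      using scaleR_half_double[of x] by (simp add: u_def v_def algebra_simps)
    with dle[OF mid] have "d \<le> norm (u + v) / 2"
      by simp
    hence "d\<^sup>2 \<le> (norm (u + v) / 2)\<^sup>2"
      using d0 by (intro power_mono)
    hence "4 * d\<^sup>2 \<le> (norm (u + v))\<^sup>2"
      by (simp add: power_divide)
    moreover have "m i - m j = v - u"
      by (simp add: u_def v_def)
    ultimately show ?thesis
      using norm_sq_add[of u v] norm_sq_diff[of v u] Re_cinner_commute[of u v]
      unfolding u_def[symmetric] v_def[symmetric] by simp
  qed
  have dlim: "(\<lambda>n. norm (x - m n)) \<longlonglongrightarrow> d"
  proof (rule tendsto_sandwich[where f = "\<lambda>_. d" and h = "\<lambda>n. d + inverse (real (Suc n))"])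
    show "(\<lambda>n. d + inverse (real (Suc n))) \<longlonglongrightarrow> d"
      using tendsto_add[OF tendsto_const LIMSEQ_inverse_real_of_nat, of d] by simp
    show "\<forall>\<^sub>F n in sequentially. d \<le> norm (x - m n)"
      using m(1) dle by (simp add: always_eventually)
    show "\<forall>\<^sub>F n in sequentially. norm (x - m n) \<le> d + inverse (real (Suc n))"
      using m(2) by (intro always_eventually allI less_imp_le)
  qed simp
  have "(\<lambda>n. 2 * ((norm (x - m n))\<^sup>2 - d\<^sup>2)) \<longlonglongrightarrow> 2 * (d\<^sup>2 - d\<^sup>2)"
    by (intro tendsto_intros dlim)
  hence "(\<lambda>n. 2 * ((norm (x - m n))\<^sup>2 - d\<^sup>2)) \<longlonglongrightarrow> 0"
    by simp
  from convergent_if_sq_dist_le[OF par this] obtain l where l: "m \<longlonglongrightarrow> l"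
    using convergent_def by blast
  have lM: "l \<in> M"
    using closed_sequentially[OF M(2)] m(1) l by blast
  have "(\<lambda>n. norm (x - m n)) \<longlonglongrightarrow> norm (x - l)"
    by (intro tendsto_intros l)
  with dlim have dl: "d = norm (x - l)"
    using LIMSEQ_unique by blast
  have "cinner y (x - l) = 0" if y: "y \<in> M" for y
  proof (cases "y = 0")
    case False
    define r where "r = x - l"
    \<comment> \<open>Moving \<open>l\<close> along \<open>y\<close> by this coefficient lowers the
      squared distance by \<open>|<y, r>|^2 / |y|^2\<close>, which minimality forbids unless it
      vanishes.\<close>
    define a where "a = cinner y r / complex_of_real ((norm y)\<^sup>2)"
    have ny: "(norm y)\<^sup>2 > 0"
      using False by simp
    have c: "cinner r (a *\<^sub>C y) = complex_of_real ((cmod (cinner y r))\<^sup>2 / (norm y)\<^sup>2)"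
      using complex_norm_square[of "cinner y r"] cinner_commute[of r y]
      by (simp add: cinner_scaleC_right a_def mult.commute)
    have n: "(norm (a *\<^sub>C y))\<^sup>2 = (cmod (cinner y r))\<^sup>2 / (norm y)\<^sup>2"
    proof -
      have "cmod a = cmod (cinner y r) / (norm y)\<^sup>2"
        by (simp add: a_def norm_divide norm_power)
      thus ?thesis
        using False by (simp add: norm_scaleC power2_eq_square)
    qed
    have "l + a *\<^sub>C y \<in> M"
      using M(1) lM y by (simp add: cvec.subspace_add cvec.subspace_scale)
    from dle[OF this] have "norm r \<le> norm (r - a *\<^sub>C y)"
      by (simp add: dl r_def diff_diff_eq)
    hence "(norm r)\<^sup>2 \<le> (norm (r - a *\<^sub>C y))\<^sup>2"
      by (intro power_mono) auto
    also have "\<dots> = (norm r)\<^sup>2 - (cmod (cinner y r))\<^sup>2 / (norm y)\<^sup>2"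
      unfolding norm_sq_diff c n by simp
    finally have "(cmod (cinner y r))\<^sup>2 / (norm y)\<^sup>2 \<le> 0"
      by simp
    hence "(cmod (cinner y r))\<^sup>2 \<le> 0"
      using ny by (simp add: divide_le_0_iff)
    thus ?thesis
      by (simp add: r_def)
  qed auto
  with lM that show ?thesis
    by blast
qed

lemma clinear_on_add: "clinear_on V f \<Longrightarrow> x \<in> V \<Longrightarrow> y \<in> V \<Longrightarrow> f (x + y) = f x + f y"
  and clinear_on_scale: "clinear_on V f \<Longrightarrow> x \<in> V \<Longrightarrow> f (c *\<^sub>C x) = c *\<^sub>C f x"
  by (simp_all add: clinear_on_def)

lemma clinear_on_diff:
  assumes "clinear_on V f" "cvec.subspace V" "x \<in> V" "y \<in> V"
  shows "f (x - y) = f x - f y"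
proof -
  have "(-1) *\<^sub>C y \<in> V"
    using assms by (intro cvec.subspace_scale)
  from clinear_on_add[OF assms(1,3) this] clinear_on_scale[OF assms(1,4), of "-1"] show ?thesis
    by simp
qed

lemma clinear_on_zero:
  assumes "clinear_on V f" "cvec.subspace V"
  shows "f 0 = 0"
  using clinear_on_scale[OF assms(1) cvec.subspace_0[OF assms(2)], of 0] by simp

text \<open>The kernel has codimension at most one, so a vector \<open>v\<close> orthogonal to it
  carries the whole functional; \<open>w\<close> is the multiple of \<open>v\<close> with the right
  value at \<open>v\<close>.\<close>

lemma riesz_representation:
  fixes \<phi> :: "'a::chilbert_space \<Rightarrow> complex"
  assumes H: "hilbert_space H"
    and add: "\<And>x y. x \<in> H \<Longrightarrow> y \<in> H \<Longrightarrow> \<phi> (x + y) = \<phi> x + \<phi> y"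
    and scale: "\<And>c x. x \<in> H \<Longrightarrow> \<phi> (c *\<^sub>C x) = c * \<phi> x"
    and bdd: "\<And>x. x \<in> H \<Longrightarrow> cmod (\<phi> x) \<le> C * norm x"
  obtains w where "w \<in> H" "\<And>x. x \<in> H \<Longrightarrow> \<phi> x = cinner w x"
proof -
  have sub: "cvec.subspace H" and cl: "closed H"
    using H by (auto simp: hilbert_space_def)
  have diff: "\<phi> (x - y) = \<phi> x - \<phi> y" if "x \<in> H" "y \<in> H" for x y
    using add[of x "(-1) *\<^sub>C y"] scale[of y "-1"] that cvec.subspace_scale[OF sub, of y "-1"]
    by simp
  define M where "M = {x \<in> H. \<phi> x = 0}"
  have "cvec.subspace M"
    unfolding cvec.subspace_def M_def
    using cvec.subspace_0[OF sub] cvec.subspace_add[OF sub] cvec.subspace_scale[OF sub]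
      add scale scale[of 0 0] by auto
  moreover have "closed M"
    unfolding closed_sequential_limits
  proof safe
    fix f l assume f: "\<forall>n. f n \<in> M" "f \<longlonglongrightarrow> l"
    hence lH: "l \<in> H"
      using closed_sequentially[OF cl] by (auto simp: M_def)
    have "(\<lambda>n. C * norm (f n - l)) \<longlonglongrightarrow> C * norm (l - l)"
      by (intro tendsto_intros f)
    moreover have "cmod (\<phi> l) \<le> C * norm (f n - l)" for n
      using bdd[of "f n - l"] diff[of "f n" l] f(1) lH cvec.subspace_diff[OF sub, of "f n" l]
      by (auto simp: M_def)
    ultimately have "cmod (\<phi> l) \<le> C * norm (l - l)"
      by (intro LIMSEQ_le_const) auto
    thus "l \<in> M"
      using lH by (simp add: M_def)
  qed
  ultimately have M: "cvec.subspace M" "closed M"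
    by auto
  show ?thesis
  proof (cases "M = H")
    case True
    hence "\<phi> x = cinner 0 x" if "x \<in> H" for x
      using that unfolding M_def cinner.zero_left by blast
    then show ?thesis
      using that[of 0] cvec.subspace_0[OF sub] by blast
  next
    case False
    then obtain u where u: "u \<in> H" "\<phi> u \<noteq> 0"
      by (auto simp: M_def)
    obtain m where m: "m \<in> M" "\<And>y. y \<in> M \<Longrightarrow> cinner y (u - m) = 0"
      using closed_subspace_projection[OF M] by blast
    define v where "v = u - m"
    have mH: "m \<in> H" "\<phi> m = 0"
      using m(1) by (auto simp: M_def)
    have v: "v \<in> H" "\<phi> v \<noteq> 0"
      using u mH diff cvec.subspace_diff[OF sub] by (auto simp: v_def)
    have nv: "cinner v v \<noteq> 0"
      using v(2) scale[of 0 0] cvec.subspace_0[OF sub] by auto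
    define w where "w = cnj (\<phi> v / cinner v v) *\<^sub>C v"
    have "\<phi> x = cinner w x" if x: "x \<in> H" for x
    proof -
      define y where "y = x - (\<phi> x / \<phi> v) *\<^sub>C v"
      have "y \<in> M"
        using x v diff scale cvec.subspace_diff[OF sub] cvec.subspace_scale[OF sub]
        by (simp add: y_def M_def)
      from m(2)[OF this] have "cinner v y = 0"
        by (simp add: v_def cinner_eq_zero_commute)
      hence "cinner v x = \<phi> x / \<phi> v * cinner v v"
        by (simp add: y_def cinner.diff_right cinner_scaleC_right)
      thus ?thesis
        using nv v(2) by (simp add: w_def cinner_scaleC_left)
    qed
    moreover have "w \<in> H"
      using v cvec.subspace_scale[OF sub] by (simp add: w_def)
    ultimately show ?thesis
      using that by blast
  qed
qed

lemma cinner_eqI: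
  fixes H :: "'a::chilbert_space set"
  assumes "cvec.subspace H" "u \<in> H" "v \<in> H" "\<And>x. x \<in> H \<Longrightarrow> cinner x u = cinner x v"
  shows "u = v"
proof -
  have "cinner (u - v) (u - v) = 0"
    using assms(4)[of "u - v"] cvec.subspace_diff[OF assms(1-3)] by (simp add: cinner.diff_right)
  thus ?thesis
    by simp
qed

lemma cinner_eqI_dense:
  fixes H :: "'a::chilbert_space set"
  assumes "H \<subseteq> closure D" "u \<in> H" "v \<in> H" "cvec.subspace H"
    and "\<And>x. x \<in> D \<Longrightarrow> cinner x u = cinner x v"
  shows "u = v"
proof (rule cinner_eqI[OF assms(4,2,3)])
  fix x assume "x \<in> H"
  then obtain f where f: "\<And>n. f n \<in> D" "f \<longlonglongrightarrow> x"
    using assms(1) closure_sequential by blast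
  have "(\<lambda>n. cinner (f n) u) \<longlonglongrightarrow> cinner x u" "(\<lambda>n. cinner (f n) v) \<longlonglongrightarrow> cinner x v"
    by (intro cinner.tendsto f tendsto_const)+
  moreover have "cinner (f n) u = cinner (f n) v" for n
    using assms(5)[OF f(1)] .
  ultimately show "cinner x u = cinner x v"
    using LIMSEQ_unique by auto
qed

text \<open>Complex polarization: testing with \<open>x + y\<close> and \<open>x + i y\<close>
  isolates \<open><y, D x>\<close>. This gives uniqueness of spectral projections, which are known
  by their forms.\<close>

lemma quadratic_form_zero:
  fixes D :: "'a::chilbert_space \<Rightarrow> 'a"
  assumes H: "cvec.subspace H" and D: "clinear_on H D" "\<And>x. x \<in> H \<Longrightarrow> D x \<in> H"
    and q: "\<And>x. x \<in> H \<Longrightarrow> cinner x (D x) = 0" and x: "x \<in> H"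
  shows "D x = 0"
proof -
  have "cinner y (D x) = 0" if y: "y \<in> H" for y
  proof -
    have iy: "\<i> *\<^sub>C y \<in> H"
      using cvec.subspace_scale[OF H y] .
    have "cinner (x + y) (D (x + y)) = 0" "cinner (x + \<i> *\<^sub>C y) (D (x + \<i> *\<^sub>C y)) = 0"
      using q cvec.subspace_add[OF H] x y iy by blast+
    hence "cinner x (D y) + cinner y (D x) = 0" "\<i> * cinner x (D y) - \<i> * cinner y (D x) = 0"
      using q[OF x] q[OF y]
      by (simp_all add: clinear_on_add[OF D(1) x y] clinear_on_add[OF D(1) x iy]
          clinear_on_scale[OF D(1) y] cinner.add_left cinner.add_right cinner_scaleC_left
          cinner_scaleC_right)
    hence "cinner y (D x) = - cinner x (D y)" "cinner y (D x) = cinner x (D y)"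
      by (auto simp: add_eq_0_iff)
    thus ?thesis
      by simp
  qed
  from this[OF D(2)[OF x]] show ?thesis
    by simp
qed

lemma isometry_cinner:
  fixes D :: "'a::chilbert_space \<Rightarrow> 'b::chilbert_space"
  assumes H: "cvec.subspace H" and D: "clinear_on H D"
    and iso: "\<And>x. x \<in> H \<Longrightarrow> norm (D x) = norm x" and x: "x \<in> H" and y: "y \<in> H"
  shows "cinner (D x) (D y) = cinner x y"
proof -
  have Re: "Re (cinner (D x) (D z)) = Re (cinner x z)" if z: "z \<in> H" for z
    using norm_sq_add[of x z] norm_sq_add[of "D x" "D z"] iso[OF cvec.subspace_add[OF H x z]]
      iso[OF x] iso[OF z] clinear_on_add[OF D x z] by simp
  have "Re (cinner (D x) (D (\<i> *\<^sub>C y))) = Re (cinner x (\<i> *\<^sub>C y))"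
    by (intro Re cvec.subspace_scale H y)
  hence "Im (cinner (D x) (D y)) = Im (cinner x y)"
    by (simp add: clinear_on_scale[OF D y] cinner_scaleC_right)
  with Re[OF y] show ?thesis
    by (simp add: complex_eq_iff)
qed

section \<open>Bounded operators, adjoints and norms\<close>

lemma bounded_operatorsD:
  assumes "T \<in> bounded_operators H K"
  shows "x \<in> H \<Longrightarrow> T x \<in> K" "clinear_on H T"
    "\<exists>C\<ge>0. \<forall>x\<in>H. norm (T x) \<le> C * norm x"
proof -
  obtain C where C: "\<forall>x\<in>H. norm (T x) \<le> C * norm x"
    using assms by (auto simp: bounded_operators_def)
  have "norm (T x) \<le> max C 0 * norm x" if "x \<in> H" for x
    using C that by (meson max.cobounded1 mult_right_mono norm_ge_zero order_trans)
  thus "\<exists>C\<ge>0. \<forall>x\<in>H. norm (T x) \<le> C * norm x"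
    by (intro exI[of _ "max C 0"]) auto
qed (use assms in \<open>auto simp: bounded_operators_def\<close>)

lemma bounded_operators_tendsto:
  assumes T: "T \<in> bounded_operators H K" and H: "cvec.subspace H"
    and f: "f \<longlonglongrightarrow> l" "\<And>n. f n \<in> H" "l \<in> H"
  shows "(\<lambda>n. T (f n)) \<longlonglongrightarrow> T l"
proof -
  obtain C where C: "C \<ge> 0" "\<And>x. x \<in> H \<Longrightarrow> norm (T x) \<le> C * norm x"
    using bounded_operatorsD(3)[OF T] by auto
  have "(\<lambda>n. C * norm (f n - l)) \<longlonglongrightarrow> C * norm (l - l)"
    by (intro tendsto_intros f)
  hence lim: "(\<lambda>n. C * norm (f n - l)) \<longlonglongrightarrow> 0"
    by simp
  have "norm (T (f n) - T l) \<le> C * norm (f n - l)" for n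
    using C(2)[OF cvec.subspace_diff[OF H f(2)[of n] f(3)]]
      clinear_on_diff[OF bounded_operatorsD(2)[OF T] H f(2)[of n] f(3)] by simp
  hence "(\<lambda>n. T (f n) - T l) \<longlonglongrightarrow> 0"
    by (intro Lim_null_comparison[OF always_eventually lim]) auto
  thus ?thesis
    by (rule LIM_zero_cancel)
qed

text \<open>The real supremum dominates the quotients only if these are bounded at all, hence the a
  priori constant \<open>C\<close>. At 0 the quotient is 0 by the convention for division.\<close>

lemma onorm_on_bound:
  fixes T :: "'a::chilbert_space \<Rightarrow> 'b::chilbert_space"
  assumes T: "\<And>x. x \<in> H \<Longrightarrow> norm (T x) \<le> C * norm x" and x: "x \<in> H"
  shows "norm (T x) \<le> onorm_on H T * norm x"
proof (cases "x = 0")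
  case True
  then show ?thesis
    using T[OF x] by simp
next
  case False
  have "norm (T y) / norm y \<le> max C 0" if "y \<in> H" for y
    using T[OF that] by (cases "y = 0") (auto simp: divide_le_eq le_max_iff_disj)
  hence "norm (T x) / norm x \<le> onorm_on H T"
    unfolding onorm_on_def by (intro cSUP_upper x bdd_aboveI2[where M = "max C 0"])
  thus ?thesis
    using False by (simp add: divide_le_eq)
qed

lemma onorm_on_least:
  assumes "H \<noteq> {}" "c \<ge> 0" "\<And>x. x \<in> H \<Longrightarrow> norm (T x) \<le> c * norm x"
  shows "onorm_on H T \<le> c"
  unfolding onorm_on_def
proof (rule cSUP_least[OF assms(1)])
  fix x assume "x \<in> H"
  thus "norm (T x) / norm x \<le> c"
    using assms(2,3) by (cases "x = 0") (auto simp: divide_le_eq)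
qed

lemma onorm_on_nonneg:
  assumes "0 \<in> H" "\<And>x. x \<in> H \<Longrightarrow> norm (T x) \<le> c * norm x"
  shows "0 \<le> onorm_on H T"
proof -
  have "norm (T y) / norm y \<le> max c 0" if "y \<in> H" for y
    using assms(2)[OF that] by (cases "y = 0") (auto simp: divide_le_eq le_max_iff_disj)
  hence "norm (T 0) / norm (0 :: 'a) \<le> onorm_on H T"
    unfolding onorm_on_def by (intro cSUP_upper assms(1) bdd_aboveI2[where M = "max c 0"])
  thus ?thesis
    by simp
qed

text \<open>Riesz applied to \<open>x |-> <y, T x>\<close>, which is bounded for every
  \<open>y\<close> of the type and not only for \<open>y\<close> in \<open>K\<close>; so the adjoint
  is linear everywhere.\<close>

lemma adjoint_on_works:
  fixes T :: "'a::chilbert_space \<Rightarrow> 'b::chilbert_space"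
  assumes H: "hilbert_space H" and T: "T \<in> bounded_operators H K"
  shows "adjoint_on H T y \<in> H" "\<And>x. x \<in> H \<Longrightarrow> cinner (T x) y = cinner x (adjoint_on H T y)"
proof -
  obtain C where C: "C \<ge> 0" "\<And>x. x \<in> H \<Longrightarrow> norm (T x) \<le> C * norm x"
    using bounded_operatorsD(3)[OF T] by auto
  have sub: "cvec.subspace H"
    using H by (simp add: hilbert_space_def)
  obtain w where w: "w \<in> H" "\<And>x. x \<in> H \<Longrightarrow> cinner y (T x) = cinner w x"
  proof (rule riesz_representation[OF H, of "\<lambda>x. cinner y (T x)" "norm y * C"])
    fix x assume "x \<in> H"
    show "cmod (cinner y (T x)) \<le> norm y * C * norm x"
      using cinner_cauchy_schwarz[of y "T x"] C(2)[OF \<open>x \<in> H\<close>]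
      by (metis mult.assoc mult_left_mono norm_ge_zero order_trans)
  qed (use bounded_operatorsD(2)[OF T] in
      \<open>auto simp: clinear_on_def cinner.add_right cinner_scaleC_right\<close>)
  have *: "cinner (T x) y = cinner x w" if "x \<in> H" for x
    using w(2)[OF that] cinner_commute by metis
  have "\<exists>!w. w \<in> H \<and> (\<forall>x\<in>H. cinner (T x) y = cinner x w)"
    using w(1) * by (intro ex1I[of _ w]) (auto intro: cinner_eqI[OF sub])
  from theI'[OF this] show "adjoint_on H T y \<in> H"
    "\<And>x. x \<in> H \<Longrightarrow> cinner (T x) y = cinner x (adjoint_on H T y)"
    unfolding adjoint_on_def by auto
qed

lemma adjoint_on_linear:
  fixes T :: "'a::chilbert_space \<Rightarrow> 'b::chilbert_space"
  assumes H: "hilbert_space H" and T: "T \<in> bounded_operators H K"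
  shows "clinear_on V (adjoint_on H T)"
proof -
  note adj = adjoint_on_works[OF H T]
  have sub: "cvec.subspace H"
    using H by (simp add: hilbert_space_def)
  show ?thesis
    unfolding clinear_on_def
  proof safe
    fix x y
    show "adjoint_on H T (x + y) = adjoint_on H T x + adjoint_on H T y"
    proof (rule cinner_eqI[OF sub])
      fix u assume "u \<in> H"
      thus "cinner u (adjoint_on H T (x + y)) = cinner u (adjoint_on H T x + adjoint_on H T y)"
        by (simp only: cinner.add_right adj(2)[symmetric])
    qed (use adj(1) cvec.subspace_add[OF sub] in blast)+
  next
    fix c x
    show "adjoint_on H T (c *\<^sub>C x) = c *\<^sub>C adjoint_on H T x"
    proof (rule cinner_eqI[OF sub])
      fix u assume "u \<in> H"
      thus "cinner u (adjoint_on H T (c *\<^sub>C x)) = cinner u (c *\<^sub>C adjoint_on H T x)"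
        by (simp only: cinner_scaleC_right adj(2)[symmetric])
    qed (use adj(1) cvec.subspace_scale[OF sub] in blast)+
  qed
qed

lemma adjoint_on_bound:
  fixes T :: "'a::chilbert_space \<Rightarrow> 'b::chilbert_space"
  assumes H: "hilbert_space H" and T: "T \<in> bounded_operators H K" and "C \<ge> 0"
    and C: "\<And>x. x \<in> H \<Longrightarrow> norm (T x) \<le> C * norm x"
  shows "norm (adjoint_on H T y) \<le> C * norm y"
proof -
  define w where "w = adjoint_on H T y"
  note adj = adjoint_on_works[OF H T, where y = y, folded w_def]
  have "(norm w)\<^sup>2 = cmod (cinner (T w) y)"
    using adj by (simp add: cinner_self norm_power)
  also have "\<dots> \<le> norm (T w) * norm y"
    by (rule cinner_cauchy_schwarz)
  also have "\<dots> \<le> C * norm w * norm y"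
    using C[OF adj(1)] by (intro mult_right_mono) auto
  finally have "norm w * norm w \<le> (C * norm y) * norm w"
    by (simp add: power2_eq_square algebra_simps)
  thus ?thesis
    using \<open>C \<ge> 0\<close> unfolding w_def[symmetric] by (cases "w = 0") auto
qed

section \<open>The Cayley transform of a self-adjoint operator\<close>

locale self_adjoint_operator =
  fixes H :: "'a::chilbert_space set" and A :: "'a unbounded_op"
  assumes hilbert: "hilbert_space H" and self_adj: "self_adjoint H A"
begin

lemma subspace_H: "cvec.subspace H" and closed_H: "closed H"
  using hilbert by (auto simp: hilbert_space_def)

lemma subspace_dom: "cvec.subspace (op_dom A)"
  and dom_H: "x \<in> op_dom A \<Longrightarrow> x \<in> H"
  and dom_dense: "H \<subseteq> closure (op_dom A)"
  and app_H: "x \<in> op_dom A \<Longrightarrow> op_app A x \<in> H"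
  and app_linear: "clinear_on (op_dom A) (op_app A)"
  using self_adj by (auto simp: self_adjoint_def densely_defined_def)

lemmas H_add = cvec.subspace_add[OF subspace_H]
  and H_diff = cvec.subspace_diff[OF subspace_H]
  and H_scale = cvec.subspace_scale[OF subspace_H]
  and H_zero = cvec.subspace_0[OF subspace_H]
  and dom_add = cvec.subspace_add[OF subspace_dom]
  and dom_diff = cvec.subspace_diff[OF subspace_dom]
  and dom_scale = cvec.subspace_scale[OF subspace_dom]
  and dom_zero = cvec.subspace_0[OF subspace_dom]
  and app_add = clinear_on_add[OF app_linear]
  and app_scale = clinear_on_scale[OF app_linear]
  and app_diff = clinear_on_diff[OF app_linear subspace_dom]

lemma symmetric:
  assumes "x \<in> op_dom A" "y \<in> op_dom A"
  shows "cinner y (op_app A x) = cinner (op_app A y) x"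
proof -
  have "(y, op_app A y) \<in> adjoint_graph H A"
    using self_adj assms(2) by (auto simp: self_adjoint_def op_graph_def)
  thus ?thesis
    using assms(1) by (auto simp: adjoint_graph_def)
qed

lemma dom_adjointI:
  assumes "y \<in> H" "w \<in> H" "\<And>x. x \<in> op_dom A \<Longrightarrow> cinner y (op_app A x) = cinner w x"
  shows "y \<in> op_dom A" "op_app A y = w"
proof -
  have "(y, w) \<in> op_graph A"
    using self_adj assms by (auto simp: self_adjoint_def adjoint_graph_def)
  thus "y \<in> op_dom A" "op_app A y = w"
    by (auto simp: op_graph_def)
qed

text \<open>The relation that defines the adjoint survives limits, and for a self-adjoint operator
  it is the graph itself.\<close>

lemma app_closed:
  assumes f: "\<And>n::nat. f n \<in> op_dom A" "f \<longlonglongrightarrow> x" "(\<lambda>n. op_app A (f n)) \<longlonglongrightarrow> y"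
  shows "x \<in> op_dom A" "op_app A x = y"
proof -
  have xy: "x \<in> H" "y \<in> H"
    using closed_sequentially[OF closed_H, OF _ f(2)] closed_sequentially[OF closed_H, OF _ f(3)]
      dom_H[OF f(1)] app_H[OF f(1)] by auto
  have *: "cinner x (op_app A u) = cinner y u" if "u \<in> op_dom A" for u
  proof -
    have "(\<lambda>n. cinner (f n) (op_app A u)) \<longlonglongrightarrow> cinner x (op_app A u)"
      "(\<lambda>n. cinner (op_app A (f n)) u) \<longlonglongrightarrow> cinner y u"
      by (intro cinner.tendsto f tendsto_const)+
    moreover have "cinner (f n) (op_app A u) = cinner (op_app A (f n)) u" for n
      by (intro symmetric f that)
    ultimately show ?thesis
      using LIMSEQ_unique by auto
  qed
  show "x \<in> op_dom A"
    by (rule dom_adjointI(1)[OF xy *])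
  show "op_app A x = y"
    by (rule dom_adjointI(2)[OF xy *])
qed

lemma cinner_app_real: "x \<in> op_dom A \<Longrightarrow> Im (cinner x (op_app A x)) = 0"
proof -
  assume x: "x \<in> op_dom A"
  have "cinner x (op_app A x) = cnj (cinner x (op_app A x))"
    using symmetric[OF x x] cinner_commute[of "op_app A x" x] by simp
  thus ?thesis
    by (metis Reals_cnj_iff complex_is_Real_iff)
qed

text \<open>This is \<open>A + c\<close>. The side conditions \<open>Re c = 0\<close> and
  \<open>cmod c = 1\<close> below mean that \<open>c\<close> is i or -i, so both signs share one
  proof.\<close>

definition shift :: "complex \<Rightarrow> 'a \<Rightarrow> 'a" where
  "shift c x = op_app A x + c *\<^sub>C x"

lemma shift_linear: "clinear_on (op_dom A) (shift c)"
  by (simp add: clinear_on_def shift_def app_add app_scale scaleC_add_right scaleC_scaleC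
      mult.commute)

lemma shift_H: "x \<in> op_dom A \<Longrightarrow> shift c x \<in> H"
  by (simp add: shift_def H_add H_scale app_H dom_H)

text \<open>The cross term is purely imaginary because \<open><x, A x>\<close> is real. The right
  side does not see the sign of \<open>c\<close>, which is why the Cayley transform is
  isometric.\<close>

lemma norm_shift:
  assumes x: "x \<in> op_dom A" and c: "Re c = 0" "cmod c = 1"
  shows "(norm (shift c x))\<^sup>2 = (norm (op_app A x))\<^sup>2 + (norm x)\<^sup>2"
proof -
  have "Re (cinner (op_app A x) (c *\<^sub>C x)) = 0"
    using cinner_app_real[OF x] symmetric[OF x x] c by (simp add: cinner_scaleC_right)
  thus ?thesis
    using c(2) by (simp add: shift_def norm_sq_add norm_scaleC)
qed

lemma shift_inj:
  assumes c: "Re c = 0" "cmod c = 1"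
  shows "inj_on (shift c) (op_dom A)"
proof (rule inj_onI)
  fix x y assume xy: "x \<in> op_dom A" "y \<in> op_dom A" "shift c x = shift c y"
  hence "shift c (x - y) = 0"
    using clinear_on_diff[OF shift_linear subspace_dom] by simp
  hence "(norm (x - y))\<^sup>2 = 0"
    using norm_shift[OF dom_diff[OF xy(1,2)] c] by (simp add: add_nonneg_eq_0_iff)
  thus "x = y"
    by simp
qed

text \<open>\<open>norm_shift\<close> bounds \<open>A + c\<close> from below, so its range is
  closed. A vector orthogonal to the range would be an eigenvector of \<open>A\<close> with a
  nonreal eigenvalue.\<close>

lemma shift_surj:
  assumes c: "Re c = 0" "cmod c = 1"
  shows "shift c ` op_dom A = H"
proof -
  define M where "M = shift c ` op_dom A"
  note sdiff = clinear_on_diff[OF shift_linear subspace_dom]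
  have MH: "M \<subseteq> H"
    using shift_H by (auto simp: M_def)
  have M: "cvec.subspace M"
    unfolding cvec.subspace_def
  proof safe
    show "0 \<in> M"
      unfolding M_def using clinear_on_zero[OF shift_linear subspace_dom] dom_zero
      by (metis imageI)
    show "x + y \<in> M" if "x \<in> M" "y \<in> M" for x y
      using that clinear_on_add[OF shift_linear] dom_add by (auto simp: M_def image_iff) metis
    show "a *\<^sub>C x \<in> M" if "x \<in> M" for x a
      using that clinear_on_scale[OF shift_linear] dom_scale by (auto simp: M_def image_iff) metis
  qed
  have cl: "closed M"
    unfolding closed_sequential_limits
  proof safe
    fix g l assume g: "\<forall>n. g n \<in> M" "g \<longlonglongrightarrow> l"
    then obtain f where f: "\<And>n. f n \<in> op_dom A" "\<And>n. g n = shift c (f n)"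
      by (auto simp: M_def image_iff) metis
    have le: "norm (f i - f j) \<le> norm (g i - g j)" for i j
    proof -
      have "(norm (f i - f j))\<^sup>2 \<le> (norm (g i - g j))\<^sup>2"
        using norm_shift[OF dom_diff[OF f(1,1)] c] by (simp add: f sdiff)
      thus ?thesis
        by (rule power2_le_imp_le) simp
    qed
    have "Cauchy g"
      using g(2) LIMSEQ_imp_Cauchy by blast
    hence "Cauchy f"
      unfolding Cauchy_def dist_norm using le order_le_less_trans by meson
    then obtain x where x: "f \<longlonglongrightarrow> x"
      using Cauchy_convergent convergent_def by blast
    have "(\<lambda>n. g n - c *\<^sub>C f n) \<longlonglongrightarrow> l - c *\<^sub>C x"
      by (intro tendsto_diff g scaleC.tendsto tendsto_const x)
    hence "(\<lambda>n. op_app A (f n)) \<longlonglongrightarrow> l - c *\<^sub>C x"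
      by (simp add: f shift_def)
    from app_closed[OF f(1) x this] show "l \<in> M"
      unfolding M_def by (intro image_eqI[of _ _ x]) (auto simp: shift_def)
  qed
  have "x \<in> M" if x: "x \<in> H" for x
  proof -
    obtain m where m: "m \<in> M" "\<And>y. y \<in> M \<Longrightarrow> cinner y (x - m) = 0"
      using closed_subspace_projection[OF M cl] by blast
    define r where "r = x - m"
    have rH: "r \<in> H"
      using m(1) MH x H_diff by (auto simp: r_def)
    \<comment> \<open>Orthogonality to the range puts \<open>r\<close> into the domain of the
      adjoint, hence of \<open>A\<close>, with \<open>A r = - cnj c r\<close>.\<close>
    have "cinner r (op_app A u) = cinner (- cnj c *\<^sub>C r) u" if u: "u \<in> op_dom A" for u
    proof -
      have "cinner (shift c u) r = 0"
        unfolding r_def using u by (intro m(2)) (auto simp: M_def)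
      hence "cinner r (shift c u) = 0"
        using cinner_eq_zero_commute by blast
      thus ?thesis
        by (simp add: shift_def cinner.add_right cinner_scaleC_right cinner_scaleC_left
            cinner.minus_left add_eq_0_iff)
    qed
    note r = dom_adjointI[OF rH H_scale[OF rH] this]
    have "Im (- cnj c * complex_of_real ((norm r)\<^sup>2)) = 0"
      using cinner_app_real[OF r(1)] by (simp add: r(2) cinner.minus_right scaleC.minus_left cinner_scaleC_right cinner_self)
    hence "Im c * (norm r)\<^sup>2 = 0"
      by simp
    moreover have "Im c \<noteq> 0"
      using c by (auto simp: cmod_def)
    ultimately show ?thesis
      using m(1) by (simp add: r_def)
  qed
  with MH show ?thesis
    by (auto simp: M_def)
qed

definition shift_inv :: "complex \<Rightarrow> 'a \<Rightarrow> 'a" where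
  "shift_inv c = inv_into (op_dom A) (shift c)"

context
  fixes c assumes c: "Re c = 0" "cmod c = 1"
begin

lemma shift_inv_dom: "w \<in> H \<Longrightarrow> shift_inv c w \<in> op_dom A"
  unfolding shift_inv_def by (rule inv_into_into) (simp add: shift_surj[OF c])

lemma shift_shift_inv: "w \<in> H \<Longrightarrow> shift c (shift_inv c w) = w"
  unfolding shift_inv_def by (rule f_inv_into_f) (simp add: shift_surj[OF c])

lemma shift_inv_shift: "x \<in> op_dom A \<Longrightarrow> shift_inv c (shift c x) = x"
  unfolding shift_inv_def by (rule inv_into_f_f[OF shift_inj[OF c]])

lemma shift_inv_linear: "clinear_on H (shift_inv c)"
  unfolding clinear_on_def
proof safe
  fix x y assume "x \<in> H" "y \<in> H"
  thus "shift_inv c (x + y) = shift_inv c x + shift_inv c y"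
    by (metis clinear_on_add[OF shift_linear] dom_add shift_inv_dom shift_inv_shift shift_shift_inv)
next
  fix a x assume "x \<in> H"
  thus "shift_inv c (a *\<^sub>C x) = a *\<^sub>C shift_inv c x"
    by (metis clinear_on_scale[OF shift_linear] dom_scale shift_inv_dom shift_inv_shift
        shift_shift_inv)
qed

end

text \<open>This is \<open>(A - c) (A + c)^-1\<close>; the opposite sign of \<open>c\<close> gives
  the inverse operator.\<close>

definition cayley :: "complex \<Rightarrow> 'a \<Rightarrow> 'a" where
  "cayley c w = shift (- c) (shift_inv c w)"

context
  fixes c assumes c: "Re c = 0" "cmod c = 1"
begin

lemma cayley_H: "w \<in> H \<Longrightarrow> cayley c w \<in> H"
  by (simp add: cayley_def shift_H shift_inv_dom c)

lemma norm_cayley: 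
  assumes "w \<in> H"
  shows "norm (cayley c w) = norm w"
proof -
  have "(norm (cayley c w))\<^sup>2 = (norm (shift c (shift_inv c w)))\<^sup>2"
    using assms c by (simp add: cayley_def norm_shift shift_inv_dom)
  thus ?thesis
    using assms by (simp add: shift_shift_inv c power2_eq_iff_nonneg)
qed

lemma cayley_linear: "clinear_on H (cayley c)"
  using shift_inv_linear[OF c] shift_inv_dom[OF c] shift_linear[of "- c"]
  by (auto simp: clinear_on_def cayley_def)

lemma cayley_cayley: "w \<in> H \<Longrightarrow> cayley (- c) (cayley c w) = w"
  using c by (simp add: cayley_def shift_inv_shift shift_inv_dom shift_shift_inv)

text \<open>From \<open>A - c = (A + c) - 2 c\<close>. It identifies the range of
  \<open>cayley c - 1\<close> with the domain of \<open>A\<close> and makes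
  \<open>(A + c)^-1\<close> a polynomial in the Cayley transform.\<close>

lemma cayley_eq: "w \<in> H \<Longrightarrow> cayley c w = w - (2 * c) *\<^sub>C shift_inv c w"
proof -
  assume w: "w \<in> H"
  define x where "x = shift_inv c w"
  have "op_app A x = w - c *\<^sub>C x"
    using shift_shift_inv[OF c w] by (simp add: shift_def x_def eq_diff_eq)
  moreover have "(2 * c) *\<^sub>C x = c *\<^sub>C x + c *\<^sub>C x"
    by (simp only: mult_2 scaleC_add_left)
  ultimately show ?thesis
    by (simp add: cayley_def shift_def scaleC.minus_left flip: x_def)
qed

end

end

section \<open>Spectral measures of a unitary group\<close>

text \<open>A geometric sum over the powers of a nontrivial root of unity vanishes; the bound on
  \<open>d\<close> excludes nonzero multiples of \<open>n\<close>.\<close>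

lemma sum_cis_roots:
  fixes d :: int
  assumes n: "n > 0" and d: "\<bar>d\<bar> < int n"
  shows "(\<Sum>j<n. cis (2 * pi * real j / real n) powi d) = (if d = 0 then of_nat n else 0)"
proof (cases "d = 0")
  case False
  define z where "z = cis (2 * pi * real_of_int d / real n)"
  have eq: "cis (2 * pi * real j / real n) powi d = z ^ j" for j
  proof -
    have "of_int d * (2 * pi * real j / real n) = real j * (2 * pi * real_of_int d / real n)"
      by simp
    thus ?thesis
      by (simp only: z_def cis_power_int Complex.DeMoivre)
  qed
  have "z \<noteq> 1"
  proof
    assume "z = 1"
    then obtain m :: int where "2 * pi * real_of_int d / real n = of_int (2 * m) * pi"
      unfolding z_def cis_conv_exp exp_eq_1 by auto
    hence "real_of_int d = of_int (m * int n)"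
      using n by (simp add: field_simps)
    hence dm: "d = m * int n"
      using of_int_eq_iff by blast
    with False have "\<bar>m\<bar> \<ge> 1"
      by auto
    hence "int n \<le> \<bar>m\<bar> * int n"
      using mult_right_mono[of 1 "\<bar>m\<bar>" "int n"] by simp
    with d dm show False
      by (simp add: abs_mult)
  qed
  moreover have "z ^ n = 1"
    using n by (simp add: z_def Complex.DeMoivre)
  ultimately show ?thesis
    using False geometric_sum[of z n] by (simp add: eq)
qed auto

locale unitary_group =
  fixes H :: "'a::chilbert_space set" and V :: "int \<Rightarrow> 'a \<Rightarrow> 'a"
  assumes hilbert: "hilbert_space H"
    and V_H: "x \<in> H \<Longrightarrow> V k x \<in> H"
    and V_linear: "clinear_on H (V k)"
    and norm_V: "x \<in> H \<Longrightarrow> norm (V k x) = norm x"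
    and V_V: "x \<in> H \<Longrightarrow> V j (V k x) = V (j + k) x"
    and V_0: "x \<in> H \<Longrightarrow> V 0 x = x"
begin

lemma subspace_H: "cvec.subspace H" and closed_H: "closed H"
  using hilbert by (auto simp: hilbert_space_def)

lemmas H_add = cvec.subspace_add[OF subspace_H]
  and H_diff = cvec.subspace_diff[OF subspace_H]
  and H_scale = cvec.subspace_scale[OF subspace_H]
  and H_zero = cvec.subspace_0[OF subspace_H]
  and H_sum = cvec.subspace_sum[OF subspace_H]
  and V_add = clinear_on_add[OF V_linear]
  and V_scale = clinear_on_scale[OF V_linear]
  and V_diff = clinear_on_diff[OF V_linear subspace_H]

lemma cinner_V_V: "x \<in> H \<Longrightarrow> y \<in> H \<Longrightarrow> cinner (V k x) (V k y) = cinner x y"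
  by (rule isometry_cinner[OF subspace_H V_linear norm_V])

lemma cinner_V_left: "x \<in> H \<Longrightarrow> y \<in> H \<Longrightarrow> cinner (V k x) y = cinner x (V (- k) y)"
  using cinner_V_V[of x "V (- k) y" k] by (simp add: V_V V_H V_0)

text \<open>The Fejer weights of the moment sequence \<open>k \<mapsto> \<langle>x, V k x\<rangle>\<close>, sampled at roots of unity:
  positivity is manifest, and sampling at \<open>2 n\<close> points avoids aliasing.\<close>

definition fejer :: "nat \<Rightarrow> 'a \<Rightarrow> nat \<Rightarrow> real" where
  "fejer n x j =
     (norm (\<Sum>k<n. cis (2 * pi * real j / real (2 * n)) powi (- int k) *\<^sub>C V (int k) x))\<^sup>2 / (2 * (real n)\<^sup>2)"

text \<open>Expanding the square gives a sum over pairs \<open>k, l < n\<close>. Summing over the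
  sample points keeps only \<open>l = m + k\<close>, and there are \<open>n - m\<close> such pairs:
  this is the triangular factor \<open>1 - m / n\<close> of the Fejer kernel.\<close>

lemma fejer_moment:
  assumes x: "x \<in> H" and m: "m \<le> n" and n: "n > 0"
  shows "(\<Sum>j<2*n. fejer n x j *\<^sub>R cis (2 * pi * real j / real (2 * n)) powi (int m)) =
           complex_of_real ((real n - real m) / real n) * cinner x (V (int m) x)"
proof -
  define z where "z j = cis (2 * pi * real j / real (2 * n))" for j
  have z0: "z j \<noteq> 0" for j
    by (simp add: z_def)
  have cz: "cnj (z j powi i) = z j powi (- i)" for i j
    by (simp add: z_def cis_power_int cis_cnj)
  have sum1: "(\<Sum>j<2*n. z j powi d) = (if d = 0 then of_nat (2 * n) else 0)"
    if "\<bar>d\<bar> < int (2 * n)" for d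
    using sum_cis_roots[OF _ that] n by (simp add: z_def)
  have in_V: "cinner (V (int k) x) (V (int l) x) = cinner x (V (int l - int k) x)" for k l
    by (simp add: cinner_V_left x V_H V_V)
  have fej: "fejer n x j *\<^sub>R z j powi (int m) = (\<Sum>k<n. \<Sum>l<n. cinner x (V (int l - int k) x) *
      z j powi (int m + int k - int l)) / complex_of_real (2 * (real n)\<^sup>2)" for j
  proof -
    define S where "S = (\<Sum>k<n. z j powi (- int k) *\<^sub>C V (int k) x)"
    have "complex_of_real ((norm S)\<^sup>2) = cinner S S"
      by (simp add: cinner_self)
    also have "\<dots> = (\<Sum>k<n. \<Sum>l<n. z j powi (int k) * z j powi (- int l) *
        cinner x (V (int l - int k) x))"
      unfolding S_def cinner.sum_left unfolding cinner.sum_right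
      by (simp only: cinner_scaleC_left cinner_scaleC_right cz in_V mult_ac minus_minus)
    finally have "complex_of_real ((norm S)\<^sup>2) * z j powi (int m) =
        (\<Sum>k<n. \<Sum>l<n. cinner x (V (int l - int k) x) * z j powi (int m + int k - int l))"
      using z0[of j]
      by (simp add: sum_distrib_left sum_distrib_right power_int_add power_int_diff power_int_minus
          field_simps)
    moreover have "fejer n x j = (norm S)\<^sup>2 / (2 * (real n)\<^sup>2)"
      by (simp add: fejer_def S_def z_def)
    ultimately show ?thesis
      by (simp add: scaleR_conv_of_real)
  qed
  have "(\<Sum>j<2*n. fejer n x j *\<^sub>R z j powi (int m)) =
      (\<Sum>k<n. \<Sum>l<n. cinner x (V (int l - int k) x) * (\<Sum>j<2*n. z j powi (int m + int k - int l)))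
        / complex_of_real (2 * (real n)\<^sup>2)"
    unfolding fej sum_divide_distrib[symmetric] sum_distrib_left
    by (subst sum.swap, subst sum.swap) (simp add: sum.swap[of _ "{..<2*n}"])
  also have "(\<Sum>k<n. \<Sum>l<n. cinner x (V (int l - int k) x) *
      (\<Sum>j<2*n. z j powi (int m + int k - int l))) =
      (\<Sum>k<n. \<Sum>l<n. if l = m + k then of_nat (2 * n) * cinner x (V (int m) x) else 0)"
  proof (intro sum.cong refl)
    fix k l assume kl: "k \<in> {..<n}" "l \<in> {..<n}"
    have "\<bar>int m + int k - int l\<bar> < int (2 * n)"
      using kl m by auto
    from sum1[OF this] show "cinner x (V (int l - int k) x) *
        (\<Sum>j<2*n. z j powi (int m + int k - int l)) =
        (if l = m + k then of_nat (2 * n) * cinner x (V (int m) x) else 0)"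
      by auto
  qed
  also have "\<dots> = (\<Sum>k<n. if m + k < n then of_nat (2 * n) * cinner x (V (int m) x) else 0)"
    by simp
  also have "\<dots> = (\<Sum>k\<in>{k\<in>{..<n}. m + k < n}. of_nat (2 * n) * cinner x (V (int m) x))"
    by (rule sum.inter_filter[symmetric]) simp
  also have "{k\<in>{..<n}. m + k < n} = {..<n - m}"
    by auto
  also have "(\<Sum>k<n - m. of_nat (2 * n) * cinner x (V (int m) x)) / complex_of_real (2 * (real n)\<^sup>2)
      = complex_of_real ((real n - real m) / real n) * cinner x (V (int m) x)"
    using m n by (simp add: of_nat_diff field_simps power2_eq_square)
  finally show ?thesis
    by (simp add: z_def)
qed

lemma trig_moment_unit:
  assumes x: "x \<in> H" "norm x = 1"
  shows "\<exists>M. real_distribution M \<and> (\<forall>k. (LINT t|M. cis t powi k) = cinner x (V k x))"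
proof -
  define th :: "nat \<Rightarrow> nat \<Rightarrow> real" where "th n j = 2 * pi * real j / real (2 * Suc n)" for n j
  define P where "P n = point_measure {..<2 * Suc n} (\<lambda>j. ennreal (fejer (Suc n) x j))" for n
  define \<mu> where "\<mu> n = distr (P n) borel (th n)" for n
  have fn: "fejer n x j \<ge> 0" for n j
    by (simp add: fejer_def)
  have tot: "(\<Sum>j<2 * Suc n. fejer (Suc n) x j) = 1" for n
  proof -
    have "complex_of_real (\<Sum>j<2 * Suc n. fejer (Suc n) x j) = 1"
      using fejer_moment[OF x(1), of 0 "Suc n"] x
      by (simp add: V_0 cinner_self scaleR_conv_of_real del: sum.lessThan_Suc mult_Suc_right)
    thus ?thesis
      using of_real_eq_1_iff by blast
  qed
  have P: "prob_space (P n)" for n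
  proof
    show "emeasure (P n) (space (P n)) = 1"
      unfolding P_def space_point_measure
      by (subst emeasure_point_measure_finite)
        (auto simp: sum_ennreal fn tot simp del: sum.lessThan_Suc mult_Suc_right)
  qed
  have thb: "th n \<in> P n \<rightarrow>\<^sub>M borel" for n
    by (simp add: P_def)
  have \<mu>: "real_distribution (\<mu> n)" for n
    unfolding \<mu>_def real_distribution_def real_distribution_axioms_def
    using prob_space.prob_space_distr[OF P thb] by simp
  \<comment> \<open>The left end is -1 because tightness is stated with half-open intervals and the
    angle 0 is sampled.\<close>
  have rng: "th n j \<in> {-1<..2 * pi}" if "j < 2 * Suc n" for n j
  proof -
    have "real j / real (2 * Suc n) \<le> 1" "real j / real (2 * Suc n) \<ge> 0"
      using that by (simp_all del: of_nat_Suc of_nat_mult)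
    hence "2 * pi * (real j / real (2 * Suc n)) \<le> 2 * pi * 1"
      "2 * pi * (real j / real (2 * Suc n)) \<ge> 0"
      by (intro mult_left_mono mult_nonneg_nonneg; simp)+
    moreover have "th n j = 2 * pi * (real j / real (2 * Suc n))"
      by (simp only: th_def times_divide_eq_right)
    ultimately show ?thesis
      unfolding greaterThanAtMost_iff by linarith
  qed
  have meas: "measure (\<mu> n) {-1<..2 * pi} = 1" for n
  proof -
    have "th n -` {-1<..2 * pi} \<inter> space (P n) = space (P n)"
      using rng by (auto simp: P_def space_point_measure)
    thus ?thesis
      unfolding \<mu>_def using prob_space.prob_space[OF P]
      by (subst measure_distr[OF thb]) auto
  qed
  have "tight \<mu>"
    unfolding tight_def
  proof (intro conjI allI impI \<mu>)
    fix \<epsilon> :: real assume "\<epsilon> > 0"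
    hence "-1 < 2 * pi \<and> (\<forall>n. 1 - \<epsilon> < measure (\<mu> n) {-1<..2 * pi})"
      using pi_gt_zero by (auto simp: meas intro: less_trans[of _ 0])
    thus "\<exists>a b. a < b \<and> (\<forall>n. 1 - \<epsilon> < measure (\<mu> n) {a<..b})"
      by blast
  qed
  from tight_imp_convergent_subsubsequence[OF this strict_mono_id]
  obtain r M where r: "strict_mono r" and M: "real_distribution M" "weak_conv_m (\<mu> \<circ> id \<circ> r) M"
    by auto
  have pos: "(LINT t|M. cis t powi (int m)) = cinner x (V (int m) x)" for m :: nat
  proof -
    have cont: "isCont (\<lambda>t. cis t powi (int m)) t" for t
    proof -
      have "continuous_on UNIV (\<lambda>t. cis t powi (int m))"
        by (intro continuous_intros) auto
      thus ?thesis
        by (simp add: continuous_on_eq_continuous_at)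
    qed
    have "(\<lambda>n. LINT t|(\<mu> \<circ> id \<circ> r) n. cis t powi (int m)) \<longlonglongrightarrow> (LINT t|M. cis t powi (int m))"
      using \<mu> M cont
      by (intro weak_conv_imp_integral_bdd_continuous_conv[where B = 1]) 
        (auto simp: norm_power comp_def)
    moreover have "(\<lambda>n. LINT t|\<mu> n. cis t powi (int m)) \<longlonglongrightarrow> cinner x (V (int m) x)"
    proof (rule Lim_transform_eventually)
      have "(\<lambda>n. (real (Suc n) - real m) / real (Suc n)) \<longlonglongrightarrow> 1"
        by real_asymp
      hence "(\<lambda>n. complex_of_real ((real (Suc n) - real m) / real (Suc n)) * cinner x (V (int m) x))
          \<longlonglongrightarrow> complex_of_real 1 * cinner x (V (int m) x)"
        by (intro tendsto_mult tendsto_of_real tendsto_const)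
      thus "(\<lambda>n. complex_of_real ((real (Suc n) - real m) / real (Suc n)) * cinner x (V (int m) x))
          \<longlonglongrightarrow> cinner x (V (int m) x)"
        by simp
      show "\<forall>\<^sub>F n in sequentially. complex_of_real ((real (Suc n) - real m) / real (Suc n)) *
          cinner x (V (int m) x) = (LINT t|\<mu> n. cis t powi (int m))"
      proof (rule eventually_sequentiallyI[of m])
        fix n assume "m \<le> n"
        have "(LINT t|\<mu> n. cis t powi (int m)) = (LINT j|P n. cis (th n j) powi (int m))"
          unfolding \<mu>_def by (intro integral_distr thb borel_measurable_continuous_onI
              continuous_at_imp_continuous_on ballI cont)
        also have "\<dots> = (\<Sum>j<2*Suc n. fejer (Suc n) x j *\<^sub>R cis (th n j) powi (int m))"
          unfolding P_def by (intro lebesgue_integral_point_measure_finite fn) simp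
        also have "\<dots> = complex_of_real ((real (Suc n) - real m) / real (Suc n)) *
            cinner x (V (int m) x)"
          unfolding th_def using \<open>m \<le> n\<close> by (intro fejer_moment x) auto
        finally show "complex_of_real ((real (Suc n) - real m) / real (Suc n)) *
          cinner x (V (int m) x) = (LINT t|\<mu> n. cis t powi (int m))" ..
      qed
    qed
    from LIMSEQ_subseq_LIMSEQ[OF this r]
    have "(\<lambda>n. LINT t|(\<mu> \<circ> id \<circ> r) n. cis t powi (int m)) \<longlonglongrightarrow> cinner x (V (int m) x)"
      by (simp add: comp_def)
    ultimately show ?thesis
      using LIMSEQ_unique by blast
  qed
  have "(LINT t|M. cis t powi k) = cinner x (V k x)" for k
  proof (cases "k \<ge> 0")
    case True
    with pos[of "nat k"] show ?thesis
      by simp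
  next
    case False
    \<comment> \<open>Negative moments of a positive measure are conjugates of the positive ones,
      and \<open><x, V k x>\<close> has the same symmetry.\<close>
    define m where "m = nat (- k)"
    have k: "k = - int m"
      using False by (simp add: m_def)
    have "(LINT t|M. cis t powi k) = (LINT t|M. cnj (cis t powi (int m)))"
      unfolding k by (simp only: cis_power_int cis_cnj) simp
    also have "\<dots> = cnj (cinner x (V (int m) x))"
      by (subst Bochner_Integration.integral_cnj) (simp only: pos)
    also have "\<dots> = cinner x (V k x)"
      using cinner_commute[of "V (int m) x" x] cinner_V_left[OF x(1) x(1), of "int m"]
      by (simp add: k)
    finally show ?thesis .
  qed
  with M(1) show ?thesis
    by blast
qed

text \<open>Helly's theorem is about probability measures, so \<open>x\<close> is normalized first;
  scaling back multiplies the measure by \<open>(norm x)^2\<close>.\<close>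

lemma trig_moment:
  assumes x: "x \<in> H"
  shows "\<exists>M. finite_measure M \<and> sets M = sets borel \<and> (\<forall>k. (LINT t|M. cis t powi k) = cinner x (V k x))"
proof (cases "x = 0")
  case True
  have "finite_measure (null_measure borel :: real measure)"
    by (intro finite_measureI) simp
  thus ?thesis
    using True by (intro exI[of _ "null_measure borel"]) auto
next
  case False
  define r u where "r = norm x" and "u = (1 / complex_of_real r) *\<^sub>C x"
  have r: "r > 0"
    using False by (simp add: r_def)
  have u: "u \<in> H" "norm u = 1" "x = complex_of_real r *\<^sub>C u"
    using x r by (auto simp: u_def r_def H_scale norm_scaleC norm_divide scaleC_scaleC)
  obtain M where M: "real_distribution M" "\<And>k. (LINT t|M. cis t powi k) = cinner u (V k u)"
    using trig_moment_unit[OF u(1,2)] by blast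
  interpret real_distribution M
    by fact
  define N where "N = density M (\<lambda>_. ennreal (r\<^sup>2))"
  have "finite_measure N"
    by (intro finite_measureI) (simp add: N_def emeasure_density nn_integral_cmult
        ennreal_mult_eq_top_iff emeasure_finite)
  moreover have "(LINT t|N. cis t powi k) = cinner x (V k x)" for k
  proof -
    have [measurable]: "(\<lambda>t. cis t powi k) \<in> borel_measurable M"
      unfolding cis_power_int measurable_cong_sets[OF events_eq_borel refl]
      by (intro borel_measurable_continuous_onI continuous_intros)
    have "(LINT t|N. cis t powi k) = (LINT t|M. r\<^sup>2 *\<^sub>R cis t powi k)"
      unfolding N_def by (rule integral_density) auto
    also have "\<dots> = r\<^sup>2 *\<^sub>R cinner u (V k u)"
      by (simp add: M(2))
    also have "\<dots> = cinner x (V k x)"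
      using u by (simp add: V_scale cinner_scaleC_left cinner_scaleC_right scaleR_conv_of_real
          power2_eq_square)
    finally show ?thesis .
  qed
  ultimately show ?thesis
    by (intro exI[of _ N]) (auto simp: N_def)
qed

end

section \<open>The Cayley map of the line onto the punctured circle, and the mass at the missing
  point\<close>

lemma cnj_eq_inverse: "cmod z = 1 \<Longrightarrow> cnj z = inverse z"
  by (metis complex_norm_square inverse_unique mult.right_neutral of_real_1 power_one)

definition cay :: "real \<Rightarrow> complex" where
  "cay s = (complex_of_real s - \<i>) / (complex_of_real s + \<i>)"

lemma real_plus_i_nonzero [simp]: "complex_of_real s + \<i> \<noteq> 0"
  by (simp add: complex_eq_iff)

lemma norm_cay [simp]: "cmod (cay s) = 1"
proof -
  have "cmod (complex_of_real s - \<i>) = cmod (cnj (complex_of_real s - \<i>))"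
    by (simp only: complex_mod_cnj)
  thus ?thesis
    by (simp add: cay_def norm_divide)
qed

lemma cay_nonzero [simp]: "cay s \<noteq> 0"
  using norm_cay[of s] by force

lemma one_minus_cay: "1 - cay s = 2 * \<i> / (complex_of_real s + \<i>)"
  by (simp add: cay_def diff_divide_eq_iff)

lemma one_plus_cay: "1 + cay s = 2 * complex_of_real s / (complex_of_real s + \<i>)"
  by (simp add: cay_def add_divide_eq_iff)

lemma cay_neq_1 [simp]: "cay s \<noteq> 1"
  using one_minus_cay[of s] by force

lemma continuous_cay: "continuous_on UNIV cay"
  unfolding cay_def by (intro continuous_intros) simp

lemma measurable_cay [measurable]: "cay \<in> borel_measurable borel"
  by (intro borel_measurable_continuous_onI continuous_cay)

lemma measurable_powi [measurable]:
  "(\<lambda>z::complex. z powi k) \<in> borel_measurable borel"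
  by (cases "k \<ge> 0") (auto simp: power_int_def)

lemma cay_inverse: "complex_of_real s = \<i> * (1 + cay s) / (1 - cay s)"
  unfolding one_minus_cay one_plus_cay by (simp add: field_simps)

lemma ex_cay:
  assumes z: "cmod z = 1" "z \<noteq> 1"
  shows "cay (Re (\<i> * (1 + z) / (1 - z))) = z"
proof -
  define w where "w = \<i> * (1 + z) / (1 - z)"
  have z0: "z \<noteq> 0"
    using z by auto
  have "cnj z = inverse z"
    by (rule cnj_eq_inverse[OF z(1)])
  hence "cnj w = - \<i> * (1 + inverse z) / (1 - inverse z)"
    by (simp add: w_def)
  also have "\<dots> = w"
    using z0 z(2) by (simp add: w_def field_simps)
  finally have "complex_of_real (Re w) = w"
    by (metis Reals_cnj_iff of_real_Re)
  hence "cay (Re w) = (w - \<i>) / (w + \<i>)"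
    by (simp add: cay_def)
  also have "w - \<i> = 2 * \<i> * z / (1 - z)"
    using z(2) by (simp add: w_def field_simps)
  also have "w + \<i> = 2 * \<i> / (1 - z)"
    using z(2) by (simp add: w_def field_simps)
  finally show ?thesis
    using z(2) by (simp add: w_def)
qed

text \<open>For \<open>z\<close> other than 1 the geometric sums stay below
  \<open>2 / cmod (z - 1)\<close>, so their means vanish. With \<open>cesaro_bound\<close>,
  dominated convergence then isolates the mass at the point 1.\<close>

lemma cesaro_limit:
  fixes z :: complex
  assumes z: "cmod z = 1"
  shows "(\<lambda>n. (1 / of_nat n) * (\<Sum>k<n. z powi (int k))) \<longlonglongrightarrow> (if z = 1 then 1 else 0)"
proof (cases "z = 1")
  case True
  have "\<forall>\<^sub>F n in sequentially. (1 / of_nat n) * (\<Sum>k<n. z powi (int k)) = 1"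
    using eventually_gt_at_top[of 0] by eventually_elim (simp add: True)
  thus ?thesis
    using True by (simp add: tendsto_eventually)
next
  case False
  have b: "norm ((1 / of_nat n) * (\<Sum>k<n. z powi (int k))) \<le> 2 / cmod (z - 1) * (1 / real n)" for n
  proof -
    have "cmod (z ^ n - 1) \<le> 2"
      using norm_triangle_ineq4[of "z ^ n" 1] z by (simp add: norm_power)
    thus ?thesis
      using False geometric_sum[of z n] 
      by (simp add: norm_mult norm_divide mult.commute[of "real n"] divide_right_mono)
  qed
  have "(\<lambda>n. 2 / cmod (z - 1) * (1 / real n)) \<longlonglongrightarrow> 2 / cmod (z - 1) * 0"
    by (intro tendsto_intros lim_1_over_n)
  hence lim: "(\<lambda>n. 2 / cmod (z - 1) * (1 / real n)) \<longlonglongrightarrow> 0"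
    by simp
  have "(\<lambda>n. (1 / of_nat n) * (\<Sum>k<n. z powi (int k))) \<longlonglongrightarrow> 0"
    by (rule Lim_null_comparison[OF always_eventually[OF allI[OF b]] lim])
  thus ?thesis
    using False by simp
qed

lemma cesaro_bound:
  fixes z :: complex
  assumes z: "cmod z = 1"
  shows "cmod ((1 / of_nat n) * (\<Sum>k<n. z powi (int k))) \<le> 1"
proof -
  have "cmod (\<Sum>k<n. z powi (int k)) \<le> (\<Sum>k<n. 1)"
    using z by (intro order_trans[OF norm_sum]) (simp add: norm_power)
  thus ?thesis
    by (cases "n = 0") (auto simp: norm_mult norm_divide divide_le_eq)
qed

text \<open>Density of this range says that 1 is not an eigenvalue of \<open>V 1\<close>, which is
  what allows the measures to live on the line.\<close>

locale dense_unitary_group = unitary_group +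
  assumes dense: "H \<subseteq> closure ((\<lambda>w. V 1 w - w) ` H)"
begin

text \<open>On vectors \<open>V 1 w - w\<close> the sums telescope to \<open>V n w - w\<close>;
  since the means are contractions, the limit extends to the closure.\<close>

lemma mean_ergodic:
  assumes x: "x \<in> H"
  shows "(\<lambda>n. (1 / of_nat n) *\<^sub>C (\<Sum>k<n. V (int k) x)) \<longlonglongrightarrow> 0"
proof (rule LIMSEQ_I)
  fix e :: real assume e: "e > 0"
  have "x \<in> closure ((\<lambda>w. V 1 w - w) ` H)"
    using x dense by blast
  then obtain w where w: "w \<in> H" "norm (x - (V 1 w - w)) < e / 2"
    using e by (auto simp: closure_approachable dist_norm norm_minus_commute dest!: spec[of _ "e/2"])
  define u where "u = x - (V 1 w - w)"
  have u: "u \<in> H" "norm u < e / 2"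
    using w x by (auto simp: u_def H_diff V_H)
  have Vx: "V (int k) x = V (int k) u + (V (int (Suc k)) w - V (int k) w)" for k
  proof -
    have "x = u + (V 1 w - w)"
      by (simp add: u_def)
    thus ?thesis
      using w u by (simp only: V_add V_diff H_diff V_H V_V) (simp add: add.commute)
  qed
  \<comment> \<open>Beyond this index the telescoped remainder, at most \<open>2 |w| / n\<close>, is
    below \<open>e / 2\<close>.\<close>
  obtain N0 :: nat where N0: "4 * norm w / e < real N0"
    using reals_Archimedean2 by blast
  define N where "N = Suc N0"
  have N: "N > 0" "real N > 4 * norm w / e"
    using N0 by (auto simp: N_def)
  have "norm ((1 / of_nat n) *\<^sub>C (\<Sum>k<n. V (int k) x) - 0) < e" if n: "n \<ge> N" for n
  proof -
    have n0: "real n > 0" "real n > 4 * norm w / e"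
      using n N by auto
    have "(\<Sum>k<n. V (int k) x) = (\<Sum>k<n. V (int k) u) + (V (int n) w - V (int 0) w)"
      using sum_lessThan_telescope[of "\<lambda>k. V (int k) w" n] by (simp only: Vx sum.distrib)
    also have "norm \<dots> \<le> (\<Sum>k<n. norm (V (int k) u)) + norm (V (int n) w - V (int 0) w)"
      by (rule order_trans[OF norm_triangle_ineq add_right_mono[OF norm_sum]])
    also have "\<dots> \<le> real n * norm u + 2 * norm w"
      using norm_triangle_ineq4[of "V (int n) w" "V (int 0) w"] u w by (simp add: norm_V)
    finally have "norm ((1 / of_nat n) *\<^sub>C (\<Sum>k<n. V (int k) x)) \<le> norm u + 2 * norm w / real n"
      using n0 by (simp add: norm_scaleC norm_divide field_simps)
    also have "\<dots> < e / 2 + e / 2"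
      using u(2) n0 e by (intro add_strict_mono) (auto simp: field_simps)
    finally show ?thesis
      by simp
  qed
  thus "\<exists>N. \<forall>n\<ge>N. norm ((1 / of_nat n) *\<^sub>C (\<Sum>k<n. V (int k) x) - 0) < e"
    by blast
qed

text \<open>The means of the powers of \<open>cis t\<close> converge boundedly to the indicator of
  the point 1, while their integrals are inner products of \<open>x\<close> with ergodic
  means.\<close>

lemma measure_cis_eq_1:
  assumes x: "x \<in> H" and M: "finite_measure M" "sets M = sets borel"
    "\<And>k. (LINT t|M. cis t powi k) = cinner x (V k x)"
  shows "emeasure M {t. cis t = 1} = 0"
proof -
  interpret finite_measure M by fact
  note [measurable_cong] = M(2)
  have [measurable]: "cis \<in> borel_measurable borel"
    by (intro borel_measurable_continuous_onI continuous_intros)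
  have int: "integrable M (\<lambda>t. cis t powi k)" for k
    by (rule integrable_const_bound[where B = 1]) (auto simp: norm_power_int)
  let ?E = "{t. cis t = 1}"
  have E: "?E \<in> sets M"
    by measurable
  have "(\<lambda>n. LINT t|M. (1 / of_nat n) * (\<Sum>k<n. cis t powi (int k))) \<longlonglongrightarrow>
      (LINT t|M. (if cis t = 1 then 1 else 0))"
  proof (rule integral_dominated_convergence[where w = "\<lambda>_. 1"])
    show "AE t in M. (\<lambda>n. (1 / of_nat n) * (\<Sum>k<n. cis t powi (int k))) \<longlonglongrightarrow>
        (if cis t = 1 then 1 else 0 :: complex)"
      by (intro AE_I2 cesaro_limit) simp
    show "AE t in M. norm ((1 / of_nat n) * (\<Sum>k<n. cis t powi (int k))) \<le> 1" for n
      by (intro AE_I2 cesaro_bound) simp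
  qed auto
  moreover have "(LINT t|M. (1 / of_nat n) * (\<Sum>k<n. cis t powi (int k))) =
      cinner x ((1 / of_nat n) *\<^sub>C (\<Sum>k<n. V (int k) x))" for n
  proof -
    have "(LINT t|M. (1 / of_nat n) * (\<Sum>k<n. cis t powi (int k))) =
       (1 / of_nat n) * (\<Sum>k<n. (LINT t|M. cis t powi (int k)))"
      by (subst integral_mult_right_zero, subst Bochner_Integration.integral_sum) (rule int refl)+
    thus ?thesis
      by (simp only: M(3) cinner_scaleC_right cinner.sum_right)
  qed
  moreover have "(\<lambda>n. cinner x ((1 / of_nat n) *\<^sub>C (\<Sum>k<n. V (int k) x))) \<longlonglongrightarrow> cinner x 0"
    by (intro cinner.tendsto tendsto_const mean_ergodic x)
  ultimately have "(LINT t|M. (if cis t = 1 then 1 else 0 :: complex)) = 0"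
    using LIMSEQ_unique by (simp only: cinner.zero_right) blast
  moreover have "(LINT t|M. (if cis t = 1 then 1 else 0 :: complex)) = 
      (LINT t|M. complex_of_real (indicator ?E t))"
    by (intro Bochner_Integration.integral_cong) auto
  moreover have "\<dots> = complex_of_real (measure M ?E)"
    using E by (simp add: M(2) sets_eq_imp_space_eq[OF M(2)])
  ultimately have "measure M ?E = 0"
    by simp
  thus ?thesis
    by (simp add: emeasure_eq_measure)
qed

text \<open>Push-forward under the inverse Cayley map \<open>g\<close>. Where
  \<open>cis t = 1\<close> the value of \<open>g\<close> is a default of division, harmless because
  that set is null.\<close>

lemma line_measure:
  assumes x: "x \<in> H"
  shows "\<exists>M. finite_measure M \<and> sets M = sets borel \<and> (\<forall>k. (LINT s|M. cay s powi k) = cinner x (V k x))"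
proof -
  obtain M where M: "finite_measure M" "sets M = sets borel"
    "\<And>k. (LINT t|M. cis t powi k) = cinner x (V k x)"
    using trig_moment[OF x] by blast
  interpret finite_measure M by fact
  note [measurable_cong] = M(2)
  have [measurable]: "cis \<in> borel_measurable borel"
    by (intro borel_measurable_continuous_onI continuous_intros)
  define g where "g t = Re (\<i> * (1 + cis t) / (1 - cis t))" for t
  have [measurable]: "g \<in> borel_measurable borel"
    unfolding g_def by measurable
  have "{t. cis t = 1} \<in> null_sets M"
    using measure_cis_eq_1[OF x M] by (intro null_setsI) measurable
  hence AE: "AE t in M. cis t \<noteq> 1"
    by (rule AE_not_in[THEN AE_mp]) auto
  have "(LINT s|distr M borel g. cay s powi k) = cinner x (V k x)" for k
  proof -
    have "(LINT s|distr M borel g. cay s powi k) = (LINT t|M. cay (g t) powi k)"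
      by (rule integral_distr) measurable
    also have "\<dots> = (LINT t|M. cis t powi k)"
      using AE by (intro integral_cong_AE) (auto simp: g_def ex_cay)
    finally show ?thesis
      by (simp add: M(3))
  qed
  thus ?thesis
    by (intro exI[of _ "distr M borel g"]) (auto intro: finite_measure_distr)
qed

text \<open>A choice, but a unique one: \<open>finite_borel_measure_eqI\<close> shows that the
  moments determine the measure.\<close>

definition mu :: "'a \<Rightarrow> real measure" where
  "mu x = (SOME M. finite_measure M \<and> sets M = sets borel \<and>
             (\<forall>k. (LINT s|M. cay s powi k) = cinner x (V k x)))"

lemma mu:
  assumes "x \<in> H"
  shows finite_mu: "finite_measure (mu x)" and sets_mu: "sets (mu x) = sets borel"
    and mu_moment: "(LINT s|mu x. cay s powi k) = cinner x (V k x)"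
  using someI_ex[OF line_measure[OF assms]] unfolding mu_def by blast+

end

section \<open>Laurent polynomials on the circle, and measures determined by their moments\<close>

fun laurent :: "(complex \<times> int) list \<Rightarrow> complex \<Rightarrow> complex" where
  "laurent [] z = 0"
| "laurent ((a, k) # ps) z = a * z powi k + laurent ps z"

text \<open>Conjugation on the unit circle, where \<open>cnj z = inverse z\<close>. Coefficient
  lists are used so that one polynomial can be evaluated both at numbers and, by
  \<open>laurent_op\<close>, at the unitary group.\<close>

definition lcnj :: "(complex \<times> int) list \<Rightarrow> (complex \<times> int) list" where
  "lcnj ps = map (\<lambda>(a, k). (cnj a, - k)) ps"

fun lmul :: "(complex \<times> int) list \<Rightarrow> (complex \<times> int) list \<Rightarrow> (complex \<times> int) list" where
  "lmul [] qs = []"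
| "lmul ((a, j) # ps) qs = map (\<lambda>(b, k). (a * b, j + k)) qs @ lmul ps qs"

lemma laurent_append: "laurent (ps @ qs) z = laurent ps z + laurent qs z"
  by (induction ps z rule: laurent.induct) auto

lemma laurent_monom_mul:
  assumes "z \<noteq> 0"
  shows "laurent (map (\<lambda>(b, k). (a * b, j + k)) qs) z = a * z powi j * laurent qs z"
  using assms by (induction qs z rule: laurent.induct) (auto simp: power_int_add algebra_simps)

lemma laurent_mul:
  assumes "cmod z = 1"
  shows "laurent (lmul ps qs) z = laurent ps z * laurent qs z"
proof -
  have "z \<noteq> 0"
    using assms by auto
  thus ?thesis
    by (induction ps qs rule: lmul.induct) (auto simp: laurent_append laurent_monom_mul algebra_simps)
qed

lemma laurent_cnj:
  assumes "cmod z = 1"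
  shows "laurent (lcnj ps) z = cnj (laurent ps z)"
proof -
  have "cnj z = inverse z"
    by (rule cnj_eq_inverse[OF assms])
  thus ?thesis
    by (induction ps z rule: laurent.induct) (auto simp: lcnj_def power_int_minus power_int_inverse)
qed

lemma continuous_laurent: "continuous_on (- {0}) (laurent ps)"
proof (induction ps)
  case (Cons p ps)
  then show ?case
    by (cases p) (auto intro!: continuous_intros)
qed auto

lemma measurable_laurent [measurable]: "laurent ps \<in> borel_measurable borel"
proof (induction ps)
  case (Cons p ps)
  obtain a k where "p = (a, k)"
    by fastforce
  with Cons show ?case
    by simp
qed simp

lemma laurent_bounded: "\<exists>B. \<forall>z. cmod z = 1 \<longrightarrow> cmod (laurent ps z) \<le> B"
proof (induction ps)
  case (Cons p ps)
  then obtain B where B: "\<And>z. cmod z = 1 \<Longrightarrow> cmod (laurent ps z) \<le> B"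
    by blast
  obtain a k where p: "p = (a, k)"
    by fastforce
  have "cmod (laurent (p # ps) z) \<le> cmod a + B" if "cmod z = 1" for z
    using B[OF that] that norm_triangle_ineq[of "a * z powi k" "laurent ps z"]
    by (simp add: p norm_mult norm_power_int)
  thus ?case
    by blast
qed (auto intro: exI[of _ 0])

text \<open>Stone-Weierstrass for the algebra of real functions that agree on the circle with some
  Laurent polynomial.\<close>

lemma laurent_dense_real:
  assumes f: "continuous_on (sphere 0 1) f" and e: "e > 0"
  shows "\<exists>ps. \<forall>z\<in>sphere 0 1. cmod (laurent ps z - complex_of_real (f z)) < e"
proof -
  define P where "P g \<longleftrightarrow> (\<exists>ps. \<forall>z\<in>sphere 0 1. laurent ps z = complex_of_real (g z))" for g
  have "\<exists>g. P g \<and> (\<forall>z\<in>sphere 0 1. \<bar>f z - g z\<bar> < e)"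
  proof (rule Stone_Weierstrass_HOL)
    show "P (\<lambda>x. c)" for c
      unfolding P_def by (intro exI[of _ "[(complex_of_real c, 0)]"]) simp
    show "continuous_on (sphere 0 1) g" if g: "P g" for g
    proof -
      obtain ps where ps: "\<forall>z\<in>sphere 0 1. laurent ps z = complex_of_real (g z)"
        using g unfolding P_def by blast
      have "continuous_on (sphere 0 1) (\<lambda>z. Re (laurent ps z))"
        by (intro continuous_on_Re continuous_on_subset[OF continuous_laurent]) auto
      thus ?thesis
        by (rule continuous_on_eq) (simp add: ps)
    qed
    show "P (\<lambda>x. g x + h x)" if gh: "P g \<and> P h" for g h
    proof -
      obtain ps qs where "\<forall>z\<in>sphere 0 1. laurent ps z = complex_of_real (g z)"
        "\<forall>z\<in>sphere 0 1. laurent qs z = complex_of_real (h z)"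
        using gh unfolding P_def by blast
      hence "\<forall>z\<in>sphere 0 1. laurent (ps @ qs) z = complex_of_real (g z + h z)"
        by (simp add: laurent_append)
      thus ?thesis
        unfolding P_def by blast
    qed
    show "P (\<lambda>x. g x * h x)" if gh: "P g \<and> P h" for g h
    proof -
      obtain ps qs where "\<forall>z\<in>sphere 0 1. laurent ps z = complex_of_real (g z)"
        "\<forall>z\<in>sphere 0 1. laurent qs z = complex_of_real (h z)"
        using gh unfolding P_def by blast
      hence "\<forall>z\<in>sphere 0 1. laurent (lmul ps qs) z = complex_of_real (g z * h z)"
        by (auto simp: laurent_mul)
      thus ?thesis
        unfolding P_def by blast
    qed
    show "\<exists>g. P g \<and> g x \<noteq> g y" if xy: "x \<in> sphere 0 1 \<and> y \<in> sphere 0 1 \<and> x \<noteq> y" for x y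
    proof -
      have inv: "inverse z = cnj z" if "z \<in> sphere 0 1" for z :: complex
        using cnj_eq_inverse[of z] that by simp
      \<comment> \<open>On the circle \<open>Re z = (z + 1/z) / 2\<close> and
        \<open>Im z = (z - 1/z) / (2 i)\<close>; these two functions separate points.\<close>
      have "P Re"
        unfolding P_def
        by (intro exI[of _ "[(1/2, 1), (1/2, -1)]"])
          (auto simp: inv power_int_minus complex_eq_iff)
      moreover have "P Im"
        unfolding P_def
        by (intro exI[of _ "[(-\<i>/2, 1), (\<i>/2, -1)]"])
          (auto simp: inv power_int_minus complex_eq_iff)
      ultimately show ?thesis
        using xy complex_eq_iff by blast
    qed
  qed (use f e in auto)
  then obtain g ps where g: "\<forall>z\<in>sphere 0 1. \<bar>f z - g z\<bar> < e"
    and ps: "\<forall>z\<in>sphere 0 1. laurent ps z = complex_of_real (g z)"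
    unfolding P_def by blast
  have "cmod (laurent ps z - complex_of_real (f z)) < e" if "z \<in> sphere 0 1" for z
    using g ps that by (simp add: abs_minus_commute flip: of_real_diff)
  thus ?thesis
    by blast
qed

text \<open>Tent functions of the distance to the image of \<open>C\<close> decrease to its
  indicator. Approximating the \<open>j\<close>-th one within \<open>1 / (j + 1)\<close> keeps the
  limit and the bound 1 + 1. The image can fail to be closed only at 1, a value that
  \<open>cay\<close> never takes.\<close>

lemma laurent_indicator:
  assumes C: "closed C"
  shows "\<exists>p :: nat \<Rightarrow> _. (\<forall>s. (\<lambda>j. laurent (p j) (cay s)) \<longlonglongrightarrow> indicator C s) \<and>
           (\<forall>j s. cmod (laurent (p j) (cay s)) \<le> 2)"
proof (cases "C = {}")
  case True
  then show ?thesis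
    by (intro exI[of _ "\<lambda>_. []"]) simp
next
  case False
  define h where "h z = infdist z (cay ` C)" for z
  have h0: "h (cay s) = 0 \<longleftrightarrow> s \<in> C" for s
  proof
    assume "h (cay s) = 0"
    hence "cay s \<in> closure (cay ` C)"
      using False by (simp add: h_def in_closure_iff_infdist_zero)
    then obtain z where z: "\<And>n. z n \<in> cay ` C" "z \<longlonglongrightarrow> cay s"
      using closure_sequential by blast
    hence "\<forall>n. \<exists>t. t \<in> C \<and> z n = cay t"
      by blast
    from choice[OF this] obtain t where t: "\<And>n. t n \<in> C" "\<And>n. z n = cay (t n)"
      by blast
    \<comment> \<open>The inverse of \<open>cay\<close> is continuous away from 1, so convergence on
      the circle pulls back to the line.\<close>
    have "(\<lambda>n. Re (\<i> * (1 + z n) / (1 - z n))) \<longlonglongrightarrow> Re (\<i> * (1 + cay s) / (1 - cay s))"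
      by (intro tendsto_intros z) simp
    hence "t \<longlonglongrightarrow> s"
      by (simp add: t(2) flip: cay_inverse)
    thus "s \<in> C"
      using closed_sequentially[OF C] t(1) by blast
  qed (simp add: h_def)
  have hpos: "h z \<ge> 0" for z
    by (simp add: h_def infdist_nonneg)
  define f where "f j z = max 0 (1 - real j * h z)" for j z
  have cont: "continuous_on (sphere 0 1) (f j)" for j
    unfolding f_def h_def by (intro continuous_intros)
  have "\<exists>p. \<forall>z\<in>sphere 0 1. cmod (laurent p z - complex_of_real (f j z)) < inverse (real (Suc j))" for j
    by (intro laurent_dense_real cont) simp
  then obtain p where p: "\<And>j z. z \<in> sphere 0 1 \<Longrightarrow>
      cmod (laurent (p j) z - complex_of_real (f j z)) < inverse (real (Suc j))"
    by metis
  have f_lim: "(\<lambda>j. f j (cay s)) \<longlonglongrightarrow> indicator C s" for s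
  proof (cases "s \<in> C")
    case True
    hence "h (cay s) = 0"
      using h0 by blast
    then show ?thesis
      using True by (simp add: f_def)
  next
    case False
    hence hp: "h (cay s) > 0"
      using h0[of s] hpos[of "cay s"] by linarith
    then obtain N where N: "1 < real N * h (cay s)"
      using ex_less_of_nat_mult by blast
    have "\<forall>\<^sub>F j in sequentially. f j (cay s) = 0"
    proof (rule eventually_sequentiallyI[of N])
      fix j assume "N \<le> j"
      hence "real N * h (cay s) \<le> real j * h (cay s)"
        using hpos by (intro mult_right_mono) auto
      with N show "f j (cay s) = 0"
        by (simp add: f_def)
    qed
    thus ?thesis
      using False by (simp add: tendsto_eventually)
  qed
  have "(\<lambda>j. laurent (p j) (cay s)) \<longlonglongrightarrow> indicator C s" for s
  proof -
    have "(\<lambda>j. laurent (p j) (cay s) - complex_of_real (f j (cay s))) \<longlonglongrightarrow> 0"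
    proof (rule Lim_null_comparison[OF always_eventually[OF allI] LIMSEQ_inverse_real_of_nat])
      show "cmod (laurent (p j) (cay s) - complex_of_real (f j (cay s))) \<le> inverse (real (Suc j))" for j
        using p[of "cay s" j] by simp
    qed
    from tendsto_add[OF this tendsto_of_real[OF f_lim[of s]]] show ?thesis
      by (cases "s \<in> C") simp_all
  qed
  moreover have "cmod (laurent (p j) (cay s)) \<le> 2" for j s
  proof -
    have "inverse (real (Suc j)) \<le> 1"
      by (simp add: field_simps)
    moreover have "0 \<le> f j (cay s)" "f j (cay s) \<le> 1"
      using hpos[of "cay s"] by (auto simp: f_def)
    ultimately show ?thesis
      using p[of "cay s" j] norm_triangle_sub[of "laurent (p j) (cay s)" "complex_of_real (f j (cay s))"]
      by simp
  qed
  ultimately show ?thesis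
    by blast
qed

lemma integral_laurent_tendsto_measure:
  fixes M :: "real measure" and p :: "nat \<Rightarrow> _"
  assumes M: "finite_measure M" "sets M = sets borel" and C: "closed C"
    and p: "\<forall>s. (\<lambda>j. laurent (p j) (cay s)) \<longlonglongrightarrow> indicator C s" "\<forall>j s. cmod (laurent (p j) (cay s)) \<le> 2"
  shows "(\<lambda>j. LINT s|M. laurent (p j) (cay s)) \<longlonglongrightarrow> complex_of_real (measure M C)"
proof -
  interpret finite_measure M by fact
  note [measurable_cong] = M(2)
  have [measurable]: "C \<in> sets borel"
    using C by simp
  have "(\<lambda>j. LINT s|M. laurent (p j) (cay s)) \<longlonglongrightarrow> (LINT s|M. complex_of_real (indicator C s))"
  proof (rule integral_dominated_convergence[where w = "\<lambda>_. 2"])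
    have "(indicator C s :: complex) = complex_of_real (indicator C s)" for s
      by (simp add: indicator_def)
    thus "AE s in M. (\<lambda>j. laurent (p j) (cay s)) \<longlonglongrightarrow> complex_of_real (indicator C s)"
      using p(1) by (intro AE_I2) simp
    show "AE s in M. norm (laurent (p j) (cay s)) \<le> 2" for j
      using p(2) by (intro AE_I2) simp
  qed auto
  also have "(LINT s|M. complex_of_real (indicator C s)) = complex_of_real (measure M C)"
    by (simp add: sets_eq_imp_space_eq[OF M(2)])
  finally show ?thesis .
qed

text \<open>Equal moments give equal integrals of Laurent polynomials, hence equal values on closed
  sets, which form an intersection-stable generator.\<close>

lemma finite_borel_measure_eqI:
  fixes M N :: "real measure"
  assumes M: "finite_measure M" "sets M = sets borel" and N: "finite_measure N" "sets N = sets borel"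
    and eq: "\<And>k. (LINT s|M. cay s powi k) = (LINT s|N. cay s powi k)"
  shows "M = N"
proof -
  have int: "integrable M' (\<lambda>s. cay s powi k)" if "finite_measure M'" "sets M' = sets borel" for M' k
  proof -
    interpret finite_measure M' by fact
    note [measurable_cong] = that(2)
    show ?thesis
      by (rule integrable_const_bound[where B = 1]) (auto simp: norm_power_int)
  qed
  have "integrable M (\<lambda>s. laurent ps (cay s)) \<and> integrable N (\<lambda>s. laurent ps (cay s)) \<and>
      (LINT s|M. laurent ps (cay s)) = (LINT s|N. laurent ps (cay s))" for ps
  proof (induction ps)
    case (Cons p ps)
    then show ?case
      using int[OF M] int[OF N] eq by (cases p) auto
  qed auto
  hence laurent_eq: "(LINT s|M. laurent ps (cay s)) = (LINT s|N. laurent ps (cay s))" for ps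
    by blast
  have closed_eq: "measure M C = measure N C" if C: "closed C" for C
  proof -
    obtain p :: "nat \<Rightarrow> _" where p: "\<forall>s. (\<lambda>j. laurent (p j) (cay s)) \<longlonglongrightarrow> indicator C s"
      "\<forall>j s. cmod (laurent (p j) (cay s)) \<le> 2"
      using laurent_indicator[OF C] by blast
    show ?thesis
      using LIMSEQ_unique[OF integral_laurent_tendsto_measure[OF M C p, unfolded laurent_eq]
          integral_laurent_tendsto_measure[OF N C p]] by simp
  qed
  show ?thesis
  proof (rule measure_eqI_generator_eq[where \<Omega> = UNIV and E = "{C. closed C}" and A = "\<lambda>_. UNIV"])
    show "Int_stable {C :: real set. closed C}"
      by (auto simp: Int_stable_def)
    show "emeasure M C = emeasure N C" if "C \<in> {C. closed C}" for C
      using closed_eq that M(1) N(1) by (simp add: finite_measure.emeasure_eq_measure)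
    show "sets M = sigma_sets UNIV {C. closed C}" "sets N = sigma_sets UNIV {C. closed C}"
      using M N by (simp_all add: borel_eq_closed)
    show "emeasure M UNIV \<noteq> \<infinity>"
      using M(1) by (simp add: finite_measure.emeasure_eq_measure)
  qed auto
qed

section \<open>Functional calculus for Laurent polynomials\<close>

context dense_unitary_group
begin

fun laurent_op :: "(complex \<times> int) list \<Rightarrow> 'a \<Rightarrow> 'a" where
  "laurent_op [] x = 0"
| "laurent_op ((a, k) # ps) x = a *\<^sub>C V k x + laurent_op ps x"

lemma laurent_op_H: "x \<in> H \<Longrightarrow> laurent_op ps x \<in> H"
  by (induction ps x rule: laurent_op.induct) (auto intro: H_zero H_add H_scale V_H)

lemma laurent_op_linear: "clinear_on H (laurent_op ps)"
proof (induction ps)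
  case (Cons p ps)
  then show ?case
    by (cases p) (auto simp: clinear_on_def V_add V_scale scaleC_add_right scaleC_scaleC mult.commute)
qed (simp add: clinear_on_def)

lemma laurent_op_append: "laurent_op (ps @ qs) x = laurent_op ps x + laurent_op qs x"
  by (induction ps x rule: laurent_op.induct) auto

lemma laurent_op_monom_mul:
  "x \<in> H \<Longrightarrow> laurent_op (map (\<lambda>(b, k). (a * b, j + k)) qs) x = a *\<^sub>C V j (laurent_op qs x)"
proof (induction qs)
  case Nil
  then show ?case
    using clinear_on_zero[OF V_linear subspace_H] by simp
next
  case (Cons q qs)
  then show ?case
    by (cases q) (simp add: V_add V_scale V_V V_H laurent_op_H H_scale scaleC_add_right scaleC_scaleC)
qed

lemma laurent_op_mul: "x \<in> H \<Longrightarrow> laurent_op (lmul ps qs) x = laurent_op ps (laurent_op qs x)"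
  by (induction ps qs rule: lmul.induct) (auto simp: laurent_op_append laurent_op_monom_mul)

lemma laurent_op_adjoint: "x \<in> H \<Longrightarrow> y \<in> H \<Longrightarrow> cinner (laurent_op ps x) y = cinner x (laurent_op (lcnj ps) y)"
proof (induction ps)
  case (Cons p ps)
  then show ?case
    by (cases p)
      (simp add: lcnj_def cinner.add_left cinner.add_right cinner_scaleC_left cinner_scaleC_right cinner_V_left)
qed (simp add: lcnj_def)

lemma integrable_laurent:
  assumes x: "x \<in> H"
  shows "integrable (mu x) (\<lambda>s. laurent ps (cay s))"
proof -
  interpret finite_measure "mu x" by (rule finite_mu[OF x])
  note [measurable_cong] = sets_mu[OF x]
  obtain B where "\<And>z. cmod z = 1 \<Longrightarrow> cmod (laurent ps z) \<le> B"
    using laurent_bounded by blast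
  thus ?thesis
    by (intro integrable_const_bound[where B = B]) auto
qed

lemma cinner_laurent_op:
  assumes x: "x \<in> H"
  shows "cinner x (laurent_op ps x) = (LINT s|mu x. laurent ps (cay s))"
proof (induction ps)
  case (Cons p ps)
  obtain a k where p: "p = (a, k)"
    by fastforce
  have "integrable (mu x) (\<lambda>s. laurent [(a, k)] (cay s))" "integrable (mu x) (\<lambda>s. laurent ps (cay s))"
    by (intro integrable_laurent x)+
  thus ?case
    using Cons mu_moment[OF x, of k] by (simp add: p cinner.add_right cinner_scaleC_right)
qed simp

text \<open>The adjoint of \<open>laurent_op ps\<close> is the operator of \<open>lcnj ps\<close>,
  so the squared norm is the moment integral of \<open>|p|^2\<close>.\<close>

lemma norm_laurent_op:
  assumes x: "x \<in> H"
  shows "(norm (laurent_op ps x))\<^sup>2 = (LINT s|mu x. (cmod (laurent ps (cay s)))\<^sup>2)"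
proof -
  have "complex_of_real ((norm (laurent_op ps x))\<^sup>2) = cinner (laurent_op ps x) (laurent_op ps x)"
    by (simp only: cinner_self)
  also have "\<dots> = cinner x (laurent_op (lmul (lcnj ps) ps) x)"
    using x by (simp add: laurent_op_mul laurent_op_adjoint laurent_op_H)
  also have "\<dots> = (LINT s|mu x. complex_of_real ((cmod (laurent ps (cay s)))\<^sup>2))"
    unfolding cinner_laurent_op[OF x] 
    by (intro Bochner_Integration.integral_cong refl)
      (simp add: laurent_mul laurent_cnj complex_norm_square mult.commute del: of_real_power)
  also have "\<dots> = complex_of_real (LINT s|mu x. (cmod (laurent ps (cay s)))\<^sup>2)"
    by (simp del: of_real_power)
  finally show ?thesis
    using of_real_eq_iff by blast
qed

lemma measure_mu_UNIV:
  assumes x: "x \<in> H"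
  shows "measure (mu x) UNIV = (norm x)\<^sup>2"
proof -
  interpret finite_measure "mu x" by (rule finite_mu[OF x])
  have "complex_of_real (measure (mu x) UNIV) = (LINT s|mu x. cay s powi 0)"
    using sets_eq_imp_space_eq[OF sets_mu[OF x]] by (simp add: scaleR_conv_of_real)
  thus ?thesis
    using x by (simp only: mu_moment V_0 cinner_self of_real_eq_iff)
qed

text \<open>Both measures have the moments \<open><p(V) x, V k p(V) x>\<close>, so uniqueness
  applies. With \<open>p\<close> representing \<open>1 / (s + i)\<close> this relates the measures
  of \<open>w\<close> and of \<open>(A + i)^-1 w\<close>.\<close>

lemma mu_laurent_op:
  assumes x: "x \<in> H"
  shows "mu (laurent_op ps x) = density (mu x) (\<lambda>s. ennreal ((cmod (laurent ps (cay s)))\<^sup>2))"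
proof (rule finite_borel_measure_eqI)
  interpret finite_measure "mu x" by (rule finite_mu[OF x])
  note [measurable_cong] = sets_mu[OF x]
  let ?f = "\<lambda>s. (cmod (laurent ps (cay s)))\<^sup>2"
  obtain B where "\<And>z. cmod z = 1 \<Longrightarrow> cmod (laurent ps z) \<le> B"
    using laurent_bounded by blast
  hence B: "?f s \<le> B\<^sup>2" for s
    by (intro power_mono) auto
  have int: "integrable (mu x) ?f"
    using B by (intro integrable_const_bound[where B = "B\<^sup>2"]) auto
  show "finite_measure (density (mu x) (\<lambda>s. ennreal (?f s)))"
    using int by (intro finite_measureI)
      (simp add: emeasure_density nn_integral_eq_integral sets_eq_imp_space_eq[OF sets_mu[OF x]] cong: nn_integral_cong)
  show "finite_measure (mu (laurent_op ps x))" "sets (mu (laurent_op ps x)) = sets borel"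
    by (intro finite_mu sets_mu laurent_op_H x)+
  show "sets (density (mu x) (\<lambda>s. ennreal (?f s))) = sets borel"
    by (simp add: sets_mu x)
  fix k
  have "(LINT s|mu (laurent_op ps x). cay s powi k) = cinner x (laurent_op (lmul (lcnj ps) (lmul [(1, k)] ps)) x)"
  proof -
    have "laurent_op [(1, k)] (laurent_op ps x) = V k (laurent_op ps x)"
      by simp
    thus ?thesis
      by (simp only: mu_moment[OF laurent_op_H[OF x]] laurent_op_mul[OF x] laurent_op_adjoint x V_H laurent_op_H)
  qed
  also have "\<dots> = (LINT s|mu x. ?f s *\<^sub>R cay s powi k)"
    unfolding cinner_laurent_op[OF x]
    by (intro Bochner_Integration.integral_cong refl)
      (simp add: laurent_mul laurent_cnj complex_norm_square scaleR_conv_of_real mult_ac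
        del: of_real_power lmul.simps laurent.simps, simp)
  also have "\<dots> = (LINT s|density (mu x) (\<lambda>s. ennreal (?f s)). cay s powi k)"
    by (rule integral_density[symmetric]) auto
  finally show "(LINT s|mu (laurent_op ps x). cay s powi k) =
      (LINT s|density (mu x) (\<lambda>s. ennreal (?f s)). cay s powi k)" .
qed

end

text \<open>Polarization turns the equality of forms into \<open><x, Q y> = <Q x, Q y>\<close>, from
  which symmetry and idempotence follow.\<close>

lemma orthogonal_projectionI:
  fixes Q :: "'a::chilbert_space \<Rightarrow> 'a"
  assumes H: "cvec.subspace H" and Q: "clinear_on H Q" "\<And>x. x \<in> H \<Longrightarrow> Q x \<in> H"
    and q: "\<And>x. x \<in> H \<Longrightarrow> cinner x (Q x) = cinner (Q x) (Q x)"
  shows "orthogonal_projection H Q"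
proof -
  have pol: "cinner x (Q y) = cinner (Q x) (Q y)" if x: "x \<in> H" and y: "y \<in> H" for x y
  proof -
    have iy: "\<i> *\<^sub>C y \<in> H"
      using cvec.subspace_scale[OF H y] .
    have "cinner (x + y) (Q (x + y)) = cinner (Q (x + y)) (Q (x + y))"
      "cinner (x + \<i> *\<^sub>C y) (Q (x + \<i> *\<^sub>C y)) = cinner (Q (x + \<i> *\<^sub>C y)) (Q (x + \<i> *\<^sub>C y))"
      using q cvec.subspace_add[OF H] x y iy by blast+
    hence eq: "cinner x (Q y) + cinner y (Q x) = cinner (Q x) (Q y) + cinner (Q y) (Q x)"
      "\<i> * cinner x (Q y) - \<i> * cinner y (Q x) = \<i> * cinner (Q x) (Q y) - \<i> * cinner (Q y) (Q x)"
      using q[OF x] q[OF y]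
      by (simp_all add: clinear_on_add[OF Q(1) x y] clinear_on_add[OF Q(1) x iy]
          clinear_on_scale[OF Q(1) y] cinner.add_left cinner.add_right cinner_scaleC_left
          cinner_scaleC_right algebra_simps)
    have "cinner x (Q y) - cinner y (Q x) = cinner (Q x) (Q y) - cinner (Q y) (Q x)"
      using eq(2) by (simp flip: right_diff_distrib)
    hence "(cinner x (Q y) + cinner y (Q x)) + (cinner x (Q y) - cinner y (Q x)) =
        (cinner (Q x) (Q y) + cinner (Q y) (Q x)) + (cinner (Q x) (Q y) - cinner (Q y) (Q x))"
      by (simp only: eq(1))
    thus ?thesis
      by simp
  qed
  have sym: "cinner (Q x) y = cinner x (Q y)" if "x \<in> H" "y \<in> H" for x y
    using pol[OF that] pol[OF that(2,1)] cinner_commute by metis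
  have idem: "Q (Q y) = Q y" if y: "y \<in> H" for y
  proof (rule cinner_eqI[OF H])
    fix x assume x: "x \<in> H"
    show "cinner x (Q (Q y)) = cinner x (Q y)"
      using sym[OF x Q(2)[OF y]] pol[OF x y] by simp
  qed (use Q y in auto)
  have "norm (Q x) \<le> 1 * norm x" if x: "x \<in> H" for x
  proof -
    have "norm (Q x) * norm (Q x) = cmod (cinner x (Q x))"
      by (simp add: q[OF x] cinner_self power2_eq_square norm_mult)
    also have "\<dots> \<le> norm x * norm (Q x)"
      by (rule cinner_cauchy_schwarz)
    finally show ?thesis
      by (cases "Q x = 0") auto
  qed
  with Q sym idem show ?thesis
    unfolding orthogonal_projection_def bounded_operators_def by blast
qed

lemma orthogonal_projectionD:
  assumes "orthogonal_projection H Q"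
  shows "clinear_on H Q" "x \<in> H \<Longrightarrow> Q x \<in> H" "x \<in> H \<Longrightarrow> Q (Q x) = Q x"
    "x \<in> H \<Longrightarrow> y \<in> H \<Longrightarrow> cinner (Q x) y = cinner x (Q y)"
  using assms by (auto simp: orthogonal_projection_def bounded_operators_def)

lemma orthogonal_projection_norm:
  assumes "orthogonal_projection H Q" "x \<in> H"
  shows "cinner x (Q x) = complex_of_real ((norm (Q x))\<^sup>2)"
proof -
  have "cinner (Q x) (Q x) = cinner x (Q (Q x))"
    by (rule orthogonal_projectionD[OF assms(1)])
      (use assms orthogonal_projectionD[OF assms(1)] in auto)
  thus ?thesis
    by (simp only: orthogonal_projectionD(3)[OF assms] cinner_self)
qed

lemma orthogonal_projection_norm_le:
  assumes "orthogonal_projection H Q" "x \<in> H"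
  shows "norm (Q x) \<le> norm x"
proof -
  have "norm (Q x) * norm (Q x) = cmod (cinner x (Q x))"
    by (simp add: orthogonal_projection_norm[OF assms] power2_eq_square norm_mult)
  also have "\<dots> \<le> norm x * norm (Q x)"
    by (rule cinner_cauchy_schwarz)
  finally show ?thesis
    by (cases "Q x = 0") auto
qed

section \<open>Spectral projections as strong limits, extended to Borel sets\<close>

context dense_unitary_group
begin

lemma norm_laurent_op_diff:
  assumes x: "x \<in> H"
  shows "(norm (laurent_op ps x - laurent_op qs x))\<^sup>2 = (LINT s|mu x. (cmod (laurent ps (cay s) - laurent qs (cay s)))\<^sup>2)"
proof -
  let ?rs = "ps @ lmul [(-1, 0)] qs"
  have "laurent_op [(-1, 0)] (laurent_op qs x) = - laurent_op qs x"
    by (simp add: V_0 laurent_op_H x)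
  hence "laurent_op ?rs x = laurent_op ps x - laurent_op qs x"
    by (simp only: laurent_op_append laurent_op_mul[OF x]) simp
  moreover have "laurent ?rs (cay s) = laurent ps (cay s) - laurent qs (cay s)" for s
    unfolding laurent_append laurent_mul[OF norm_cay] by simp
  ultimately show ?thesis
    using norm_laurent_op[OF x, of ?rs] by (simp only:)
qed

text \<open>By the isometry the vectors are Cauchy once the functions converge in L2 of
  \<open>mu x\<close>. The majorant \<open>g\<close> may be unbounded: a constant serves for
  indicators, \<open>4 (1 + s^2)\<close> for the function \<open>s + i\<close>.\<close>

lemma laurent_op_convergent:
  assumes x: "x \<in> H" and f [measurable]: "f \<in> borel_measurable borel"
    and lim: "\<And>s. (\<lambda>j. laurent (p j) (cay s)) \<longlonglongrightarrow> f s"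
    and g [measurable]: "integrable (mu x) g" and bound: "\<And>j s. (cmod (laurent (p j) (cay s)))\<^sup>2 \<le> g s"
  shows "convergent (\<lambda>j. laurent_op (p j) x)"
proof -
  note [measurable_cong] = sets_mu[OF x]
  define E where "E j = (LINT s|mu x. (cmod (laurent (p j) (cay s) - f s))\<^sup>2)" for j
  have sq: "(cmod (a - b))\<^sup>2 \<le> 2 * (cmod a)\<^sup>2 + 2 * (cmod b)\<^sup>2" for a b
    using power_mono[OF norm_triangle_ineq4[of a b] norm_ge_zero, of 2]
      sum_squares_bound[of "cmod a" "cmod b"] by (simp add: power2_sum)
  have fg: "(cmod (f s))\<^sup>2 \<le> g s" for s
    by (rule LIMSEQ_le_const2[OF tendsto_power[OF tendsto_norm[OF lim[of s]], of 2]]) (use bound in auto)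
  have bd: "(cmod (laurent (p j) (cay s) - f s))\<^sup>2 \<le> 4 * g s" for j s
    using sq[of "laurent (p j) (cay s)" "f s"] bound[of j s] fg[of s] by linarith
  have int: "integrable (mu x) (\<lambda>s. (cmod (laurent (p j) (cay s) - f s))\<^sup>2)" for j
    by (rule Bochner_Integration.integrable_bound[of _ "\<lambda>s. 4 * g s"]) (use g bd in \<open>auto intro!: AE_I2 order_trans[OF bd]\<close>)
  have "E \<longlonglongrightarrow> (LINT s|mu x. 0)"
    unfolding E_def
  proof (rule integral_dominated_convergence[where w = "\<lambda>s. 4 * g s"])
    have "(\<lambda>j. (cmod (laurent (p j) (cay s) - f s))\<^sup>2) \<longlonglongrightarrow> (cmod (f s - f s))\<^sup>2" for s
      by (intro tendsto_intros lim)
    thus "AE s in mu x. (\<lambda>j. (cmod (laurent (p j) (cay s) - f s))\<^sup>2) \<longlonglongrightarrow> 0"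
      by (intro AE_I2) simp
    show "AE s in mu x. norm ((cmod (laurent (p j) (cay s) - f s))\<^sup>2) \<le> 4 * g s" for j
      by (intro AE_I2) (simp add: bd)
  qed (use g in auto)
  hence E0: "E \<longlonglongrightarrow> 0"
    by simp
  have le: "(norm (laurent_op (p i) x - laurent_op (p j) x))\<^sup>2 \<le> 2 * E i + 2 * E j" for i j
  proof -
    have "(norm (laurent_op (p i) x - laurent_op (p j) x))\<^sup>2 \<le>
        (LINT s|mu x. 2 * (cmod (laurent (p i) (cay s) - f s))\<^sup>2 + 2 * (cmod (laurent (p j) (cay s) - f s))\<^sup>2)"
      unfolding norm_laurent_op_diff[OF x]
    proof (rule integral_mono')
      show "integrable (mu x) (\<lambda>s. 2 * (cmod (laurent (p i) (cay s) - f s))\<^sup>2 + 2 * (cmod (laurent (p j) (cay s) - f s))\<^sup>2)"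
        using int by simp
      show "(cmod (laurent (p i) (cay s) - laurent (p j) (cay s)))\<^sup>2 \<le>
        2 * (cmod (laurent (p i) (cay s) - f s))\<^sup>2 + 2 * (cmod (laurent (p j) (cay s) - f s))\<^sup>2" for s
        using sq[of "laurent (p i) (cay s) - f s" "laurent (p j) (cay s) - f s"] by simp
    qed auto
    also have "\<dots> = 2 * E i + 2 * E j"
      using int by (simp add: E_def)
    finally show ?thesis .
  qed
  from tendsto_mult_right_zero[OF E0, of 2] show ?thesis
    by (rule convergent_if_sq_dist_le[OF le])
qed

text \<open>The form determines \<open>Q\<close> on \<open>H\<close>
  (\<open>proj_for_unique\<close>), so existence can be proved by induction over Borel sets without
  fixing the operators beforehand.\<close>

definition proj_for :: "real set \<Rightarrow> ('a \<Rightarrow> 'a) \<Rightarrow> bool" where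
  "proj_for \<Omega> Q \<longleftrightarrow> orthogonal_projection H Q \<and>
     (\<forall>x\<in>H. cinner x (Q x) = complex_of_real (measure (mu x) \<Omega>))"

text \<open>The two limits make \<open><x, Q x>\<close> and \<open>|Q x|^2\<close> agree, which is
  the criterion of \<open>orthogonal_projectionI\<close>. Closed sets and countable unions both go
  through this lemma.\<close>

lemma proj_for_limit:
  assumes T: "\<And>j::nat. clinear_on H (T j)" "\<And>j x. x \<in> H \<Longrightarrow> T j x \<in> H"
    and conv: "\<And>x. x \<in> H \<Longrightarrow> convergent (\<lambda>j. T j x)"
    and lim: "\<And>x. x \<in> H \<Longrightarrow> (\<lambda>j. cinner x (T j x)) \<longlonglongrightarrow> complex_of_real (measure (mu x) \<Omega>)"
      "\<And>x. x \<in> H \<Longrightarrow> (\<lambda>j. (norm (T j x))\<^sup>2) \<longlonglongrightarrow> measure (mu x) \<Omega>"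
  shows "proj_for \<Omega> (\<lambda>x. lim (\<lambda>j. T j x)) \<and> (\<forall>x\<in>H. (\<lambda>j. T j x) \<longlonglongrightarrow> lim (\<lambda>j. T j x))"
proof -
  define Q where "Q x = lim (\<lambda>j. T j x)" for x
  have TQ: "(\<lambda>j. T j x) \<longlonglongrightarrow> Q x" if "x \<in> H" for x
    using conv[OF that] by (simp add: Q_def convergent_LIMSEQ_iff)
  have QH: "Q x \<in> H" if "x \<in> H" for x
    using closed_sequentially[OF closed_H _ TQ[OF that]] T(2)[OF that] by simp
  have qx: "cinner x (Q x) = complex_of_real (measure (mu x) \<Omega>)" if x: "x \<in> H" for x
    by (rule LIMSEQ_unique[OF cinner.tendsto[OF tendsto_const TQ[OF x]] lim(1)[OF x]])
  have nx: "(norm (Q x))\<^sup>2 = measure (mu x) \<Omega>" if x: "x \<in> H" for x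
    by (rule LIMSEQ_unique[OF tendsto_power[OF tendsto_norm[OF TQ[OF x]]] lim(2)[OF x]])
  have "clinear_on H Q"
    unfolding clinear_on_def
  proof safe
    fix x y assume xy: "x \<in> H" "y \<in> H"
    have "(\<lambda>j. T j x + T j y) \<longlonglongrightarrow> Q (x + y)"
      using TQ[OF H_add[OF xy]] clinear_on_add[OF T(1) xy] by simp
    thus "Q (x + y) = Q x + Q y"
      using LIMSEQ_unique[OF _ tendsto_add[OF TQ[OF xy(1)] TQ[OF xy(2)]]] by blast
  next
    fix c x assume x: "x \<in> H"
    have "(\<lambda>j. c *\<^sub>C T j x) \<longlonglongrightarrow> Q (c *\<^sub>C x)"
      using TQ[OF H_scale[OF x]] clinear_on_scale[OF T(1) x] by simp
    thus "Q (c *\<^sub>C x) = c *\<^sub>C Q x"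
      using LIMSEQ_unique[OF _ scaleC.tendsto[OF tendsto_const TQ[OF x]]] by blast
  qed
  hence "orthogonal_projection H Q"
    using QH qx nx by (intro orthogonal_projectionI subspace_H) (auto simp: cinner_self)
  hence "proj_for \<Omega> Q \<and> (\<forall>x\<in>H. (\<lambda>j. T j x) \<longlonglongrightarrow> Q x)"
    using qx TQ unfolding proj_for_def by blast
  thus ?thesis
    unfolding Q_def .
qed

lemma proj_for_closed:
  assumes C: "closed C"
  shows "\<exists>Q. proj_for C Q"
proof -
  obtain p :: "nat \<Rightarrow> _" where p: "\<forall>s. (\<lambda>j. laurent (p j) (cay s)) \<longlonglongrightarrow> indicator C s"
    "\<forall>j s. cmod (laurent (p j) (cay s)) \<le> 2"
    using laurent_indicator[OF C] by blast
  have [measurable]: "C \<in> sets borel"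
    using C by simp
  have bd: "(cmod (laurent (p j) (cay s)))\<^sup>2 \<le> 4" for j s
    using power_mono[OF p(2)[rule_format, of j s] norm_ge_zero, of 2] by simp
  have "proj_for C (\<lambda>x. lim (\<lambda>j. laurent_op (p j) x)) \<and> (\<forall>x\<in>H. (\<lambda>j. laurent_op (p j) x) \<longlonglongrightarrow> lim (\<lambda>j. laurent_op (p j) x))"
  proof (rule proj_for_limit)
    fix x assume x: "x \<in> H"
    interpret finite_measure "mu x" by (rule finite_mu[OF x])
    note [measurable_cong] = sets_mu[OF x]
    have sp: "space (mu x) = UNIV"
      by (simp add: sets_eq_imp_space_eq[OF sets_mu[OF x]])
    show "convergent (\<lambda>j. laurent_op (p j) x)"
      by (rule laurent_op_convergent[OF x, where f = "indicator C" and g = "\<lambda>_. 4"]) (use p bd in auto)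
    show "(\<lambda>j. cinner x (laurent_op (p j) x)) \<longlonglongrightarrow> complex_of_real (measure (mu x) C)"
      unfolding cinner_laurent_op[OF x]
      by (rule integral_laurent_tendsto_measure[OF finite_mu[OF x] sets_mu[OF x] C p])
    have "(\<lambda>j. LINT s|mu x. (cmod (laurent (p j) (cay s)))\<^sup>2) \<longlonglongrightarrow> (LINT s|mu x. indicator C s)"
    proof (rule integral_dominated_convergence[where w = "\<lambda>_. 4"])
      have "(\<lambda>j. (cmod (laurent (p j) (cay s)))\<^sup>2) \<longlonglongrightarrow> (cmod (indicator C s))\<^sup>2" for s
        using p(1) by (intro tendsto_intros) simp
      moreover have "(cmod (indicator C s))\<^sup>2 = indicator C s" for s
        by (simp add: indicator_def)
      ultimately show "AE s in mu x. (\<lambda>j. (cmod (laurent (p j) (cay s)))\<^sup>2) \<longlonglongrightarrow> indicator C s"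
        by (intro AE_I2) simp
      show "AE s in mu x. norm ((cmod (laurent (p j) (cay s)))\<^sup>2) \<le> 4" for j
        using bd by (intro AE_I2) simp
    qed auto
    also have "(LINT s|mu x. indicator C s) = measure (mu x) C"
      by (simp add: sp)
    finally show "(\<lambda>j. (norm (laurent_op (p j) x))\<^sup>2) \<longlonglongrightarrow> measure (mu x) C"
      by (simp only: norm_laurent_op[OF x])
  qed (use laurent_op_linear laurent_op_H in auto)
  thus ?thesis
    by blast
qed

lemma proj_for_unique:
  assumes "proj_for \<Omega> Q" "proj_for \<Omega> Q'" "x \<in> H"
  shows "Q x = Q' x"
proof -
  have Q: "orthogonal_projection H Q" "orthogonal_projection H Q'"
    using assms by (auto simp: proj_for_def)
  note Q1 = orthogonal_projectionD[OF Q(1)] and Q2 = orthogonal_projectionD[OF Q(2)]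
  have "(\<lambda>x. Q x - Q' x) x = 0"
  proof (rule quadratic_form_zero[OF subspace_H _ _ _ assms(3)])
    show "clinear_on H (\<lambda>x. Q x - Q' x)"
      using Q1(1) Q2(1) by (simp add: clinear_on_def scaleC.diff_right)
    show "Q x - Q' x \<in> H" if "x \<in> H" for x
      using that Q1(2) Q2(2) H_diff by blast
    show "cinner x (Q x - Q' x) = 0" if "x \<in> H" for x
      using that assms(1,2) by (simp add: proj_for_def cinner.diff_right)
  qed
  thus ?thesis
    by simp
qed

lemma proj_for_norm:
  assumes "proj_for \<Omega> Q" "x \<in> H"
  shows "(norm (Q x))\<^sup>2 = measure (mu x) \<Omega>"
  using orthogonal_projection_norm[of H Q x] assms unfolding proj_for_def
  by (metis of_real_eq_iff)

lemma proj_for_compl: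
  assumes Q: "proj_for \<Omega> Q" and \<Omega>: "\<Omega> \<in> sets borel"
  shows "proj_for (UNIV - \<Omega>) (\<lambda>x. x - Q x)"
proof -
  have oQ: "orthogonal_projection H Q"
    using Q by (simp add: proj_for_def)
  note oQD = orthogonal_projectionD[OF oQ]
  have m: "measure (mu x) (UNIV - \<Omega>) = (norm x)\<^sup>2 - measure (mu x) \<Omega>" if x: "x \<in> H" for x
  proof -
    interpret finite_measure "mu x" by (rule finite_mu[OF x])
    have "space (mu x) = UNIV"
      by (simp add: sets_eq_imp_space_eq[OF sets_mu[OF x]])
    thus ?thesis
      using finite_measure_compl[of \<Omega>] \<Omega> measure_mu_UNIV[OF x] by (simp add: sets_mu[OF x])
  qed
  have q: "cinner x (x - Q x) = complex_of_real (measure (mu x) (UNIV - \<Omega>))" if x: "x \<in> H" for x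
    using Q x by (simp add: proj_for_def cinner.diff_right cinner_self m)
  have n: "(norm (x - Q x))\<^sup>2 = measure (mu x) (UNIV - \<Omega>)" if x: "x \<in> H" for x
    using Q x proj_for_norm[OF Q x] by (simp add: proj_for_def norm_sq_diff m)
  have "orthogonal_projection H (\<lambda>x. x - Q x)"
  proof (rule orthogonal_projectionI[OF subspace_H])
    show "clinear_on H (\<lambda>x. x - Q x)"
      using oQD(1) by (simp add: clinear_on_def scaleC.diff_right)
    show "x - Q x \<in> H" if "x \<in> H" for x
      using that oQD(2) H_diff by blast
    show "cinner x (x - Q x) = cinner (x - Q x) (x - Q x)" if "x \<in> H" for x
      unfolding cinner_self n[OF that] by (rule q[OF that])
  qed
  with q show ?thesis
    by (simp add: proj_for_def)
qed

text \<open>For \<open>y = Q' x\<close> the set \<open>\<Omega>'\<close> already has the full mass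
  \<open>|y|^2\<close> of \<open>mu y\<close>, so nothing is left for
  \<open>\<Omega>\<close>.\<close>

lemma proj_for_disjoint:
  assumes Q: "proj_for \<Omega> Q" "proj_for \<Omega>' Q'" and \<Omega>: "\<Omega> \<in> sets borel" "\<Omega>' \<in> sets borel"
    and disj: "\<Omega> \<inter> \<Omega>' = {}" and x: "x \<in> H"
  shows "Q (Q' x) = 0"
proof -
  define y where "y = Q' x"
  have oQ: "orthogonal_projection H Q'"
    using Q by (simp add: proj_for_def)
  note oQD = orthogonal_projectionD[OF oQ]
  have y: "y \<in> H" "Q' y = y"
    using oQD(2,3)[OF x] by (auto simp: y_def)
  interpret finite_measure "mu y" by (rule finite_mu[OF y(1)])
  have "measure (mu y) \<Omega> + measure (mu y) \<Omega>' = measure (mu y) (\<Omega> \<union> \<Omega>')"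
    using \<Omega> disj by (subst finite_measure_Union) (auto simp: sets_mu[OF y(1)])
  also have "\<dots> \<le> measure (mu y) UNIV"
    using \<Omega> by (intro finite_measure_mono) (auto simp: sets_mu[OF y(1)])
  finally have "(norm (Q y))\<^sup>2 + (norm y)\<^sup>2 \<le> (norm y)\<^sup>2"
    using proj_for_norm[OF Q(1) y(1)] proj_for_norm[OF Q(2) y(1)] y(2) measure_mu_UNIV[OF y(1)]
    by simp
  thus ?thesis
    by (simp add: y_def)
qed

text \<open>The ranges are orthogonal, so squared norms of partial sums are partial sums of
  measures, and countable additivity of \<open>mu x\<close> forces convergence.\<close>

lemma proj_for_Union:
  assumes Q: "\<And>j::nat. proj_for (\<Omega> j) (Q j)" and \<Omega>: "range \<Omega> \<subseteq> sets borel" "disjoint_family \<Omega>"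
  shows "\<exists>P. proj_for (\<Union>j. \<Omega> j) P \<and> (\<forall>x\<in>H. (\<lambda>j. Q j x) sums P x)"
proof -
  have oQ: "orthogonal_projection H (Q j)" for j
    using Q by (simp add: proj_for_def)
  note oQD = orthogonal_projectionD[OF oQ]
  define T where "T n x = (\<Sum>j<n. Q j x)" for n x
  have orth: "cinner (Q i x) (Q j x) = 0" if "i \<noteq> j" "x \<in> H" for i j x
  proof -
    have "Q i (Q j x) = 0"
      using that \<Omega> by (intro proj_for_disjoint[OF Q Q]) (auto simp: disjoint_family_on_def)
    thus ?thesis
      using oQD(4)[of x "Q j x" i] oQD(2) that by simp
  qed
  have pyth: "(norm (\<Sum>j\<in>F. Q j x))\<^sup>2 = (\<Sum>j\<in>F. measure (mu x) (\<Omega> j))" if "finite F" "x \<in> H" for F x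
    using that(1)
  proof (induction F)
    case (insert i F)
    have "cinner (Q i x) (\<Sum>j\<in>F. Q j x) = (\<Sum>j\<in>F. 0)"
      unfolding cinner.sum_right using insert that(2) by (intro sum.cong orth) auto
    thus ?case
      using insert proj_for_norm[OF Q that(2)] by (simp add: norm_sq_add)
  qed simp
  have sums: "(\<lambda>j. measure (mu x) (\<Omega> j)) sums measure (mu x) (\<Union>j. \<Omega> j)" if x: "x \<in> H" for x
  proof -
    interpret finite_measure "mu x" by (rule finite_mu[OF x])
    show ?thesis
      using \<Omega> by (intro finite_measure_UNION) (auto simp: sets_mu[OF x])
  qed
  have "proj_for (\<Union>j. \<Omega> j) (\<lambda>x. lim (\<lambda>n. T n x)) \<and> (\<forall>x\<in>H. (\<lambda>n. T n x) \<longlonglongrightarrow> lim (\<lambda>n. T n x))"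
  proof (rule proj_for_limit)
    show "clinear_on H (T n)" for n
      using oQD(1) by (simp add: clinear_on_def T_def sum.distrib scaleC.sum_right)
    show "T n x \<in> H" if "x \<in> H" for n x
      using that oQD(2) by (auto simp: T_def intro!: H_sum)
    fix x assume x: "x \<in> H"
    define S where "S n = (\<Sum>j<n. measure (mu x) (\<Omega> j))" for n
    have S: "S \<longlonglongrightarrow> measure (mu x) (\<Union>j. \<Omega> j)"
      using sums[OF x] unfolding sums_def S_def[abs_def] .
    have dist: "(norm (T m x - T n x))\<^sup>2 = S m - S n" if "n \<le> m" for m n
    proof -
      have "T m x - T n x = (\<Sum>j\<in>{n..<m}. Q j x)" "S m - S n = (\<Sum>j\<in>{n..<m}. measure (mu x) (\<Omega> j))"
        using that sum_diff_nat_ivl[of 0 n m] by (simp_all add: T_def S_def lessThan_atLeast0)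
      thus ?thesis
        using pyth[of "{n..<m}" x] x by simp
    qed
    show "convergent (\<lambda>n. T n x)"
    proof (rule convergent_if_sq_dist_le)
      let ?s = "measure (mu x) (\<Union>j. \<Omega> j)"
      show "(norm (T m x - T n x))\<^sup>2 \<le> \<bar>S m - ?s\<bar> + \<bar>S n - ?s\<bar>" for m n
        using dist[of n m] dist[of m n] by (cases "n \<le> m") (simp_all add: norm_minus_commute)
      show "(\<lambda>n. \<bar>S n - ?s\<bar>) \<longlonglongrightarrow> 0"
        by (intro tendsto_rabs_zero LIM_zero S)
    qed
    have "cinner x (T n x) = complex_of_real (S n)" for n
      using Q x by (simp add: T_def S_def cinner.sum_right proj_for_def)
    thus "(\<lambda>n. cinner x (T n x)) \<longlonglongrightarrow> complex_of_real (measure (mu x) (\<Union>j. \<Omega> j))"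
      using tendsto_of_real[OF S] by simp
    have "(norm (T n x))\<^sup>2 = S n" for n
      using pyth[of "{..<n}" x] x by (simp add: T_def S_def)
    thus "(\<lambda>n. (norm (T n x))\<^sup>2) \<longlonglongrightarrow> measure (mu x) (\<Union>j. \<Omega> j)"
      using S by simp
  qed
  thus ?thesis
    unfolding sums_def T_def by blast
qed

lemma proj_for_exists:
  assumes "\<Omega> \<in> sets borel"
  shows "\<exists>Q. proj_for \<Omega> Q"
proof -
  have stable: "Int_stable {C :: real set. closed C}"
    by (auto simp: Int_stable_def)
  have "\<Omega> \<in> sigma_sets UNIV {C. closed C}"
    using assms by (simp add: borel_eq_closed)
  note A = this
  have "{C :: real set. closed C} \<subseteq> Pow UNIV"
    by simp
  from stable this A show ?thesis
  proof (induction rule: sigma_sets_induct_disjoint)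
    case (basic A)
    then show ?case
      using proj_for_closed by simp
  next
    case empty
    then show ?case
      using proj_for_closed by simp
  next
    case (compl A)
    have "A \<in> sets borel"
      using compl(1) by (simp add: borel_eq_closed)
    then show ?case
      using compl(2) proj_for_compl by blast
  next
    case (union A)
    have "range A \<subseteq> sets borel"
      using union(2) by (simp add: borel_eq_closed)
    moreover from union(3) obtain Q where "\<And>j. proj_for (A j) (Q j)"
      by metis
    ultimately show ?case
      using proj_for_Union[of A Q] union(1) by blast
  qed
qed

definition PV :: "real set \<Rightarrow> 'a \<Rightarrow> 'a" where
  "PV \<Omega> = (SOME Q. proj_for \<Omega> Q)"

lemma proj_for_PV: "\<Omega> \<in> sets borel \<Longrightarrow> proj_for \<Omega> (PV \<Omega>)"
  unfolding PV_def by (rule someI_ex[OF proj_for_exists])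

lemma projection_valued_measure_PV: "projection_valued_measure H PV"
  unfolding projection_valued_measure_def
proof (intro conjI ballI allI impI)
  show "orthogonal_projection H (PV \<Omega>)" if "\<Omega> \<in> sets borel" for \<Omega>
    using proj_for_PV[OF that] by (simp add: proj_for_def)
  show "PV UNIV x = x" if x: "x \<in> H" for x
  proof -
    have P: "proj_for UNIV (PV UNIV)"
      by (rule proj_for_PV) simp
    have "(norm (x - PV UNIV x))\<^sup>2 = 0"
      using P x proj_for_norm[OF P x] measure_mu_UNIV[OF x] by (simp add: norm_sq_diff proj_for_def)
    thus ?thesis
      by simp
  qed
  fix \<Omega> :: "nat \<Rightarrow> real set" and x assume \<Omega>: "range \<Omega> \<subseteq> sets borel" "disjoint_family \<Omega>" and x: "x \<in> H"
  have PVj: "proj_for (\<Omega> j) (PV (\<Omega> j))" for j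
    using \<Omega>(1) by (intro proj_for_PV) auto
  have U: "(\<Union>j. \<Omega> j) \<in> sets borel"
    using \<Omega>(1) by (intro sets.countable_UN) auto
  obtain P where P: "proj_for (\<Union>j. \<Omega> j) P" "\<forall>x\<in>H. (\<lambda>j. PV (\<Omega> j) x) sums P x"
    using proj_for_Union[of \<Omega> "\<lambda>j. PV (\<Omega> j)", OF PVj \<Omega>] by blast
  show "(\<lambda>k. PV (\<Omega> k) x) sums PV (\<Union>k. \<Omega> k) x"
    unfolding proj_for_unique[OF proj_for_PV[OF U] P(1) x] using P(2) x by blast
qed

lemma scalar_measure_PV:
  assumes x: "x \<in> H"
  shows "scalar_measure PV x = mu x"
proof -
  interpret finite_measure "mu x" by (rule finite_mu[OF x])
  have sp: "space (mu x) = UNIV"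
    by (simp add: sets_eq_imp_space_eq[OF sets_mu[OF x]])
  have "scalar_measure PV x = measure_of UNIV (sets borel) (emeasure (mu x))"
    unfolding scalar_measure_def
  proof (rule measure_of_eq)
    fix \<Omega> :: "real set" assume "\<Omega> \<in> sigma_sets UNIV (sets borel)"
    hence "\<Omega> \<in> sets borel"
      using sets.sigma_sets_eq[of "borel :: real measure"] by simp
    from proj_for_PV[OF this] x show "ennreal (Re (cinner x (PV \<Omega> x))) = emeasure (mu x) \<Omega>"
      by (simp add: proj_for_def emeasure_eq_measure)
  qed simp
  also have "\<dots> = mu x"
    using measure_of_of_measure[of "mu x"] by (simp add: sp sets_mu[OF x])
  finally show ?thesis .
qed

end

section \<open>The spectral theorem\<close>

text \<open>\<open>W\<close> is to invert \<open>U\<close> on \<open>H\<close>. It is a separate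
  argument because operators are arbitrary outside \<open>H\<close>, so the inverse function of
  \<open>U\<close> on the type is of no use.\<close>

definition int_power :: "('a \<Rightarrow> 'a) \<Rightarrow> ('a \<Rightarrow> 'a) \<Rightarrow> int \<Rightarrow> 'a \<Rightarrow> 'a" where
  "int_power U W k = (if k \<ge> 0 then U ^^ nat k else W ^^ nat (- k))"

lemma unitary_group_int_power:
  fixes U W :: "'a::chilbert_space \<Rightarrow> 'a"
  assumes H: "hilbert_space H"
    and U: "clinear_on H U" "\<And>x. x \<in> H \<Longrightarrow> U x \<in> H" "\<And>x. x \<in> H \<Longrightarrow> norm (U x) = norm x"
    and W: "clinear_on H W" "\<And>x. x \<in> H \<Longrightarrow> W x \<in> H" "\<And>x. x \<in> H \<Longrightarrow> norm (W x) = norm x"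
    and WU: "\<And>x. x \<in> H \<Longrightarrow> W (U x) = x" and UW: "\<And>x. x \<in> H \<Longrightarrow> U (W x) = x"
  shows "unitary_group H (int_power U W)"
proof -
  have pow: "clinear_on H (X ^^ n) \<and> (\<forall>x\<in>H. (X ^^ n) x \<in> H \<and> norm ((X ^^ n) x) = norm x)"
    if X: "clinear_on H X" "\<And>x. x \<in> H \<Longrightarrow> X x \<in> H" "\<And>x. x \<in> H \<Longrightarrow> norm (X x) = norm x" for X n
    by (induction n) (use X in \<open>auto simp: clinear_on_def\<close>)
  have lin: "clinear_on H (int_power U W k)" for k
    unfolding int_power_def using pow[OF U] pow[OF W] by auto
  have inH: "int_power U W k x \<in> H" and nrm: "norm (int_power U W k x) = norm x" if "x \<in> H" for k x
    unfolding int_power_def using pow[OF U] pow[OF W] that by auto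
  have step: "U (int_power U W k x) = int_power U W (k + 1) x" if x: "x \<in> H" for k x
  proof (cases "k \<ge> 0")
    case True
    thus ?thesis
      by (simp add: int_power_def nat_add_distrib)
  next
    case False
    define n where "n = nat (- k - 1)"
    have n: "nat (- k) = Suc n" "nat (- (k + 1)) = n"
      using False by (auto simp: n_def)
    have "int_power U W (k + 1) x = (W ^^ n) x"
    proof (cases "k = -1")
      case True
      thus ?thesis
        by (simp add: int_power_def n_def)
    next
      case False
      with \<open>\<not> k \<ge> 0\<close> have "\<not> k + 1 \<ge> 0"
        by simp
      thus ?thesis
        unfolding int_power_def n(2) by simp
    qed
    moreover have "int_power U W k x = W ((W ^^ n) x)"
      using False n(1) by (simp add: int_power_def)
    ultimately show ?thesis
      using UW pow[OF W] x by simp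
  qed
  have step': "W (int_power U W k x) = int_power U W (k - 1) x" if x: "x \<in> H" for k x
    using step[OF x, of "k - 1"] WU[OF inH[OF x, of "k - 1"]] by simp
  have add: "int_power U W j (int_power U W k x) = int_power U W (j + k) x" if x: "x \<in> H" for j k x
  proof (induction j rule: int_induct[where k = 0])
    case base
    show ?case
      by (simp add: int_power_def)
  next
    case (step1 j)
    show ?case
      using step[OF inH[OF x, of k], of j] step[OF x, of "j + k"] step1 by (simp add: add_ac)
  next
    case (step2 j)
    show ?case
      using step'[OF inH[OF x, of k], of j] step'[OF x, of "j + k"] step2 by (simp add: algebra_simps)
  qed
  show ?thesis
  proof
    show "int_power U W 0 x = x" for x
      by (simp add: int_power_def)
  qed (use H lin inH nrm add in auto)
qed

lemma norm_inverse_real_plus_i: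
  "(cmod (inverse (complex_of_real s + \<i>)))\<^sup>2 = 1 / (1 + s\<^sup>2)"
proof -
  have "(cmod (inverse (complex_of_real s + \<i>)))\<^sup>2 = inverse ((cmod (complex_of_real s + \<i>))\<^sup>2)"
    by (simp only: norm_inverse power_inverse)
  thus ?thesis
    by (simp add: cmod_power2 inverse_eq_divide add.commute)
qed

context self_adjoint_operator
begin

definition Vc :: "int \<Rightarrow> 'a \<Rightarrow> 'a" where
  "Vc = int_power (cayley \<i>) (cayley (- \<i>))"

lemma Vc_1: "Vc 1 = cayley \<i>"
  by (simp add: Vc_def int_power_def)

lemma dense_unitary_group_Vc: "dense_unitary_group H Vc"
proof -
  have i: "Re \<i> = 0" "cmod \<i> = 1" "Re (- \<i>) = 0" "cmod (- \<i>) = 1"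
    by simp_all
  interpret unitary_group H Vc
    unfolding Vc_def
    using cayley_cayley[OF i(1,2)] cayley_cayley[OF i(3,4)]
    by (intro unitary_group_int_power hilbert cayley_linear cayley_H norm_cayley i) auto
  show ?thesis
  proof
    have "op_dom A \<subseteq> (\<lambda>w. Vc 1 w - w) ` H"
    proof
      fix x assume x: "x \<in> op_dom A"
      \<comment> \<open>Chosen so that \<open>-2 i y = x\<close>.\<close>
      define y where "y = (\<i> / 2) *\<^sub>C x"
      have y: "y \<in> op_dom A"
        using x dom_scale by (simp add: y_def)
      define w where "w = shift \<i> y"
      have w: "w \<in> H" "shift_inv \<i> w = y"
        using y shift_H shift_inv_shift[OF i(1,2)] by (auto simp: w_def)
      have "Vc 1 w - w = - ((2 * \<i>) *\<^sub>C y)"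
        using cayley_eq[OF i(1,2) w(1)] w(2) by (simp add: Vc_1)
      also have "\<dots> = x"
        by (simp add: y_def scaleC_scaleC)
      finally show "x \<in> (\<lambda>w. Vc 1 w - w) ` H"
        using w(1) by blast
    qed
    thus "H \<subseteq> closure ((\<lambda>w. Vc 1 w - w) ` H)"
      using dom_dense closure_mono by blast
  qed
qed

sublocale V: dense_unitary_group H Vc
  by (rule dense_unitary_group_Vc)

abbreviation Rplus :: "'a \<Rightarrow> 'a" where
  "Rplus \<equiv> shift_inv \<i>"

lemma i_unit: "Re \<i> = 0" "cmod \<i> = 1"
  by simp_all

lemma Vc_eq: "w \<in> H \<Longrightarrow> Vc 1 w = w - (2 * \<i>) *\<^sub>C Rplus w"
  unfolding Vc_1 by (rule cayley_eq[OF i_unit])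

text \<open>The polynomial \<open>(1 - z) / (2 i)\<close>; at \<open>z = cay s\<close> it equals
  \<open>1 / (s + i)\<close>, so it represents \<open>(A + i)^-1\<close>.\<close>

definition inv_plus_i :: "(complex \<times> int) list" where
  "inv_plus_i = [(1 / (2 * \<i>), 0), (- (1 / (2 * \<i>)), 1)]"

lemma laurent_inv_plus_i: "laurent inv_plus_i (cay s) = inverse (complex_of_real s + \<i>)"
proof -
  have "(2 * \<i> / c) / (2 * \<i>) = inverse c" for c
    unfolding divide_divide_eq_left
    by (subst nonzero_divide_mult_cancel_right) (auto simp: inverse_eq_divide)
  moreover have "laurent inv_plus_i (cay s) = (1 - cay s) / (2 * \<i>)"
    by (simp add: inv_plus_i_def field_simps)
  ultimately show ?thesis
    unfolding one_minus_cay by (simp only:)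
qed

lemma laurent_op_inv_plus_i:
  assumes w: "w \<in> H"
  shows "V.laurent_op inv_plus_i w = Rplus w"
proof -
  have "V.laurent_op inv_plus_i w = (1 / (2 * \<i>)) *\<^sub>C (w - Vc 1 w)"
    by (simp add: inv_plus_i_def V.V_0 w scaleC.diff_right scaleC.minus_left)
  thus ?thesis
    by (simp add: Vc_eq w scaleC_scaleC)
qed

lemma Rplus_dom: "w \<in> H \<Longrightarrow> Rplus w \<in> op_dom A"
  by (rule shift_inv_dom[OF i_unit])

lemma app_Rplus: "w \<in> H \<Longrightarrow> op_app A (Rplus w) = w - \<i> *\<^sub>C Rplus w"
  using shift_shift_inv[OF i_unit, of w] by (simp add: shift_def eq_diff_eq)

lemma dom_eq_Rplus: "x \<in> op_dom A \<Longrightarrow> \<exists>w\<in>H. x = Rplus w"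
  using shift_inv_shift[OF i_unit] shift_H by metis

lemma mu_Rplus:
  assumes w: "w \<in> H"
  shows "V.mu (Rplus w) = density (V.mu w) (\<lambda>s. ennreal (1 / (1 + s\<^sup>2)))"
  using V.mu_laurent_op[OF w, of inv_plus_i] by (simp only: laurent_op_inv_plus_i[OF w] laurent_inv_plus_i norm_inverse_real_plus_i)

text \<open>For \<open>x = (A + i)^-1 w\<close> the measure of \<open>x\<close> has density
  \<open>1 / (1 + s^2)\<close> with respect to that of \<open>w\<close>, which absorbs the factor
  \<open>t^2\<close>.\<close>

lemma dom_second_moment:
  assumes x: "x \<in> op_dom A"
  shows "(\<integral>\<^sup>+ t. ennreal (t\<^sup>2) \<partial>V.mu x) < \<infinity>"
proof -
  obtain w where w: "w \<in> H" "x = Rplus w"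
    using dom_eq_Rplus[OF x] by blast
  interpret finite_measure "V.mu w" by (rule V.finite_mu[OF w(1)])
  note [measurable_cong] = V.sets_mu[OF w(1)]
  have "(\<integral>\<^sup>+ t. ennreal (t\<^sup>2) \<partial>V.mu x) = (\<integral>\<^sup>+ t. ennreal (1 / (1 + t\<^sup>2)) * ennreal (t\<^sup>2) \<partial>V.mu w)"
    unfolding w(2) mu_Rplus[OF w(1)] by (rule nn_integral_density) auto
  also have "\<dots> \<le> (\<integral>\<^sup>+ t. 1 \<partial>V.mu w)"
  proof (rule nn_integral_mono)
    fix t :: real
    have "1 / (1 + t\<^sup>2) * t\<^sup>2 \<le> 1"
      by (simp add: divide_le_eq add_pos_nonneg)
    thus "ennreal (1 / (1 + t\<^sup>2)) * ennreal (t\<^sup>2) \<le> 1"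
      by (simp flip: ennreal_mult)
  qed
  also have "\<dots> < \<infinity>"
    by (simp add: emeasure_eq_measure)
  finally show ?thesis .
qed

text \<open>For \<open>x = (A + i)^-1 w\<close> one has \<open>A x = w - i x\<close>. Hence
  \<open><x, A x>\<close> is the integral over \<open>mu w\<close> of
  \<open>1 / (s - i) - i / (1 + s^2) = s / (1 + s^2)\<close>, and the density of \<open>mu x\<close>
  turns this into a first moment.\<close>

lemma dom_first_moment:
  assumes x: "x \<in> op_dom A"
  shows "cinner x (op_app A x) = complex_of_real (LINT t|V.mu x. t)"
proof -
  obtain w where w: "w \<in> H" "x = Rplus w"
    using dom_eq_Rplus[OF x] by blast
  note [measurable_cong] = V.sets_mu[OF w(1)]
  let ?g = "\<lambda>s. laurent inv_plus_i (cay s)"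
  have int: "integrable (V.mu w) ?g"
    by (rule V.integrable_laurent[OF w(1)])
  have int2: "integrable (V.mu w) (\<lambda>s. laurent (lmul (lcnj inv_plus_i) inv_plus_i) (cay s))"
    by (rule V.integrable_laurent[OF w(1)])
  have "cinner w x = (LINT s|V.mu w. ?g s)"
    using V.cinner_laurent_op[OF w(1), of inv_plus_i] by (simp add: laurent_op_inv_plus_i w)
  hence "cinner x w = cnj (LINT s|V.mu w. ?g s)"
    using cinner_commute by metis
  moreover have "cinner x x = (LINT s|V.mu w. laurent (lmul (lcnj inv_plus_i) inv_plus_i) (cay s))"
  proof -
    have "cinner x x = cinner w (V.laurent_op (lmul (lcnj inv_plus_i) inv_plus_i) w)"
      unfolding V.laurent_op_mul[OF w(1)] laurent_op_inv_plus_i[OF w(1)] w(2)[symmetric]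
      using V.laurent_op_adjoint[OF w(1), of x inv_plus_i] laurent_op_inv_plus_i[OF w(1)] w(2) dom_H[OF x] by simp
    thus ?thesis
      by (simp only: V.cinner_laurent_op[OF w(1)])
  qed
  ultimately have "cinner x (op_app A x) =
      (LINT s|V.mu w. cnj (?g s)) - \<i> * (LINT s|V.mu w. laurent (lmul (lcnj inv_plus_i) inv_plus_i) (cay s))"
    using app_Rplus[OF w(1)] w(2) by (simp add: cinner.diff_right cinner_scaleC_right)
  also have "\<dots> = (LINT s|V.mu w. cnj (?g s) - \<i> * laurent (lmul (lcnj inv_plus_i) inv_plus_i) (cay s))"
    using int int2 by (subst Bochner_Integration.integral_diff) auto
  also have "\<dots> = (LINT s|V.mu w. complex_of_real ((1 / (1 + s\<^sup>2)) *\<^sub>R s))"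
  proof (intro Bochner_Integration.integral_cong refl)
    fix s :: real
    define z where "z = complex_of_real s + \<i>"
    have z: "z \<noteq> 0"
      by (simp add: z_def)
    have zz: "z * cnj z = complex_of_real (1 + s\<^sup>2)"
      by (simp add: z_def complex_eq_iff power2_eq_square)
    have "cnj (?g s) - \<i> * laurent (lmul (lcnj inv_plus_i) inv_plus_i) (cay s) =
        inverse (cnj z) - \<i> * (inverse (cnj z) * inverse z)"
      by (simp add: laurent_mul laurent_cnj laurent_inv_plus_i z_def del: complex_cnj_add)
    also have "\<dots> = (z - \<i>) / (z * cnj z)"
      using z by (simp add: field_simps)
    also have "\<dots> = complex_of_real ((1 / (1 + s\<^sup>2)) *\<^sub>R s)"
      unfolding zz by (simp add: z_def)
    finally show "cnj (?g s) - \<i> * laurent (lmul (lcnj inv_plus_i) inv_plus_i) (cay s) =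
      complex_of_real ((1 / (1 + s\<^sup>2)) *\<^sub>R s)" .
  qed
  also have "\<dots> = complex_of_real (LINT s|V.mu w. (1 / (1 + s\<^sup>2)) *\<^sub>R s)"
    by (rule integral_complex_of_real)
  also have "(LINT s|V.mu w. (1 / (1 + s\<^sup>2)) *\<^sub>R s) = (LINT t|V.mu x. t)"
    unfolding w(2) mu_Rplus[OF w(1)] by (rule integral_density[symmetric]) auto
  finally show ?thesis .
qed

text \<open>A vector \<open>x\<close> with finite second moment should be \<open>(A + i)\<^sup>-\<^sup>1 w\<close> with \<open>w = (A + i) x\<close>, and
  \<open>s + i = 2 i / (1 - cay s)\<close>. The Cesaro means of the geometric series approximate \<open>1 / (1 - z)\<close> on
  the circle, with the uniform bound \<open>2 / \<bar>1 - z\<bar>\<close>.\<close>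

fun geo :: "nat \<Rightarrow> (complex \<times> int) list" where
  "geo 0 = []"
| "geo (Suc n) = (1, int n) # geo n"

fun cesaro :: "nat \<Rightarrow> (complex \<times> int) list" where
  "cesaro 0 = []"
| "cesaro (Suc n) = geo n @ cesaro n"

lemma laurent_geo: "(1 - z) * laurent (geo n) z = 1 - z ^ n"
proof (induction n)
  case (Suc n)
  have "(1 - z) * laurent (geo (Suc n)) z = (1 - z) * z ^ n + (1 - z ^ n)"
    by (simp add: distrib_left Suc)
  also have "\<dots> = 1 - z ^ Suc n"
    by (simp add: algebra_simps)
  finally show ?case .
qed simp

lemma laurent_cesaro: "(1 - z) * laurent (cesaro n) z = of_nat n - (\<Sum>k<n. z powi (int k))"
  by (induction n) (auto simp: laurent_append distrib_left laurent_geo)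

lemma laurent_op_geo:
  assumes x: "x \<in> H"
  shows "V.laurent_op (geo n) x - Vc 1 (V.laurent_op (geo n) x) = x - Vc (int n) x"
proof (induction n)
  case 0
  then show ?case
    using clinear_on_zero[OF V.V_linear subspace_H] by (simp add: V.V_0 x)
next
  case (Suc n)
  have "V.laurent_op (geo (Suc n)) x - Vc 1 (V.laurent_op (geo (Suc n)) x) =
      (Vc (int n) x - Vc (int (Suc n)) x) + (V.laurent_op (geo n) x - Vc 1 (V.laurent_op (geo n) x))"
    using x by (simp add: V.V_add V.V_V V.V_H V.laurent_op_H)
  thus ?case
    by (simp only: Suc) simp
qed

lemma laurent_op_cesaro:
  assumes x: "x \<in> H"
  shows "V.laurent_op (cesaro n) x - Vc 1 (V.laurent_op (cesaro n) x) = of_nat n *\<^sub>C x - (\<Sum>k<n. Vc (int k) x)"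
proof (induction n)
  case 0
  then show ?case
    using clinear_on_zero[OF V.V_linear subspace_H] by simp
next
  case (Suc n)
  have "V.laurent_op (cesaro (Suc n)) x - Vc 1 (V.laurent_op (cesaro (Suc n)) x) =
      (V.laurent_op (geo n) x - Vc 1 (V.laurent_op (geo n) x)) + (V.laurent_op (cesaro n) x - Vc 1 (V.laurent_op (cesaro n) x))"
    using x by (simp add: V.laurent_op_append V.V_add V.laurent_op_H)
  thus ?case
    by (simp only: laurent_op_geo[OF x] Suc) (simp add: scaleC_add_left algebra_simps)
qed

lemma second_moment_dom:
  assumes x: "x \<in> H" and fin: "(\<integral>\<^sup>+ t. ennreal (t\<^sup>2) \<partial>V.mu x) < \<infinity>"
  shows "x \<in> op_dom A"
proof -
  interpret finite_measure "V.mu x" by (rule V.finite_mu[OF x])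
  note [measurable_cong] = V.sets_mu[OF x]
  \<comment> \<open>At \<open>z = cay s\<close> and \<open>n > 0\<close> this is
    \<open>2 i / (1 - z) * (1 - M n z)\<close>, so it tends to \<open>s + i\<close>, dominated by
    \<open>2 |s + i|\<close>.\<close>
  define q where "q n = lmul [(2 * \<i> / of_nat n, 0)] (cesaro n)" for n
  define M where "M n z = (1 / of_nat n) * (\<Sum>k<n. z powi (int k))" for n and z :: complex
  have lpq: "laurent (q n) (cay s) = (if n = 0 then 0 else (complex_of_real s + \<i>) * (1 - M n (cay s)))" for n s
  proof (cases "n = 0")
    case False
    have "laurent (q n) (cay s) = 2 * \<i> / of_nat n * laurent (cesaro n) (cay s)"
      unfolding q_def laurent_mul[OF norm_cay] by simp
    also have "laurent (cesaro n) (cay s) = (of_nat n - (\<Sum>k<n. cay s powi (int k))) / (1 - cay s)"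
      using laurent_cesaro[of "cay s" n] by (simp add: field_simps)
    also have "\<dots> = of_nat n * (1 - M n (cay s)) / (1 - cay s)"
      using False by (simp add: M_def right_diff_distrib)
    also have "2 * \<i> / of_nat n * (of_nat n * (1 - M n (cay s)) / (1 - cay s)) =
        2 * \<i> / (1 - cay s) * (1 - M n (cay s))"
      using False by simp
    also have "2 * \<i> / (1 - cay s) = complex_of_real s + \<i>"
      by (simp add: one_minus_cay)
    finally show ?thesis
      using False by simp
  qed (simp add: q_def)
  have Mlim: "(\<lambda>n. M n (cay s)) \<longlonglongrightarrow> 0" for s
    using cesaro_limit[OF norm_cay[of s]] by (simp add: M_def)
  have Mbd: "cmod (M n (cay s)) \<le> 1" for n s
    using cesaro_bound[OF norm_cay] by (simp add: M_def)
  have "convergent (\<lambda>n. V.laurent_op (q n) x)"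
  proof (rule V.laurent_op_convergent[OF x, where f = "\<lambda>s. complex_of_real s + \<i>" and g = "\<lambda>s. 4 * (1 + s\<^sup>2)"])
    fix s
    have "(\<lambda>n. (complex_of_real s + \<i>) * (1 - M n (cay s))) \<longlonglongrightarrow> (complex_of_real s + \<i>) * (1 - 0)"
      by (intro tendsto_intros Mlim)
    moreover have "\<forall>\<^sub>F n in sequentially. (complex_of_real s + \<i>) * (1 - M n (cay s)) = laurent (q n) (cay s)"
      using eventually_gt_at_top[of 0] by eventually_elim (simp add: lpq)
    ultimately show "(\<lambda>n. laurent (q n) (cay s)) \<longlonglongrightarrow> complex_of_real s + \<i>"
      using Lim_transform_eventually by fastforce
  next
    have "integrable (V.mu x) (\<lambda>t. t\<^sup>2)"
      using fin by (intro integrableI_nonneg) auto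
    thus "integrable (V.mu x) (\<lambda>s. 4 * (1 + s\<^sup>2))"
      by simp
  next
    fix n s
    have "cmod (1 - M n (cay s)) \<le> 2"
      using norm_triangle_ineq4[of 1 "M n (cay s)"] Mbd[of n s] by simp
    hence "(cmod (1 - M n (cay s)))\<^sup>2 \<le> 2\<^sup>2"
      by (intro power_mono) auto
    hence "(cmod (complex_of_real s + \<i>))\<^sup>2 * (cmod (1 - M n (cay s)))\<^sup>2 \<le> (1 + s\<^sup>2) * 4"
      by (intro mult_mono) (auto simp: cmod_power2)
    thus "(cmod (laurent (q n) (cay s)))\<^sup>2 \<le> 4 * (1 + s\<^sup>2)"
      by (simp add: lpq norm_mult power_mult_distrib mult.commute)
  qed auto
  then obtain w where w: "(\<lambda>n. V.laurent_op (q n) x) \<longlonglongrightarrow> w"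
    using convergent_def by blast
  have wH: "w \<in> H"
    using closed_sequentially[OF closed_H _ w] V.laurent_op_H[OF x] by simp
  have "(\<lambda>n. Vc 1 (V.laurent_op (q n) x)) \<longlonglongrightarrow> Vc 1 w"
  proof (rule bounded_operators_tendsto[OF _ subspace_H w _ wH])
    show "Vc 1 \<in> bounded_operators H H"
      using V.V_H V.V_linear V.norm_V unfolding bounded_operators_def
      by (auto intro!: exI[of _ 1])
    show "V.laurent_op (q n) x \<in> H" for n
      by (rule V.laurent_op_H[OF x])
  qed
  \<comment> \<open>Here \<open>(1 - Vc 1) / (2 i)\<close> is \<open>(A + i)^-1\<close>, so the
    limit is \<open>Rplus w\<close>. For positive \<open>n\<close> the same vectors equal
    \<open>x\<close> minus an ergodic mean, so they also tend to \<open>x\<close>.\<close>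
  hence "(\<lambda>n. (1 / (2 * \<i>)) *\<^sub>C (V.laurent_op (q n) x - Vc 1 (V.laurent_op (q n) x))) \<longlonglongrightarrow> (1 / (2 * \<i>)) *\<^sub>C (w - Vc 1 w)"
    by (intro scaleC.tendsto tendsto_const tendsto_diff w)
  moreover have "(\<lambda>n. (1 / (2 * \<i>)) *\<^sub>C (V.laurent_op (q n) x - Vc 1 (V.laurent_op (q n) x))) \<longlonglongrightarrow> x - 0"
  proof (rule Lim_transform_eventually)
    show "(\<lambda>n. x - (1 / of_nat n) *\<^sub>C (\<Sum>k<n. Vc (int k) x)) \<longlonglongrightarrow> x - 0"
      by (intro tendsto_diff tendsto_const V.mean_ergodic x)
    show "\<forall>\<^sub>F n in sequentially. x - (1 / of_nat n) *\<^sub>C (\<Sum>k<n. Vc (int k) x) =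
      (1 / (2 * \<i>)) *\<^sub>C (V.laurent_op (q n) x - Vc 1 (V.laurent_op (q n) x))"
      using eventually_gt_at_top[of 0]
    proof eventually_elim
      case (elim n)
      have "V.laurent_op (q n) x = (2 * \<i> / of_nat n) *\<^sub>C V.laurent_op (cesaro n) x"
        unfolding q_def V.laurent_op_mul[OF x] by (simp add: V.V_0 V.laurent_op_H x)
      hence "V.laurent_op (q n) x - Vc 1 (V.laurent_op (q n) x) =
          (2 * \<i> / of_nat n) *\<^sub>C (V.laurent_op (cesaro n) x - Vc 1 (V.laurent_op (cesaro n) x))"
        by (simp add: V.V_scale V.laurent_op_H x scaleC.diff_right)
      also have "\<dots> = (2 * \<i>) *\<^sub>C (x - (1 / of_nat n) *\<^sub>C (\<Sum>k<n. Vc (int k) x))"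
        using elim by (simp add: laurent_op_cesaro[OF x] scaleC.diff_right scaleC_scaleC)
      finally show ?case
        by (simp add: scaleC_scaleC)
    qed
  qed
  ultimately have "x - 0 = (1 / (2 * \<i>)) *\<^sub>C (w - Vc 1 w)"
    using LIMSEQ_unique by blast
  also have "\<dots> = Rplus w"
    by (simp add: Vc_eq wH scaleC_scaleC)
  finally show ?thesis
    using Rplus_dom[OF wH] by simp
qed

theorem is_spectral_measure_PV: "is_spectral_measure H A V.PV"
  unfolding is_spectral_measure_def
proof (intro conjI V.projection_valued_measure_PV ballI)
  show "op_dom A = {x\<in>H. (\<integral>\<^sup>+ t. ennreal (t\<^sup>2) \<partial>scalar_measure V.PV x) < \<infinity>}"
    using dom_H dom_second_moment second_moment_dom V.scalar_measure_PV by auto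
  show "cinner x (op_app A x) = complex_of_real (LINT t|scalar_measure V.PV x. t)"
    if "x \<in> op_dom A" for x
    using dom_first_moment[OF that] V.scalar_measure_PV[OF dom_H[OF that]] by simp
qed

lemma is_spectral_measure_spectral_projection:
  "is_spectral_measure H A (spectral_projection H A)"
  unfolding spectral_projection_def by (rule someI[of "is_spectral_measure H A", OF is_spectral_measure_PV])

end

section \<open>Spectral subspaces\<close>

lemma finite_dim_Un:
  fixes V W :: "'a::chilbert_space set"
  assumes "\<not> infinite_dimensional V" "\<not> infinite_dimensional W"
    and "\<And>x. x \<in> X \<Longrightarrow> \<exists>v\<in>V. \<exists>w\<in>W. x = v + w"
  shows "\<not> infinite_dimensional X"
proof -
  obtain B C where B: "finite B" "V \<subseteq> cvec.span B" and C: "finite C" "W \<subseteq> cvec.span C"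
    using assms(1,2) by (auto simp: infinite_dimensional_def)
  have "X \<subseteq> cvec.span (B \<union> C)"
  proof
    fix x assume "x \<in> X"
    then obtain v w where vw: "v \<in> V" "w \<in> W" "x = v + w"
      using assms(3) by blast
    have "v \<in> cvec.span (B \<union> C)" "w \<in> cvec.span (B \<union> C)"
      using vw B C cvec.span_mono[of B "B \<union> C"] cvec.span_mono[of C "B \<union> C"] by blast+
    thus "x \<in> cvec.span (B \<union> C)"
      unfolding vw(3) by (rule cvec.span_add)
  qed
  thus ?thesis
    using B(1) C(1) unfolding infinite_dimensional_def by blast
qed

lemma infinite_dimensional_mono: "V \<subseteq> W \<Longrightarrow> infinite_dimensional V \<Longrightarrow> infinite_dimensional W"
  unfolding infinite_dimensional_def by blast

text \<open>\<open>P\<close> is an arbitrary spectral measure of \<open>A\<close>, since being one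
  is all that is known of the chosen projections.\<close>

locale spectral_measure = self_adjoint_operator +
  fixes P
  assumes spectral: "is_spectral_measure H A P"
begin

lemma P_proj: "\<Omega> \<in> sets borel \<Longrightarrow> orthogonal_projection H (P \<Omega>)"
  and P_UNIV: "x \<in> H \<Longrightarrow> P UNIV x = x"
  and P_sums: "range F \<subseteq> sets borel \<Longrightarrow> disjoint_family F \<Longrightarrow> x \<in> H \<Longrightarrow>
    (\<lambda>k::nat. P (F k) x) sums P (\<Union>k. F k) x"
  using spectral unfolding is_spectral_measure_def projection_valued_measure_def by blast+

lemmas P_linear = orthogonal_projectionD(1)[OF P_proj]
  and P_H = orthogonal_projectionD(2)[OF P_proj]
  and P_idem = orthogonal_projectionD(3)[OF P_proj]
  and P_sym = orthogonal_projectionD(4)[OF P_proj]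
  and P_norm = orthogonal_projection_norm[OF P_proj]
  and P_add = clinear_on_add[OF orthogonal_projectionD(1)[OF P_proj]]
  and P_scale = clinear_on_scale[OF orthogonal_projectionD(1)[OF P_proj]]

text \<open>The empty set is its own countable disjoint union, and a constant series converges only
  if its terms vanish.\<close>

lemma P_empty: "x \<in> H \<Longrightarrow> P {} x = 0"
  using P_sums[of "\<lambda>_. {}" x] summable_LIMSEQ_zero[of "\<lambda>_. P {} x"]
  by (auto simp: disjoint_family_on_def sums_iff LIMSEQ_const_iff)

lemma P_Un:
  assumes "\<Omega> \<in> sets borel" "\<Omega>' \<in> sets borel" "\<Omega> \<inter> \<Omega>' = {}" "x \<in> H"
  shows "P (\<Omega> \<union> \<Omega>') x = P \<Omega> x + P \<Omega>' x"
proof -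
  have "(\<lambda>k. P (binaryset \<Omega> \<Omega>' k) x) sums (\<Sum>k\<in>{0, 1}. P (binaryset \<Omega> \<Omega>' k) x)"
    by (rule sums_finite) (auto simp: binaryset_def P_empty assms)
  moreover have "(\<lambda>k. P (binaryset \<Omega> \<Omega>' k) x) sums P (\<Union>k. binaryset \<Omega> \<Omega>' k) x"
    using assms by (intro P_sums) (auto simp: binaryset_def disjoint_family_on_def)
  ultimately have "P (\<Union>k. binaryset \<Omega> \<Omega>' k) x = (\<Sum>k\<in>{0, 1}. P (binaryset \<Omega> \<Omega>' k) x)"
    using sums_unique2 by blast
  thus ?thesis
    by (simp add: UN_binaryset_eq) (simp add: binaryset_def)
qed

lemmas P_norm_le = orthogonal_projection_norm_le[OF P_proj]

text \<open>For \<open>y\<close> in the range of \<open>P \<Omega>'\<close>, additivity gives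
  \<open>|P (\<Omega> \<union> \<Omega>') y|^2 = |P \<Omega> y|^2 + |y|^2\<close>, yet a projection
  cannot increase the norm.\<close>

lemma P_disjoint:
  assumes \<Omega>: "\<Omega> \<in> sets borel" "\<Omega>' \<in> sets borel" "\<Omega> \<inter> \<Omega>' = {}" and x: "x \<in> H"
  shows "P \<Omega> (P \<Omega>' x) = 0"
proof -
  define y where "y = P \<Omega>' x"
  have y: "y \<in> H" "P \<Omega>' y = y"
    using P_H[OF \<Omega>(2) x] P_idem[OF \<Omega>(2) x] by (auto simp: y_def)
  have U: "\<Omega> \<union> \<Omega>' \<in> sets borel"
    using \<Omega> by simp
  have "complex_of_real ((norm (P (\<Omega> \<union> \<Omega>') y))\<^sup>2) = complex_of_real ((norm (P \<Omega> y))\<^sup>2 + (norm y)\<^sup>2)"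
    using P_norm[OF U y(1)] P_norm[OF \<Omega>(1) y(1)] y
    by (simp add: P_Un[OF \<Omega> y(1)] cinner.add_right cinner_self)
  hence "(norm (P (\<Omega> \<union> \<Omega>') y))\<^sup>2 = (norm (P \<Omega> y))\<^sup>2 + (norm y)\<^sup>2"
    using of_real_eq_iff by blast
  moreover have "(norm (P (\<Omega> \<union> \<Omega>') y))\<^sup>2 \<le> (norm y)\<^sup>2"
    by (intro power_mono P_norm_le U y) simp
  ultimately show ?thesis
    by (simp add: y_def)
qed

lemma P_P:
  assumes \<Omega>: "\<Omega> \<in> sets borel" "\<Omega>' \<in> sets borel" and x: "x \<in> H"
  shows "P \<Omega> (P \<Omega>' x) = P (\<Omega> \<inter> \<Omega>') x"
proof -
  define y where "y = P (\<Omega> \<inter> \<Omega>') x"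
  have s: "\<Omega> \<inter> \<Omega>' \<in> sets borel" "\<Omega>' - \<Omega> \<in> sets borel" "UNIV - \<Omega> \<in> sets borel"
    using \<Omega> by auto
  have y: "y \<in> H"
    using P_H[OF s(1) x] by (simp add: y_def)
  have d: "(\<Omega> \<inter> \<Omega>') \<inter> (\<Omega>' - \<Omega>) = {}" "\<Omega> \<inter> (UNIV - \<Omega>) = {}" "(UNIV - \<Omega>) \<inter> (\<Omega> \<inter> \<Omega>') = {}"
    "\<Omega> \<inter> (\<Omega>' - \<Omega>) = {}"
    by auto
  have "(\<Omega> \<inter> \<Omega>') \<union> (\<Omega>' - \<Omega>) = \<Omega>'"
    by auto
  hence "P \<Omega>' x = y + P (\<Omega>' - \<Omega>) x"
    using P_Un[OF s(1,2) d(1) x] by (simp add: y_def)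
  hence "P \<Omega> (P \<Omega>' x) = P \<Omega> y"
    using P_disjoint[OF \<Omega>(1) s(2) d(4) x] P_add[OF \<Omega>(1) y P_H[OF s(2) x]] by simp
  moreover have "\<Omega> \<union> (UNIV - \<Omega>) = UNIV"
    by auto
  hence "y = P \<Omega> y + P (UNIV - \<Omega>) y"
    using P_Un[OF \<Omega>(1) s(3) d(2) y] P_UNIV[OF y] by simp
  moreover have "P (UNIV - \<Omega>) y = 0"
    unfolding y_def by (rule P_disjoint[OF s(3,1) d(3) x])
  ultimately show ?thesis
    by (simp add: y_def)
qed

abbreviation nu :: "'a \<Rightarrow> real measure" where
  "nu x \<equiv> scalar_measure P x"

lemma sets_nu [measurable_cong]: "sets (nu x) = sets borel"
  unfolding scalar_measure_def by (simp add: sets.sigma_sets_eq[of "borel :: real measure", simplified])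

lemma space_nu: "space (nu x) = UNIV"
  by (simp add: scalar_measure_def)

lemma emeasure_nu:
  assumes x: "x \<in> H" and \<Omega>: "\<Omega> \<in> sets borel"
  shows "emeasure (nu x) \<Omega> = ennreal ((norm (P \<Omega> x))\<^sup>2)"
proof -
  have Re: "Re (cinner x (P \<Omega> x)) = (norm (P \<Omega> x))\<^sup>2" if "\<Omega> \<in> sets borel" for \<Omega>
    using P_norm[OF that x] by simp
  have "emeasure (nu x) \<Omega> = ennreal (Re (cinner x (P \<Omega> x)))"
    unfolding scalar_measure_def
  proof (rule emeasure_measure_of_sigma)
    show "sigma_algebra UNIV (sets (borel :: real measure))"
      using sets.sigma_algebra_axioms[of "borel :: real measure"] by simp
    show "positive (sets borel) (\<lambda>\<Omega>. ennreal (Re (cinner x (P \<Omega> x))))"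
      by (simp add: positive_def P_empty x)
    show "countably_additive (sets borel) (\<lambda>\<Omega>. ennreal (Re (cinner x (P \<Omega> x))))"
    proof (rule countably_additiveI)
      fix F :: "nat \<Rightarrow> real set" assume F: "range F \<subseteq> sets borel" "disjoint_family F"
      have Fk: "F k \<in> sets borel" for k
        using F by auto
      have "(\<lambda>k. Re (cinner x (P (F k) x))) sums Re (cinner x (P (\<Union>k. F k) x))"
        by (intro bounded_linear.sums[OF bounded_linear_Re]
            bounded_linear.sums[OF cinner.bounded_linear_right] P_sums F x)
      moreover have "0 \<le> Re (cinner x (P (F k) x))" for k
        using Re[OF Fk] by simp
      ultimately show "(\<Sum>k. ennreal (Re (cinner x (P (F k) x)))) = ennreal (Re (cinner x (P (\<Union>k. F k) x)))"
        by (rule suminf_ennreal_eq[rotated])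
    qed
  qed (rule \<Omega>)
  thus ?thesis
    using Re[OF \<Omega>] by simp
qed

lemma finite_nu:
  assumes x: "x \<in> H"
  shows "finite_measure (nu x)"
  by (rule finite_measureI) (simp add: space_nu emeasure_nu[OF x])

lemma measure_nu_UNIV: "x \<in> H \<Longrightarrow> measure (nu x) UNIV = (norm x)\<^sup>2"
  using emeasure_nu[of x UNIV] by (simp add: measure_def P_UNIV)

lemma nu_P:
  assumes x: "x \<in> H" and \<Omega>: "\<Omega> \<in> sets borel"
  shows "nu (P \<Omega> x) = density (nu x) (indicator \<Omega>)"
proof (rule measure_eqI)
  show "sets (nu (P \<Omega> x)) = sets (density (nu x) (indicator \<Omega>))"
    by (simp add: sets_nu)
  fix X assume "X \<in> sets (nu (P \<Omega> x))"
  hence X: "X \<in> sets borel"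
    by (simp add: sets_nu)
  have "emeasure (density (nu x) (indicator \<Omega>)) X = emeasure (nu x) (\<Omega> \<inter> X)"
    using X \<Omega> by (simp add: emeasure_density sets_nu nn_integral_indicator
        flip: indicator_inter_arith)
  also have "\<dots> = ennreal ((norm (P (\<Omega> \<inter> X) x))\<^sup>2)"
    using X \<Omega> by (intro emeasure_nu x) auto
  also have "P (\<Omega> \<inter> X) x = P X (P \<Omega> x)"
    by (simp only: P_P[OF X \<Omega> x] Int_commute)
  finally show "emeasure (nu (P \<Omega> x)) X = emeasure (density (nu x) (indicator \<Omega>)) X"
    using emeasure_nu[OF P_H[OF \<Omega> x] X] by simp
qed

lemma dom_iff: "x \<in> H \<Longrightarrow> x \<in> op_dom A \<longleftrightarrow> (\<integral>\<^sup>+ t. ennreal (t\<^sup>2) \<partial>nu x) < \<infinity>"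
  using spectral unfolding is_spectral_measure_def by auto

lemma cinner_app: "x \<in> op_dom A \<Longrightarrow> cinner x (op_app A x) = complex_of_real (LINT t|nu x. t)"
  using spectral unfolding is_spectral_measure_def by auto

lemma integrable_nu:
  assumes x: "x \<in> op_dom A"
  shows "integrable (nu x) (\<lambda>t. t)"
proof -
  interpret finite_measure "nu x" by (rule finite_nu[OF dom_H[OF x]])
  have "integrable (nu x) (\<lambda>t. t\<^sup>2)"
    using x dom_iff[OF dom_H[OF x]] by (intro integrableI_nonneg) auto
  hence i: "integrable (nu x) (\<lambda>t. 1 + t\<^sup>2)"
    by simp
  have b: "norm t \<le> norm (1 + t\<^sup>2)" for t :: real
    using sum_squares_bound[of 1 "\<bar>t\<bar>"] by (simp add: abs_of_nonneg)
  show ?thesis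
    by (rule Bochner_Integration.integrable_bound[OF i _ AE_I2[OF b]]) simp
qed

lemma P_dom:
  assumes x: "x \<in> op_dom A" and \<Omega>: "\<Omega> \<in> sets borel"
  shows "P \<Omega> x \<in> op_dom A"
proof -
  have xH: "x \<in> H"
    by (rule dom_H[OF x])
  have "(\<integral>\<^sup>+ t. ennreal (t\<^sup>2) \<partial>nu (P \<Omega> x)) = (\<integral>\<^sup>+ t. indicator \<Omega> t * ennreal (t\<^sup>2) \<partial>nu x)"
    unfolding nu_P[OF xH \<Omega>] using \<Omega> by (intro nn_integral_density) auto
  also have "\<dots> \<le> (\<integral>\<^sup>+ t. ennreal (t\<^sup>2) \<partial>nu x)"
    by (intro nn_integral_mono) (auto simp: indicator_def)
  also have "\<dots> < \<infinity>"
    using dom_iff[OF xH] x by simp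
  finally show ?thesis
    using dom_iff[OF P_H[OF \<Omega> xH]] by simp
qed

lemma LINT_nu_P:
  assumes x: "x \<in> op_dom A" and \<Omega>: "\<Omega> \<in> sets borel"
  shows "(LINT t|nu (P \<Omega> x). t) = (LINT t|nu x. indicator \<Omega> t * t)"
proof -
  have "nu (P \<Omega> x) = density (nu x) (\<lambda>t. ennreal (indicator \<Omega> t))"
    unfolding nu_P[OF dom_H[OF x] \<Omega>] by (simp add: ennreal_indicator)
  thus ?thesis
    using \<Omega> by (simp add: integral_density)
qed

lemma P_compl:
  assumes "\<Omega> \<in> sets borel" "x \<in> H"
  shows "P (UNIV - \<Omega>) x = x - P \<Omega> x"
proof -
  have "UNIV = \<Omega> \<union> (UNIV - \<Omega>)"
    by auto
  hence "x = P \<Omega> x + P (UNIV - \<Omega>) x"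
    using P_Un[of \<Omega> "UNIV - \<Omega>" x] P_UNIV[of x] assms by auto
  thus ?thesis
    by (simp add: algebra_simps)
qed

text \<open>Restricting the measure of \<open>y\<close> to \<open>\<Omega>\<close> and to its
  complement gives the measures of the two components, so first moments add up.\<close>

lemma quadratic_form_split:
  assumes y: "y \<in> op_dom A" and \<Omega>: "\<Omega> \<in> sets borel"
  shows "cinner y (op_app A y) = cinner (P \<Omega> y) (op_app A (P \<Omega> y)) +
           cinner (y - P \<Omega> y) (op_app A (y - P \<Omega> y))"
proof -
  have \<Omega>': "UNIV - \<Omega> \<in> sets borel"
    using \<Omega> by auto
  have int: "integrable (nu y) (\<lambda>t. indicator X t * t)" if "X \<in> sets borel" for X
    by (rule Bochner_Integration.integrable_bound[OF integrable_nu[OF y]])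
      (use that in \<open>auto simp: indicator_def\<close>)
  have "(LINT t|nu y. t) = (LINT t|nu y. indicator \<Omega> t * t + indicator (UNIV - \<Omega>) t * t)"
    by (intro Bochner_Integration.integral_cong refl) (auto simp: indicator_def)
  also have "\<dots> = (LINT t|nu (P \<Omega> y). t) + (LINT t|nu (P (UNIV - \<Omega>) y). t)"
    unfolding LINT_nu_P[OF y \<Omega>] LINT_nu_P[OF y \<Omega>']
    by (rule Bochner_Integration.integral_add[OF int[OF \<Omega>] int[OF \<Omega>']])
  finally show ?thesis
    using cinner_app[OF y] cinner_app[OF P_dom[OF y \<Omega>]] cinner_app[OF P_dom[OF y \<Omega>']]
    by (simp add: P_compl[OF \<Omega> dom_H[OF y]])
qed

text \<open>The splitting kills the sum of the cross terms for \<open>x + v\<close>; with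
  \<open>i v\<close> in place of \<open>v\<close> it kills their difference. This is how invariance
  of spectral subspaces follows from the form alone.\<close>

lemma app_orthogonal:
  assumes x: "x \<in> op_dom A" "P \<Omega> x = x" and v: "v \<in> op_dom A" "P \<Omega> v = 0" and \<Omega>: "\<Omega> \<in> sets borel"
  shows "cinner v (op_app A x) = 0"
proof -
  have *: "cinner x (op_app A v) + cinner v (op_app A x) = 0"
    if v: "v \<in> op_dom A" "P \<Omega> v = 0" for v
  proof -
    have "P \<Omega> (x + v) = x"
      using P_add[OF \<Omega> dom_H[OF x(1)] dom_H[OF v(1)]] x v by simp
    hence "cinner (x + v) (op_app A (x + v)) = cinner x (op_app A x) + cinner v (op_app A v)"
      using quadratic_form_split[OF dom_add[OF x(1) v(1)] \<Omega>] by simp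
    thus ?thesis
      by (simp add: app_add x v cinner.add_left cinner.add_right algebra_simps)
  qed
  have "P \<Omega> (\<i> *\<^sub>C v) = 0"
    using P_scale[OF \<Omega> dom_H[OF v(1)]] v by simp
  from *[OF dom_scale[OF v(1)] this] have "\<i> * (cinner x (op_app A v) - cinner v (op_app A x)) = 0"
    by (simp add: app_scale v cinner_scaleC_left cinner_scaleC_right right_diff_distrib)
  hence "cinner x (op_app A v) = cinner v (op_app A x)"
    by simp
  with *[OF v] show ?thesis
    by simp
qed

lemma AE_nu:
  assumes x: "x \<in> H" "P \<Omega> x = x" and \<Omega>: "\<Omega> \<in> sets borel"
  shows "AE t in nu x. t \<in> \<Omega>"
proof -
  have \<Omega>': "UNIV - \<Omega> \<in> sets borel"
    using \<Omega> by auto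
  have "UNIV - \<Omega> \<in> null_sets (nu x)"
    using emeasure_nu[OF x(1) \<Omega>'] P_compl[OF \<Omega> x(1)] x(2) \<Omega>' by (intro null_setsI) (auto simp: sets_nu)
  thus ?thesis
    by (rule AE_not_in[THEN AE_mp]) auto
qed

lemma quadratic_form_ge:
  assumes x: "x \<in> op_dom A" "P \<Omega> x = x" and \<Omega>: "\<Omega> \<in> sets borel" "\<And>t. t \<in> \<Omega> \<Longrightarrow> c \<le> t"
  shows "c * (norm x)\<^sup>2 \<le> Re (cinner x (op_app A x))"
proof -
  interpret finite_measure "nu x" by (rule finite_nu[OF dom_H[OF x(1)]])
  have "c * (norm x)\<^sup>2 = (LINT t|nu x. c)"
    using measure_nu_UNIV[OF dom_H[OF x(1)]] by (simp add: space_nu)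
  also have "\<dots> \<le> (LINT t|nu x. t)"
    using AE_nu[OF dom_H[OF x(1)] x(2) \<Omega>(1)] \<Omega>(2)
    by (intro integral_mono_AE integrable_nu x) auto
  finally show ?thesis
    by (simp add: cinner_app[OF x(1)])
qed

lemma quadratic_form_le:
  assumes x: "x \<in> op_dom A" "P \<Omega> x = x" and \<Omega>: "\<Omega> \<in> sets borel" "\<And>t. t \<in> \<Omega> \<Longrightarrow> t \<le> c"
  shows "Re (cinner x (op_app A x)) \<le> c * (norm x)\<^sup>2"
proof -
  interpret finite_measure "nu x" by (rule finite_nu[OF dom_H[OF x(1)]])
  have "(LINT t|nu x. t) \<le> (LINT t|nu x. c)"
    using AE_nu[OF dom_H[OF x(1)] x(2) \<Omega>(1)] \<Omega>(2)
    by (intro integral_mono_AE integrable_nu x) auto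
  also have "\<dots> = c * (norm x)\<^sup>2"
    using measure_nu_UNIV[OF dom_H[OF x(1)]] by (simp add: space_nu)
  finally show ?thesis
    by (simp add: cinner_app[OF x(1)])
qed

lemma bounded_range_dom:
  assumes x: "x \<in> H" "P \<Omega> x = x" and \<Omega>: "\<Omega> \<in> sets borel" "\<And>t. t \<in> \<Omega> \<Longrightarrow> \<bar>t\<bar> \<le> c"
  shows "x \<in> op_dom A"
proof -
  interpret finite_measure "nu x" by (rule finite_nu[OF x(1)])
  have "(\<integral>\<^sup>+ t. ennreal (t\<^sup>2) \<partial>nu x) \<le> (\<integral>\<^sup>+ t. ennreal (c\<^sup>2) \<partial>nu x)"
  proof (rule nn_integral_mono_AE)
    show "AE t in nu x. ennreal (t\<^sup>2) \<le> ennreal (c\<^sup>2)"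
      using AE_nu[OF x \<Omega>(1)]
    proof eventually_elim
      case (elim t)
      hence "\<bar>t\<bar>\<^sup>2 \<le> c\<^sup>2"
        using \<Omega>(2) by (intro power_mono) auto
      thus ?case
        by (simp add: ennreal_leI)
    qed
  qed
  also have "\<dots> < \<infinity>"
    by (simp add: emeasure_eq_measure ennreal_mult_less_top)
  finally show ?thesis
    using dom_iff[OF x(1)] by simp
qed

text \<open>The measure bounds only the form of \<open>T = A - l\<close> by \<open>d\<close>. As
  \<open>T\<close> is symmetric and preserves the subspace, polarization upgrades this to a bound on
  the norm.\<close>

lemma spectral_subspace_bound:
  assumes x: "x \<in> H" "P {l - d<..<l + d} x = x"
  shows "x \<in> op_dom A" "norm (op_app A x - complex_of_real l *\<^sub>C x) \<le> d * norm x"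
proof -
  let ?I = "{l - d<..<l + d}"
  have I: "?I \<in> sets borel" and I': "UNIV - ?I \<in> sets borel"
    by auto
  have dom: "y \<in> op_dom A" if "y \<in> H" "P ?I y = y" for y
    by (rule bounded_range_dom[OF that I, of "\<bar>l\<bar> + \<bar>d\<bar>"]) auto
  show xd: "x \<in> op_dom A"
    using dom x by blast
  define T where "T y = op_app A y - complex_of_real l *\<^sub>C y" for y
  have Tadd: "T (y + z) = T y + T z" "T (y - z) = T y - T z" "T (c *\<^sub>C y) = c *\<^sub>C T y"
    if "y \<in> op_dom A" "z \<in> op_dom A" for y z c
    using that by (simp_all add: T_def app_add app_diff app_scale scaleC.add_right scaleC.diff_right
        scaleC_scaleC mult.commute)
  have Tsym: "cinner y (T z) = cinner (T y) z" if "y \<in> op_dom A" "z \<in> op_dom A" for y z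
    using symmetric[OF that(2,1)] 
    by (simp add: T_def cinner.diff_left cinner.diff_right cinner_scaleC_left cinner_scaleC_right)
  define w where "w = T x"
  have wH: "w \<in> H"
    using app_H[OF xd] x H_scale H_diff by (simp add: w_def T_def)
  \<comment> \<open>Invariance: against \<open>w - P ?I w\<close> a domain vector \<open>u\<close>
    acts only through its component \<open>v\<close> in the complementary subspace, and
    \<open>v\<close> is orthogonal to \<open>w\<close>; the domain is dense.\<close>
  have Pw: "P ?I w = w"
  proof -
    have "w - P ?I w = 0"
    proof (rule cinner_eqI_dense[OF dom_dense _ _ subspace_H])
      fix u assume u: "u \<in> op_dom A"
      define v where "v = u - P ?I u"
      have v: "v \<in> op_dom A" "P ?I v = 0"
        using dom_diff[OF u P_dom[OF u I]] P_idem[OF I dom_H[OF u]]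
          clinear_on_diff[OF P_linear[OF I] subspace_H dom_H[OF u] P_H[OF I dom_H[OF u]]]
        by (auto simp: v_def)
      have "cinner v x = 0"
        using P_sym[OF I dom_H[OF v(1)] x(1)] v x by simp
      hence "cinner v w = 0"
        using app_orthogonal[OF xd x(2) v I] by (simp add: w_def T_def cinner.diff_right cinner_scaleC_right)
      moreover have "cinner u (w - P ?I w) = cinner v w"
        using P_sym[OF I dom_H[OF u] wH] by (simp add: v_def cinner.diff_left cinner.diff_right)
      ultimately show "cinner u (w - P ?I w) = cinner u 0"
        by simp
    qed (use wH P_H[OF I wH] H_diff H_zero in auto)
    thus ?thesis
      by simp
  qed
  have quad: "\<bar>Re (cinner y (T y))\<bar> \<le> d * (norm y)\<^sup>2" if y: "y \<in> H" "P ?I y = y" for y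
  proof -
    have "(l - d) * (norm y)\<^sup>2 \<le> Re (cinner y (op_app A y))"
      by (rule quadratic_form_ge[OF dom[OF y] y(2) I]) auto
    moreover have "Re (cinner y (op_app A y)) \<le> (l + d) * (norm y)\<^sup>2"
      by (rule quadratic_form_le[OF dom[OF y] y(2) I]) auto
    ultimately show ?thesis
      by (simp add: T_def cinner.diff_right cinner_scaleC_right Re_cinner_self algebra_simps abs_le_iff)
  qed
  show "norm (op_app A x - complex_of_real l *\<^sub>C x) \<le> d * norm x"
  proof (cases "w = 0 \<or> x = 0")
    case True
    have "0 \<le> d * norm x"
    proof (cases "x = 0")
      case False
      have "0 \<le> d * (norm x)\<^sup>2"
        using quad[OF x] by linarith
      with False show ?thesis
        by (simp add: zero_le_mult_iff)
    qed simp
    thus ?thesis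
      using True clinear_on_zero[OF app_linear subspace_dom] by (auto simp: w_def T_def)
  next
    case False
    \<comment> \<open>Rescaling \<open>w\<close> to the length of \<open>x\<close> makes the
      polarization bound exactly \<open>4 d |x|^2\<close>, while
      \<open>Re <u, T x> = |x| |w|\<close>.\<close>
    define r where "r = norm x / norm w"
    define u where "u = complex_of_real r *\<^sub>C w"
    have r: "r > 0"
      using False by (simp add: r_def)
    have u: "u \<in> H" "P ?I u = u" "norm u = norm x"
      using wH Pw P_scale[OF I wH] H_scale r False by (auto simp: u_def r_def norm_scaleC norm_divide)
    have ux: "u + x \<in> H" "P ?I (u + x) = u + x" "u - x \<in> H" "P ?I (u - x) = u - x"
      using u x H_add H_diff P_add[OF I u(1) x(1)]
        clinear_on_diff[OF P_linear[OF I] subspace_H u(1) x(1)] by auto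
    have ud: "u \<in> op_dom A"
      by (rule dom[OF u(1,2)])
    have sym: "Re (cinner x (T u)) = Re (cinner u (T x))"
      using Tsym[OF xd ud] Re_cinner_commute by metis
    have "4 * Re (cinner u (T x)) = Re (cinner (u + x) (T (u + x))) - Re (cinner (u - x) (T (u - x)))"
      using sym by (simp add: Tadd[OF ud xd] cinner.add_left cinner.add_right cinner.diff_left cinner.diff_right)
    also have "\<dots> \<le> d * (norm (u + x))\<^sup>2 + d * (norm (u - x))\<^sup>2"
      using quad[OF ux(1,2)] quad[OF ux(3,4)] by linarith
    also have "\<dots> = 4 * d * (norm x)\<^sup>2"
      by (simp add: norm_sq_add norm_sq_diff u(3) algebra_simps)
    finally have "Re (cinner u (T x)) \<le> d * (norm x)\<^sup>2"
      by simp
    hence "r * (norm w)\<^sup>2 \<le> d * (norm x)\<^sup>2"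
      by (simp add: u_def cinner_scaleC_left cinner_self flip: w_def)
    hence "norm x * norm w \<le> norm x * (d * norm x)"
      using False by (simp add: r_def power2_eq_square mult_ac)
    thus ?thesis
      using False by (simp add: w_def T_def)
  qed
qed

text \<open>\<open>x\<close> splits into a part \<open>y\<close> above and a part \<open>z\<close>
  below the gap. Tested against the reflected vector \<open>y - z\<close>, which is as long as
  \<open>x\<close>, both parts contribute to \<open>(A - l) x\<close> with a nonnegative
  sign.\<close>

lemma spectral_complement_bound:
  assumes x: "x \<in> op_dom A" "P {l - e<..<l + e} x = 0" and e: "e > 0"
  shows "e * norm x \<le> norm (op_app A x - complex_of_real l *\<^sub>C x)"
proof -
  define I1 I2 where "I1 = {l + e..}" and "I2 = {..l - e}"
  let ?I = "{l - e<..<l + e}"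
  have b: "I1 \<in> sets borel" "I2 \<in> sets borel" "?I \<in> sets borel" "UNIV - ?I \<in> sets borel"
    by (auto simp: I1_def I2_def)
  have xH: "x \<in> H"
    by (rule dom_H[OF x(1)])
  define y z where "y = P I1 x" and "z = P I2 x"
  have y: "y \<in> op_dom A" "P I1 y = y" and z: "z \<in> op_dom A" "P I2 z = z"
    using P_dom[OF x(1)] P_idem b xH by (auto simp: y_def z_def)
  have disj: "I1 \<inter> I2 = {}" "I2 \<inter> I1 = {}"
    using e by (auto simp: I1_def I2_def)
  have zy: "P I1 z = 0" "P I2 y = 0"
    using P_disjoint[OF b(1,2) disj(1) xH] P_disjoint[OF b(2,1) disj(2) xH] by (auto simp: y_def z_def)
  have "UNIV - ?I = I1 \<union> I2"
    by (auto simp: I1_def I2_def)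
  hence xyz: "x = y + z"
    using P_compl[OF b(3) xH] x(2) P_Un[OF b(1,2) disj(1) xH] by (simp add: y_def z_def)
  have cyz: "cinner y z = 0" "cinner z y = 0"
    using P_sym[OF b(1) dom_H[OF y(1)] dom_H[OF z(1)]] y zy cinner_eq_zero_commute by auto
  define T where "T u = op_app A u - complex_of_real l *\<^sub>C u" for u
  have Tx: "T x = T y + T z"
    unfolding T_def xyz app_add[OF y(1) z(1)] by (simp add: scaleC.add_right)
  have cross: "cinner z (T y) = 0" "cinner y (T z) = 0"
    using app_orthogonal[OF y z(1) zy(1) b(1)] app_orthogonal[OF z y(1) zy(2) b(2)] cyz
    by (simp_all add: T_def cinner.diff_right cinner_scaleC_right)
  have "(l + e) * (norm y)\<^sup>2 \<le> Re (cinner y (op_app A y))"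
    by (rule quadratic_form_ge[OF y b(1)]) (simp add: I1_def)
  hence 1: "e * (norm y)\<^sup>2 \<le> Re (cinner y (T y))"
    by (simp add: T_def cinner.diff_right cinner_scaleC_right Re_cinner_self algebra_simps)
  have "Re (cinner z (op_app A z)) \<le> (l - e) * (norm z)\<^sup>2"
    by (rule quadratic_form_le[OF z b(2)]) (simp add: I2_def)
  hence 2: "Re (cinner z (T z)) \<le> - e * (norm z)\<^sup>2"
    by (simp add: T_def cinner.diff_right cinner_scaleC_right Re_cinner_self algebra_simps)
  have nx: "(norm x)\<^sup>2 = (norm y)\<^sup>2 + (norm z)\<^sup>2" "(norm (y - z))\<^sup>2 = (norm y)\<^sup>2 + (norm z)\<^sup>2"
    using cyz by (simp_all add: xyz norm_sq_add norm_sq_diff)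
  hence nyz: "norm (y - z) = norm x"
    by (metis norm_ge_zero power2_eq_iff_nonneg)
  have "e * (norm x)\<^sup>2 = e * (norm y)\<^sup>2 + e * (norm z)\<^sup>2"
    by (simp add: nx algebra_simps)
  also have "\<dots> \<le> Re (cinner (y - z) (T x))"
    using 1 2 cross by (simp add: Tx cinner.diff_left cinner.add_right)
  also have "\<dots> \<le> cmod (cinner (y - z) (T x))"
    by (rule complex_Re_le_cmod)
  also have "\<dots> \<le> norm x * norm (T x)"
    using cinner_cauchy_schwarz[of "y - z" "T x"] by (simp add: nyz)
  finally have "norm x * (e * norm x) \<le> norm x * norm (T x)"
    by (simp add: power2_eq_square mult_ac)
  thus ?thesis
    by (cases "x = 0") (auto simp: T_def)
qed

lemma subspace_P_range: "\<Omega> \<in> sets borel \<Longrightarrow> cvec.subspace (P \<Omega> ` H)"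
  unfolding cvec.subspace_def
  using P_add P_scale H_add H_scale H_zero clinear_on_zero[OF P_linear subspace_H]
  by (auto simp: image_iff) metis+

text \<open>Heine-Borel: finitely many intervals of finite rank cover \<open>{a..b}\<close>.
  Contrapositively, infinite rank on the open interval yields a point of the essential spectrum in
  the closed one.\<close>

lemma finite_dim_interval:
  assumes fin: "\<And>l. l \<in> {a..b} \<Longrightarrow> \<exists>e>0. \<not> infinite_dimensional (P {l - e<..<l + e} ` H)"
  shows "\<not> infinite_dimensional (P {a<..<b} ` H)"
proof -
  have mono: "P \<Omega> ` H \<subseteq> P \<Omega>' ` H" if "\<Omega> \<subseteq> \<Omega>'" "\<Omega> \<in> sets borel" "\<Omega>' \<in> sets borel" for \<Omega> \<Omega>'
  proof
    fix y assume "y \<in> P \<Omega> ` H"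
    then obtain x where x: "x \<in> H" "y = P \<Omega> x"
      by blast
    have "P \<Omega>' (P \<Omega> x) = P \<Omega> x"
      using P_P[OF that(3,2) x(1)] that(1) by (simp add: Int_absorb1)
    thus "y \<in> P \<Omega>' ` H"
      using x P_H[OF that(2) x(1)] by (metis imageI)
  qed
  obtain e where e: "\<And>l. l \<in> {a..b} \<Longrightarrow> e l > 0"
    "\<And>l. l \<in> {a..b} \<Longrightarrow> \<not> infinite_dimensional (P {l - e l<..<l + e l} ` H)"
    using fin by metis
  have "{a..b} \<subseteq> (\<Union>l\<in>{a..b}. {l - e l<..<l + e l})"
    using e(1) by fastforce
  then obtain C where C: "C \<subseteq> {a..b}" "finite C" "{a..b} \<subseteq> (\<Union>l\<in>C. {l - e l<..<l + e l})"
    by (rule compactE_image[OF compact_Icc, rotated]) auto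
  have "\<not> infinite_dimensional (P (\<Union>l\<in>D. {l - e l<..<l + e l}) ` H)" if "finite D" "D \<subseteq> C" for D
    using that
  proof (induction D)
    case empty
    have "P {} ` H \<subseteq> cvec.span {}"
      using P_empty by auto
    hence "\<not> infinite_dimensional (P {} ` H)"
      unfolding infinite_dimensional_def by blast
    thus ?case
      by simp
  next
    case (insert l D)
    \<comment> \<open>\<open>P\<close> adds up only over disjoint sets, so \<open>X - Y\<close>
      replaces \<open>X\<close>; its range lies in that of \<open>P X\<close>.\<close>
    define X Y where "X = {l - e l<..<l + e l}" and "Y = (\<Union>l\<in>D. {l - e l<..<l + e l})"
    have "open X" "open Y"
      by (auto simp: X_def Y_def)
    hence b: "X \<in> sets borel" "Y \<in> sets borel" "X - Y \<in> sets borel" "Y \<inter> (X - Y) = {}"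
      by auto
    have "\<not> infinite_dimensional (P (Y \<union> (X - Y)) ` H)"
    proof (rule finite_dim_Un)
      show "\<not> infinite_dimensional (P Y ` H)"
        using insert by (simp add: Y_def)
      show "\<not> infinite_dimensional (P (X - Y) ` H)"
      proof
        assume "infinite_dimensional (P (X - Y) ` H)"
        hence "infinite_dimensional (P X ` H)"
          using infinite_dimensional_mono[OF mono[of "X - Y" X]] b by blast
        moreover have "l \<in> {a..b}"
          using insert.prems C(1) by blast
        ultimately show False
          using e(2) by (simp add: X_def)
      qed
      fix x assume "x \<in> P (Y \<union> (X - Y)) ` H"
      thus "\<exists>v\<in>P Y ` H. \<exists>w\<in>P (X - Y) ` H. x = v + w"
        using P_Un[OF b(2,3,4)] by blast
    qed
    moreover have "Y \<union> (X - Y) = (\<Union>l\<in>insert l D. {l - e l<..<l + e l})"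
      by (auto simp: X_def Y_def)
    ultimately show ?case
      by simp
  qed
  from this[OF C(2)] have "\<not> infinite_dimensional (P (\<Union>l\<in>C. {l - e l<..<l + e l}) ` H)"
    by simp
  moreover have "P {a<..<b} ` H \<subseteq> P (\<Union>l\<in>C. {l - e l<..<l + e l}) ` H"
    using C by (intro mono) auto
  ultimately show ?thesis
    using infinite_dimensional_mono by blast
qed

end

section \<open>Stability of the essential spectrum\<close>

text \<open>One vector with nonzero value complements the kernel, so a finite spanning set of the
  kernel would extend to one of \<open>V\<close>.\<close>

lemma infinite_dimensional_kernel:
  fixes V :: "'a::chilbert_space set" and \<phi> :: "'a \<Rightarrow> complex"
  assumes V: "cvec.subspace V" "infinite_dimensional V"
    and \<phi>: "\<And>x y. x \<in> V \<Longrightarrow> y \<in> V \<Longrightarrow> \<phi> (x + y) = \<phi> x + \<phi> y"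
      "\<And>c x. x \<in> V \<Longrightarrow> \<phi> (c *\<^sub>C x) = c * \<phi> x"
  shows "cvec.subspace {x \<in> V. \<phi> x = 0} \<and> infinite_dimensional {x \<in> V. \<phi> x = 0}"
proof
  note V0 = cvec.subspace_0[OF V(1)] and Vadd = cvec.subspace_add[OF V(1)]
    and Vscale = cvec.subspace_scale[OF V(1)] and Vdiff = cvec.subspace_diff[OF V(1)]
  have "\<phi> 0 = 0"
    using \<phi>(2)[OF V0, of 0] by simp
  thus "cvec.subspace {x \<in> V. \<phi> x = 0}"
    unfolding cvec.subspace_def using V0 Vadd Vscale \<phi> by auto
  show "infinite_dimensional {x \<in> V. \<phi> x = 0}"
  proof (rule ccontr)
    assume "\<not> ?thesis"
    then obtain B where B: "finite B" "{x \<in> V. \<phi> x = 0} \<subseteq> cvec.span B"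
      by (auto simp: infinite_dimensional_def)
    show False
    proof (cases "\<exists>w\<in>V. \<phi> w \<noteq> 0")
      case False
      hence "{x \<in> V. \<phi> x = 0} = V"
        by blast
      thus ?thesis
        using B V(2) unfolding infinite_dimensional_def by simp
    next
      case True
      then obtain w where w: "w \<in> V" "\<phi> w \<noteq> 0"
        by blast
      have "V \<subseteq> cvec.span (insert w B)"
      proof
        fix x assume x: "x \<in> V"
        define c where "c = \<phi> x / \<phi> w"
        have m: "(- c) *\<^sub>C w \<in> V"
          using w Vscale by blast
        have "\<phi> (x + (- c) *\<^sub>C w) = 0"
          using w by (simp only: \<phi>(1)[OF x m] \<phi>(2)[OF w(1)]) (simp add: c_def)
        hence "x + (- c) *\<^sub>C w \<in> cvec.span B"
          using B(2) Vadd[OF x m] by blast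
        hence "x + (- c) *\<^sub>C w \<in> cvec.span (insert w B)"
          using cvec.span_mono[of B "insert w B"] by blast
        moreover have "c *\<^sub>C w \<in> cvec.span (insert w B)"
          by (intro cvec.span_scale cvec.span_base) simp
        ultimately have "(x + (- c) *\<^sub>C w) + c *\<^sub>C w \<in> cvec.span (insert w B)"
          by (rule cvec.span_add)
        thus "x \<in> cvec.span (insert w B)"
          by (simp add: scaleC.minus_left)
      qed
      thus ?thesis
        using V(2) B(1) unfolding infinite_dimensional_def by blast
    qed
  qed
qed

lemma infinite_dimensional_orthogonal:
  fixes V :: "'a::chilbert_space set" and L :: "'a \<Rightarrow> 'b::chilbert_space"
  assumes V: "cvec.subspace V" "infinite_dimensional V" and L: "clinear_on V L" and B: "finite B"
  shows "\<exists>f\<in>V. f \<noteq> 0 \<and> (\<forall>b\<in>B. cinner b (L f) = 0)"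
proof -
  have "cvec.subspace {f \<in> V. \<forall>b\<in>B. cinner b (L f) = 0} \<and>
      infinite_dimensional {f \<in> V. \<forall>b\<in>B. cinner b (L f) = 0}"
    using B
  proof (induction B)
    case empty
    show ?case
      using V by simp
  next
    case (insert b B)
    let ?W = "{f \<in> V. \<forall>b\<in>B. cinner b (L f) = 0}"
    have "cvec.subspace {f \<in> ?W. cinner b (L f) = 0} \<and> infinite_dimensional {f \<in> ?W. cinner b (L f) = 0}"
      using insert.IH clinear_on_add[OF L] clinear_on_scale[OF L]
      by (intro infinite_dimensional_kernel) (auto simp: cinner.add_right cinner_scaleC_right)
    moreover have "{f \<in> ?W. cinner b (L f) = 0} = {f \<in> V. \<forall>b\<in>insert b B. cinner b (L f) = 0}"
      by auto
    ultimately show ?case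
      by simp
  qed
  hence "\<not> {f \<in> V. \<forall>b\<in>B. cinner b (L f) = 0} \<subseteq> cvec.span {}"
    unfolding infinite_dimensional_def by blast
  thus ?thesis
    by auto
qed

lemma cinner_span_eq_0:
  assumes "\<And>b. b \<in> B \<Longrightarrow> cinner b y = 0" "v \<in> cvec.span B"
  shows "cinner v (y :: 'a::chilbert_space) = 0"
  using assms(2)
proof (induction rule: cvec.span_induct_alt)
  case base
  show ?case by simp
next
  case (step c x z)
  thus ?case
    using assms(1) by (simp add: cinner.add_left cinner_scaleC_left)
qed

section \<open>Approximate eigenvectors in terms of the resolvent\<close>

locale spectral_resolvent = spectral_measure +
  fixes z
  assumes z: "z \<in> resolvent_set H A"
begin

abbreviation R :: "'a \<Rightarrow> 'a" where
  "R \<equiv> resolvent A z"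

lemma R_bounded: "R \<in> bounded_operators H H"
  and bij: "bij_betw (\<lambda>x. op_app A x - z *\<^sub>C x) (op_dom A) H"
  using z by (auto simp: resolvent_set_def)

lemmas R_H = bounded_operatorsD(1)[OF R_bounded]
  and R_linear = bounded_operatorsD(2)[OF R_bounded]

lemma R_dom: "g \<in> H \<Longrightarrow> R g \<in> op_dom A"
  unfolding resolvent_def using bij by (intro inv_into_into) (simp add: bij_betw_def)

lemma app_R: "g \<in> H \<Longrightarrow> op_app A (R g) = g + z *\<^sub>C R g"
  using f_inv_into_f[of g "\<lambda>x. op_app A x - z *\<^sub>C x" "op_dom A"] bij
  by (simp add: resolvent_def bij_betw_def algebra_simps)

lemma R_shift: "x \<in> op_dom A \<Longrightarrow> R (op_app A x - z *\<^sub>C x) = x"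
  unfolding resolvent_def using bij inv_into_f_f[of "\<lambda>x. op_app A x - z *\<^sub>C x" "op_dom A" x]
  by (simp add: bij_betw_def)

text \<open>From \<open>x - (l - z) R x = R (A - l) x\<close> and the bound \<open>d\<close> for
  \<open>A - l\<close> on the spectral subspace.\<close>

lemma spectral_subspace_resolvent:
  assumes x: "x \<in> H" "P {l - d<..<l + d} x = x" and N: "\<And>y. y \<in> H \<Longrightarrow> norm (R y) \<le> N * norm y"
    and "N \<ge> 0"
  shows "norm (x - (complex_of_real l - z) *\<^sub>C R x) \<le> N * d * norm x"
proof -
  note b = spectral_subspace_bound[OF x]
  have "x - (complex_of_real l - z) *\<^sub>C R x = R ((op_app A x - z *\<^sub>C x) - (complex_of_real l - z) *\<^sub>C x)"
    using clinear_on_diff[OF R_linear subspace_H] clinear_on_scale[OF R_linear] R_shift[OF b(1)]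
      app_H[OF b(1)] x(1) H_diff H_scale by simp
  also have "(op_app A x - z *\<^sub>C x) - (complex_of_real l - z) *\<^sub>C x = op_app A x - complex_of_real l *\<^sub>C x"
    by (simp add: scaleC.diff_left)
  also have "norm (R \<dots>) \<le> N * norm (op_app A x - complex_of_real l *\<^sub>C x)"
    using app_H[OF b(1)] x(1) H_diff H_scale by (intro N) blast
  also have "\<dots> \<le> N * (d * norm x)"
    using b(2) \<open>N \<ge> 0\<close> by (intro mult_left_mono)
  finally show ?thesis
    by (simp add: mult.assoc)
qed

text \<open>With \<open>S = g - (l - z) R g\<close> one has \<open>(A - l) R g = S\<close>, so the
  gap bounds \<open>|R g|\<close> by \<open>|S| / e\<close>; then
  \<open>g = S + (l - z) R g\<close>. The projection is applied to \<open>R g\<close>, which lies in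
  the domain of \<open>A\<close>.\<close>

lemma spectral_complement_resolvent:
  assumes g: "g \<in> H" "P {l - e<..<l + e} (R g) = 0" and e: "e > 0"
  shows "norm g \<le> (1 + cmod (complex_of_real l - z) / e) * norm (g - (complex_of_real l - z) *\<^sub>C R g)"
proof -
  define S where "S = g - (complex_of_real l - z) *\<^sub>C R g"
  have "op_app A (R g) - complex_of_real l *\<^sub>C R g = S"
    by (simp add: app_R g S_def scaleC.diff_left)
  hence "e * norm (R g) \<le> norm S"
    using spectral_complement_bound[OF R_dom[OF g(1)] g(2) e] by simp
  hence *: "norm (R g) \<le> norm S / e"
    using e by (simp add: field_simps)
  have "g = S + (complex_of_real l - z) *\<^sub>C R g"
    by (simp add: S_def)
  hence "norm g \<le> norm S + cmod (complex_of_real l - z) * norm (R g)"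
    by (metis norm_scaleC norm_triangle_ineq)
  also have "\<dots> \<le> norm S + cmod (complex_of_real l - z) * (norm S / e)"
    using * by (intro add_left_mono mult_left_mono) auto
  finally show ?thesis
    by (simp add: S_def algebra_simps)
qed

end

text \<open>On an infinite-dimensional space of approximate eigenvectors \<open>f\<close> of \<open>A\<close>, finitely many linear
  conditions force \<open>R\<^sub>B (T f)\<close> to be orthogonal to the spectral subspace of \<open>B\<close> near \<open>l\<close>; then \<open>T f\<close>
  cannot be an approximate eigenvector of \<open>B\<close>.\<close>

lemma intertwining_gap:
  fixes H :: "'a::chilbert_space set" and K :: "'b::chilbert_space set"
  assumes A: "spectral_resolvent H A P z" and B: "spectral_resolvent K B Q z"
    and T: "clinear_on H T" "\<And>f. f \<in> H \<Longrightarrow> T f \<in> K"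
    and lower: "\<And>f. f \<in> H \<Longrightarrow> norm f \<le> c * norm (T f)" and c: "c \<ge> 0"
    and upper: "\<And>f. f \<in> H \<Longrightarrow> norm (T f) \<le> C * norm f" and C: "C \<ge> 0"
    and N: "\<And>f. f \<in> H \<Longrightarrow> norm (resolvent A z f) \<le> N * norm f" and N0: "N \<ge> 0"
    and rho: "\<And>f. f \<in> H \<Longrightarrow> norm (resolvent B z (T f) - T (resolvent A z f)) \<le> \<rho> * norm f"
    and inf: "\<And>d. d > 0 \<Longrightarrow> infinite_dimensional (P {s - d<..<s + d} ` H)"
    and fin: "\<not> infinite_dimensional (Q {l - e<..<l + e} ` K)" and e: "e > 0"
  shows "1 \<le> c * (1 + cmod (complex_of_real l - z) / e) *
           (C * (N * \<bar>l - s\<bar>) + cmod (complex_of_real l - z) * \<rho>)"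
proof -
  interpret A: spectral_resolvent H A P z by fact
  interpret B: spectral_resolvent K B Q z by fact
  define \<kappa> where "\<kappa> = 1 + cmod (complex_of_real l - z) / e"
  have \<kappa>: "\<kappa> \<ge> 0"
    using e by (simp add: \<kappa>_def)
  let ?w = "complex_of_real l - z"
  \<comment> \<open>The window width \<open>d\<close> around \<open>s\<close> is auxiliary and is
    sent to 0 at the end.\<close>
  have main: "1 \<le> c * \<kappa> * (C * (N * (d + \<bar>l - s\<bar>)) + cmod ?w * \<rho>)" if d: "d > 0" for d
  proof -
    obtain D where D: "finite D" "Q {l - e<..<l + e} ` K \<subseteq> cvec.span D"
      using fin by (auto simp: infinite_dimensional_def)
    define V where "V = P {s - d<..<s + d} ` H"
    have V: "cvec.subspace V" "infinite_dimensional V"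
      using A.subspace_P_range inf[OF d] by (auto simp: V_def)
    have VH: "f \<in> H" "P {s - d<..<s + d} f = f" if "f \<in> V" for f
      using that A.P_H A.P_idem by (auto simp: V_def)
    have "clinear_on V (\<lambda>f. B.R (T f))"
      unfolding clinear_on_def
      using VH(1) clinear_on_add[OF T(1)] clinear_on_scale[OF T(1)] T(2)
        clinear_on_add[OF B.R_linear] clinear_on_scale[OF B.R_linear] by auto
    from infinite_dimensional_orthogonal[OF V this D(1)]
    obtain f where f: "f \<in> V" "f \<noteq> 0" "\<forall>b\<in>D. cinner b (B.R (T f)) = 0"
      by blast
    note fH = VH[OF f(1)]
    define y where "y = B.R (T f)"
    have y: "y \<in> K"
      by (simp add: y_def B.R_H T fH)
    have Qy: "Q {l - e<..<l + e} y \<in> cvec.span D"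
      using D(2) y by blast
    have "cinner b y = 0" if "b \<in> D" for b
      using f(3) that by (simp add: y_def)
    \<comment> \<open>The projected vector lies in the span of \<open>D\<close>, to which
      \<open>y\<close> is orthogonal; hence its squared norm \<open><Q y, y>\<close>
      vanishes.\<close>
    from cinner_span_eq_0[OF this Qy] have "cinner (Q {l - e<..<l + e} y) y = 0"
      by blast
    hence "cinner y (Q {l - e<..<l + e} y) = 0"
      by (subst cinner_eq_zero_commute)
    hence "Q {l - e<..<l + e} y = 0"
      using B.P_norm[of "{l - e<..<l + e}" y] y by simp
    hence low: "norm (T f) \<le> \<kappa> * norm (T f - ?w *\<^sub>C y)"
      unfolding y_def \<kappa>_def using T(2) fH e by (intro B.spectral_complement_resolvent) auto
    define g where "g = f - ?w *\<^sub>C A.R f"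
    have gH: "g \<in> H"
      using fH A.R_H A.H_diff A.H_scale by (simp add: g_def)
    \<comment> \<open>The approximate eigenvalue is moved from \<open>s\<close> to \<open>l\<close>
      at the cost \<open>|l - s|\<close>; in the backward inclusion the points \<open>s n\<close>
      only converge to \<open>l\<close>.\<close>
    have g: "norm g \<le> N * (d + \<bar>l - s\<bar>) * norm f"
    proof -
      have "g = (f - (complex_of_real s - z) *\<^sub>C A.R f) - (complex_of_real l - complex_of_real s) *\<^sub>C A.R f"
        by (simp add: g_def scaleC.diff_left)
      also have "norm \<dots> \<le> norm (f - (complex_of_real s - z) *\<^sub>C A.R f) +
          norm ((complex_of_real l - complex_of_real s) *\<^sub>C A.R f)"
        by (rule norm_triangle_ineq4)
      also have "\<dots> \<le> N * d * norm f + \<bar>l - s\<bar> * (N * norm f)"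
        unfolding norm_scaleC
        using A.spectral_subspace_resolvent[OF fH N N0] N[OF fH(1)]
        by (intro add_mono mult_mono) (auto simp flip: of_real_diff)
      finally show ?thesis
        by (simp add: algebra_simps)
    qed
    have "T g = T f - ?w *\<^sub>C T (A.R f)"
      unfolding g_def
      using clinear_on_diff[OF T(1) A.subspace_H fH(1) A.H_scale[OF A.R_H[OF fH(1)]]]
        clinear_on_scale[OF T(1) A.R_H[OF fH(1)]] by simp
    hence "T f - ?w *\<^sub>C y = T g - ?w *\<^sub>C (y - T (A.R f))"
      by (simp add: scaleC.diff_right)
    hence "norm (T f - ?w *\<^sub>C y) \<le> norm (T g) + cmod ?w * norm (y - T (A.R f))"
      by (metis norm_scaleC norm_triangle_ineq4)
    also have "\<dots> \<le> C * (N * (d + \<bar>l - s\<bar>) * norm f) + cmod ?w * (\<rho> * norm f)"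
      using order_trans[OF upper[OF gH] mult_left_mono[OF g C]] rho[OF fH(1)]
      by (intro add_mono mult_left_mono) (auto simp: y_def)
    finally have up: "norm (T f - ?w *\<^sub>C y) \<le> (C * (N * (d + \<bar>l - s\<bar>)) + cmod ?w * \<rho>) * norm f"
      by (simp add: algebra_simps)
    have "norm f \<le> c * (\<kappa> * norm (T f - ?w *\<^sub>C y))"
      using order_trans[OF lower[OF fH(1)] mult_left_mono[OF low c]] .
    also have "\<dots> \<le> c * (\<kappa> * ((C * (N * (d + \<bar>l - s\<bar>)) + cmod ?w * \<rho>) * norm f))"
      by (intro mult_left_mono up c \<kappa>)
    finally have "1 * norm f \<le> (c * \<kappa> * (C * (N * (d + \<bar>l - s\<bar>)) + cmod ?w * \<rho>)) * norm f"
      by (simp add: mult.assoc)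
    thus ?thesis
      using f(2) by (simp only: mult_le_cancel_right) auto
  qed
  have "((\<lambda>d. c * \<kappa> * (C * (N * (d + \<bar>l - s\<bar>)) + cmod ?w * \<rho>)) \<longlongrightarrow>
      c * \<kappa> * (C * (N * (0 + \<bar>l - s\<bar>)) + cmod ?w * \<rho>)) (at_right 0)"
    by (intro tendsto_intros)
  moreover have "\<forall>\<^sub>F d in at_right 0. 1 \<le> c * \<kappa> * (C * (N * (d + \<bar>l - s\<bar>)) + cmod ?w * \<rho>)"
    using eventually_at_right_less[of 0] by eventually_elim (rule main)
  ultimately have "1 \<le> c * \<kappa> * (C * (N * (0 + \<bar>l - s\<bar>)) + cmod ?w * \<rho>)"
    by (intro tendsto_lowerbound) auto
  thus ?thesis
    by (simp add: \<kappa>_def)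
qed

text \<open>One sequence must serve every \<open>e\<close>, so \<open>s n\<close> comes within
  \<open>1 / (n + 1)\<close> of the infimal distance, which need not be attained. Empty
  \<open>S n\<close> leave \<open>s n\<close> arbitrary, but only finitely often.\<close>

lemma lim_setsI:
  assumes "\<And>e. e > 0 \<Longrightarrow> \<forall>\<^sub>F n in sequentially. \<exists>t\<in>S n. \<bar>l - t\<bar> < e"
  shows "l \<in> lim_sets S"
proof -
  define s where "s n = (SOME t. t \<in> S n \<and> \<bar>l - t\<bar> < infdist l (S n) + inverse (real (Suc n)))" for n
  have s: "s n \<in> S n \<and> \<bar>l - s n\<bar> < infdist l (S n) + inverse (real (Suc n))" if ne: "S n \<noteq> {}" for n
    unfolding s_def
  proof (rule someI_ex, rule ccontr)
    assume no: "\<not> (\<exists>t. t \<in> S n \<and> \<bar>l - t\<bar> < infdist l (S n) + inverse (real (Suc n)))"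
    have "infdist l (S n) + inverse (real (Suc n)) \<le> infdist l (S n)"
      unfolding infdist_notempty[OF ne]
      by (rule cINF_greatest[OF ne]) (use no in \<open>auto simp: dist_real_def not_less infdist_notempty[OF ne]\<close>)
    moreover have "inverse (real (Suc n)) > 0"
      by simp
    ultimately show False
      by linarith
  qed
  have close: "\<bar>l - s n\<bar> < e + inverse (real (Suc n))" if t: "t \<in> S n" "\<bar>l - t\<bar> < e" for n t e
  proof -
    have "infdist l (S n) \<le> \<bar>l - t\<bar>"
      using infdist_le[OF t(1), of l] by (simp add: dist_real_def)
    thus ?thesis
      using s[of n] t by fastforce
  qed
  have "s \<longlonglongrightarrow> l"
  proof (rule tendstoI)
    fix e :: real assume e: "e > 0"
    have "\<forall>\<^sub>F n in sequentially. inverse (real (Suc n)) < e / 2"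
      using e by (intro order_tendstoD(2)[OF LIMSEQ_inverse_real_of_nat]) simp
    moreover have "\<forall>\<^sub>F n in sequentially. \<exists>t\<in>S n. \<bar>l - t\<bar> < e / 2"
      using e by (intro assms) simp
    ultimately show "\<forall>\<^sub>F n in sequentially. dist (s n) l < e"
    proof eventually_elim
      case (elim n)
      then obtain t where "t \<in> S n" "\<bar>l - t\<bar> < e / 2"
        by blast
      from close[OF this] elim(1) show ?case
        by (simp add: dist_real_def abs_minus_commute)
    qed
  qed
  moreover have "\<forall>\<^sub>F n in sequentially. s n \<in> S n"
    using assms[OF zero_less_one] by eventually_elim (use s in auto)
  ultimately show ?thesis
    unfolding lim_sets_def by blast
qed

text \<open>Used with \<open>m\<close> the norm of the image of \<open>x\<close> under an almost
  unitary map: Cauchy-Schwarz gives \<open>|x|^2 - m^2 \<le> |x|^2 / 2\<close>. The factor 2 is a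
  rounded square root of 2.\<close>

lemma norm_le_twice:
  fixes x u :: "'a::chilbert_space"
  assumes "norm (u - x) \<le> e * norm x" "e \<le> 1/2" "Re (cinner x u) = m\<^sup>2" "m \<ge> 0"
  shows "norm x \<le> 2 * m"
proof -
  have "norm (u - x) \<le> 1/2 * norm x"
    using assms(1) mult_right_mono[OF assms(2) norm_ge_zero[of x]] by linarith
  hence "norm x * norm (u - x) \<le> norm x * (1/2 * norm x)"
    by (rule mult_left_mono) simp
  hence "cmod (cinner x (u - x)) \<le> norm x * (1/2 * norm x)"
    by (rule order_trans[OF cinner_cauchy_schwarz])
  moreover have "- Re (cinner x (u - x)) \<le> cmod (cinner x (u - x))"
    using abs_Re_le_cmod[of "cinner x (u - x)"] by linarith
  moreover have "Re (cinner x (u - x)) = m\<^sup>2 - (norm x)\<^sup>2"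
    by (simp add: cinner.diff_right assms(3) Re_cinner_self)
  ultimately have "(norm x)\<^sup>2 \<le> 2 * m\<^sup>2"
    by (simp add: power2_eq_square)
  also have "\<dots> \<le> (2 * m)\<^sup>2"
    by (simp add: power_mult_distrib)
  finally show ?thesis
    by (rule power2_le_imp_le) (simp add: assms(4))
qed

text \<open>The data of a single index \<open>n\<close>, with the operator norms replaced by numbers
  that bound them, so that limits are taken only in the final theorem.\<close>

locale almost_unitary =
  fixes H :: "'a::chilbert_space set" and K :: "'b::chilbert_space set"
    and J :: "'a \<Rightarrow> 'b" and A P B Q z and C \<eta> \<eta>' \<rho> :: real
  assumes A: "spectral_resolvent H A P z" and B: "spectral_resolvent K B Q z"
    and J: "J \<in> bounded_operators H K" and C: "C \<ge> 0"
    and norm_J: "\<And>f. f \<in> H \<Longrightarrow> norm (J f) \<le> C * norm f"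
    and eta: "\<And>f. f \<in> H \<Longrightarrow> norm (adjoint_on H J (J f) - f) \<le> \<eta> * norm f" "\<eta> \<le> 1/2"
    and eta': "\<And>y. y \<in> K \<Longrightarrow> norm (J (adjoint_on H J y) - y) \<le> \<eta>' * norm y" "\<eta>' \<le> 1/2"
    and rho: "\<And>f. f \<in> H \<Longrightarrow>
      norm (adjoint_on H J (resolvent B z (J f)) - resolvent A z f) \<le> \<rho> * norm f" "\<rho> \<ge> 0"
begin

abbreviation "adj \<equiv> adjoint_on H J"

sublocale A: spectral_resolvent H A P z
  by (rule A)

sublocale B: spectral_resolvent K B Q z
  by (rule B)

lemmas J_K = bounded_operatorsD(1)[OF J]
  and J_linear = bounded_operatorsD(2)[OF J]
  and adj_H = adjoint_on_works(1)[OF A.hilbert J]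
  and cinner_adj = adjoint_on_works(2)[OF A.hilbert J]
  and adj_linear = adjoint_on_linear[OF A.hilbert J, of UNIV]
  and norm_adj = adjoint_on_bound[OF A.hilbert J C norm_J]

lemma adj_diff: "adj (x - y) = adj x - adj y"
  using clinear_on_diff[OF adj_linear] cvec.subspace_UNIV by blast

lemma J_lower:
  assumes f: "f \<in> H"
  shows "norm f \<le> 2 * norm (J f)"
proof (rule norm_le_twice[OF eta(1)[OF f] eta(2)])
  show "Re (cinner f (adj (J f))) = (norm (J f))\<^sup>2"
    by (simp add: Re_cinner_self flip: cinner_adj[OF f])
qed simp

lemma adj_lower:
  assumes y: "y \<in> K"
  shows "norm y \<le> 2 * norm (adj y)"
proof (rule norm_le_twice[OF eta'(1)[OF y] eta'(2)])
  have "Re (cinner y (J (adj y))) = Re (cinner (J (adj y)) y)"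
    by (rule Re_cinner_commute)
  thus "Re (cinner y (J (adj y))) = (norm (adj y))\<^sup>2"
    by (simp add: cinner_adj[OF adj_H] Re_cinner_self)
qed simp

text \<open>The intertwining map is \<open>J\<close>, with \<open>s = l\<close>. Since
  \<open>adj\<close> is bounded below, \<open>R_B J - J R_A\<close> may be estimated after applying
  \<open>adj\<close>: it becomes the resolvent difference minus \<open>adj J - 1\<close> on the
  range of \<open>R_A\<close>, so a bound for \<open>R_A\<close> suffices.\<close>

lemma gap_forward:
  assumes N: "\<And>f. f \<in> H \<Longrightarrow> norm (A.R f) \<le> N * norm f" "N \<ge> 0"
    and inf: "\<And>d. d > 0 \<Longrightarrow> infinite_dimensional (P {l - d<..<l + d} ` H)"
    and fin: "\<not> infinite_dimensional (Q {l - e<..<l + e} ` K)" and e: "e > 0"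
  shows "1 \<le> 2 * (1 + cmod (complex_of_real l - z) / e) *
           (cmod (complex_of_real l - z) * (2 * (\<rho> + \<eta> * N)))"
proof -
  have "norm (B.R (J f) - J (A.R f)) \<le> (2 * (\<rho> + \<eta> * N)) * norm f" if f: "f \<in> H" for f
  proof (cases "f = 0")
    case True
    thus ?thesis
      using clinear_on_zero[OF J_linear A.subspace_H] clinear_on_zero[OF A.R_linear A.subspace_H]
        clinear_on_zero[OF B.R_linear B.subspace_H] by simp
  next
    case False
    have "0 \<le> \<eta> * norm f"
      by (rule order_trans[OF norm_ge_zero eta(1)[OF f]])
    hence eta0: "\<eta> \<ge> 0"
      using False by (simp add: zero_le_mult_iff)
    have "norm (B.R (J f) - J (A.R f)) \<le> 2 * norm (adj (B.R (J f) - J (A.R f)))"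
      using f by (intro adj_lower B.H_diff B.R_H J_K A.R_H)
    also have "adj (B.R (J f) - J (A.R f)) = (adj (B.R (J f)) - A.R f) - (adj (J (A.R f)) - A.R f)"
      by (simp add: adj_diff)
    also have "2 * norm \<dots> \<le> 2 * (\<rho> * norm f + \<eta> * (N * norm f))"
      using order_trans[OF norm_triangle_ineq4 add_mono[OF rho(1)[OF f]
          order_trans[OF eta(1)[OF A.R_H[OF f]] mult_left_mono[OF N(1)[OF f] eta0]]]]
      by (rule mult_left_mono) simp
    finally show ?thesis
      by (simp add: algebra_simps)
  qed
  from intertwining_gap[OF A B J_linear J_K J_lower zero_le_numeral norm_J C N this inf fin e] show ?thesis
    by simp
qed

text \<open>The norm \<open>M\<close> is finite but not yet controlled. Replacing \<open>y\<close>
  by \<open>J (adj y)\<close>, up to a vector of norm at most \<open>\<eta>' |y|\<close>, reduces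
  \<open>R_B\<close> to \<open>R_A\<close> with an error of at most \<open>M / 2\<close>, which is
  absorbed. The final bound depends on \<open>B\<close> only through \<open>\<rho>\<close>.\<close>

lemma norm_resolvent_B:
  assumes N: "\<And>f. f \<in> H \<Longrightarrow> norm (A.R f) \<le> N * norm f" "N \<ge> 0"
    and small: "2 * C * \<eta>' \<le> 1/2" and y: "y \<in> K"
  shows "norm (B.R y) \<le> 4 * ((N + \<rho>) * C) * norm y"
proof -
  define M where "M = onorm_on K B.R"
  have M: "norm (B.R y) \<le> M * norm y" if "y \<in> K" for y
    using bounded_operatorsD(3)[OF B.R_bounded] onorm_on_bound that unfolding M_def by blast
  have M0: "M \<ge> 0"
    using bounded_operatorsD(3)[OF B.R_bounded] onorm_on_nonneg[OF B.H_zero] unfolding M_def by blast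
  have "norm (B.R y) \<le> (2 * ((N + \<rho>) * C) + M / 2) * norm y" if y: "y \<in> K" for y
  proof -
    define u where "u = J (adj y) - y"
    have u: "u \<in> K"
      using y J_K adj_H B.H_diff by (simp add: u_def)
    have "B.R u = B.R (J (adj y)) - B.R y"
      unfolding u_def by (rule clinear_on_diff[OF B.R_linear B.subspace_H J_K[OF adj_H] y])
    hence "adj (B.R y) = (adj (B.R (J (adj y))) - A.R (adj y)) + A.R (adj y) - adj (B.R u)"
      by (simp add: adj_diff)
    hence "norm (adj (B.R y)) \<le>
        norm (adj (B.R (J (adj y))) - A.R (adj y)) + norm (A.R (adj y)) + norm (adj (B.R u))"
      using norm_triangle_ineq4[of "(adj (B.R (J (adj y))) - A.R (adj y)) + A.R (adj y)" "adj (B.R u)"]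
        norm_triangle_ineq[of "adj (B.R (J (adj y))) - A.R (adj y)" "A.R (adj y)"] by simp
    also have "\<dots> \<le> \<rho> * norm (adj y) + N * norm (adj y) + C * (M * norm u)"
      using order_trans[OF norm_adj mult_left_mono[OF M[OF u] C]]
      by (intro add_mono rho N adj_H)
    also have "\<rho> * norm (adj y) + N * norm (adj y) = (N + \<rho>) * norm (adj y)"
      by (simp add: algebra_simps)
    also have "\<dots> \<le> (N + \<rho>) * (C * norm y)"
      using N(2) rho(2) by (intro mult_left_mono norm_adj add_nonneg_nonneg)
    also have "C * (M * norm u) \<le> C * (M * (\<eta>' * norm y))"
      using eta'(1)[OF y] C M0 by (intro mult_left_mono) (auto simp: u_def)
    also have "C * (M * (\<eta>' * norm y)) = (2 * C * \<eta>') * (M * norm y / 2)"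
      by simp
    also have "\<dots> \<le> 1/2 * (M * norm y / 2)"
      using M0 by (intro mult_right_mono small) simp
    finally have "norm (adj (B.R y)) \<le> (N + \<rho>) * (C * norm y) + 1/2 * (M * norm y / 2)"
      by simp
    with adj_lower[OF B.R_H[OF y]] show ?thesis
      by (simp add: algebra_simps)
  qed
  hence "M \<le> 2 * ((N + \<rho>) * C) + M / 2"
    unfolding M_def[symmetric] using B.H_zero N(2) rho(2) C M0
    by (subst M_def, intro onorm_on_least) auto
  hence "M \<le> 4 * ((N + \<rho>) * C)"
    by simp
  from order_trans[OF M[OF y] mult_right_mono[OF this norm_ge_zero]] show ?thesis .
qed

text \<open>Now \<open>adj\<close> is the intertwining map. Its error is
  \<open>adj R_B (J adj - 1)\<close> minus the resolvent difference applied after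
  \<open>adj\<close>, so the bound \<open>M\<close> for \<open>R_B\<close> enters.\<close>

lemma gap_backward:
  assumes M: "\<And>y. y \<in> K \<Longrightarrow> norm (B.R y) \<le> M * norm y" "M \<ge> 0"
    and inf: "\<And>d. d > 0 \<Longrightarrow> infinite_dimensional (Q {s - d<..<s + d} ` K)"
    and fin: "\<not> infinite_dimensional (P {l - e<..<l + e} ` H)" and e: "e > 0"
  shows "1 \<le> 2 * (1 + cmod (complex_of_real l - z) / e) *
           (C * (M * \<bar>l - s\<bar>) + cmod (complex_of_real l - z) * (\<rho> * C + C * M * \<eta>'))"
proof -
  have rho': "norm (A.R (adj y) - adj (B.R y)) \<le> (\<rho> * C + C * M * \<eta>') * norm y" if y: "y \<in> K" for y
  proof -
    define u where "u = J (adj y) - y"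
    have u: "u \<in> K"
      using y J_K adj_H B.H_diff by (simp add: u_def)
    have "B.R u = B.R (J (adj y)) - B.R y"
      unfolding u_def by (rule clinear_on_diff[OF B.R_linear B.subspace_H J_K[OF adj_H] y])
    hence "A.R (adj y) - adj (B.R y) = adj (B.R u) - (adj (B.R (J (adj y))) - A.R (adj y))"
      by (simp add: adj_diff)
    hence "norm (A.R (adj y) - adj (B.R y)) \<le> norm (adj (B.R u)) + norm (adj (B.R (J (adj y))) - A.R (adj y))"
      by (metis norm_triangle_ineq4)
    also have "\<dots> \<le> C * (M * norm u) + \<rho> * norm (adj y)"
      using order_trans[OF norm_adj mult_left_mono[OF M(1)[OF u] C]] by (intro add_mono rho adj_H)
    also have "\<dots> \<le> C * (M * (\<eta>' * norm y)) + \<rho> * (C * norm y)"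
      using eta'(1)[OF y] C M(2) rho(2) norm_adj
      by (intro add_mono mult_left_mono) (auto simp: u_def)
    finally show ?thesis
      by (simp add: algebra_simps)
  qed
  have lin: "clinear_on K adj"
    by (rule adjoint_on_linear[OF A.hilbert J])
  show ?thesis
    by (rule intertwining_gap[OF B A lin adj_H adj_lower zero_le_numeral norm_adj C M rho' inf fin e])
qed

end

lemma spectral_resolventI:
  assumes "separable_hilbert_space H" "self_adjoint H A" "z \<in> resolvent_set H A"
  shows "spectral_resolvent H A (spectral_projection H A) z"
proof -
  interpret self_adjoint_operator H A
    using assms(1,2) by (simp add: self_adjoint_operator_def separable_hilbert_space_def)
  show ?thesis
    by (intro spectral_resolvent.intro spectral_measure.intro spectral_measure_axioms.intro
        spectral_resolvent_axioms.intro self_adjoint_operator_axioms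
        is_spectral_measure_spectral_projection assms)
qed

theorem theorem2p15:
  fixes H :: "'a::chilbert_space set"
    and Hn :: "nat \<Rightarrow> 'b::chilbert_space set"
    and J :: "nat \<Rightarrow> 'a \<Rightarrow> 'b"
    and A :: "'a unbounded_op"
    and An :: "nat \<Rightarrow> 'b unbounded_op"
  assumes "separable_hilbert_space H"
    and "\<And>n. separable_hilbert_space (Hn n)"
    and "\<And>n. J n \<in> bounded_operators H (Hn n)"
    and "self_adjoint H A"
    and "\<And>n. self_adjoint (Hn n) (An n)"
    and "generalized_norm_resolvent_convergent H A Hn An J"
  shows "essential_spectrum H A = lim_sets (\<lambda>n. essential_spectrum (Hn n) (An n))"
proof -
  define adj where "adj n = adjoint_on H (J n)" for n
  define \<eta> where "\<eta> n = onorm_on H (\<lambda>x. adj n (J n x) - x)" for n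
  define \<eta>' where "\<eta>' n = onorm_on (Hn n) (\<lambda>y. J n (adj n y) - y)" for n
  obtain C z where C: "C > 0" "\<And>n. onorm_on H (J n) \<le> C"
    and eta: "\<eta> \<longlonglongrightarrow> 0" "\<eta>' \<longlonglongrightarrow> 0" and zr: "z \<in> resolvent_region H A Hn An"
    and rho0: "(\<lambda>n. onorm_on H (\<lambda>x. adj n (resolvent (An n) z (J n x)) - resolvent A z x)) \<longlonglongrightarrow> 0"
    using assms(6) unfolding generalized_norm_resolvent_convergent_def \<eta>_def[abs_def] \<eta>'_def[abs_def] adj_def
    by blast
  define \<rho> where "\<rho> n = onorm_on H (\<lambda>x. adj n (resolvent (An n) z (J n x)) - resolvent A z x)" for n
  have rho: "\<rho> \<longlonglongrightarrow> 0"
    using rho0 by (simp add: \<rho>_def[abs_def])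
  have "z \<notin> spectrum H A \<union> (\<Union>n. spectrum (Hn n) (An n))"
    using zr closure_subset[of "spectrum H A \<union> (\<Union>n. spectrum (Hn n) (An n))"]
    unfolding resolvent_region_def by blast
  hence zA: "z \<in> resolvent_set H A" and zn: "z \<in> resolvent_set (Hn n) (An n)" for n
    by (auto simp: spectrum_def)
  define P where "P = spectral_projection H A"
  define Q where "Q n = spectral_projection (Hn n) (An n)" for n
  have A: "spectral_resolvent H A P z"
    unfolding P_def by (rule spectral_resolventI[OF assms(1,4) zA])
  have B: "spectral_resolvent (Hn n) (An n) (Q n) z" for n
    unfolding Q_def by (rule spectral_resolventI[OF assms(2,5) zn])
  interpret A: spectral_resolvent H A P z by (rule A)
  interpret B: spectral_resolvent "Hn n" "An n" "Q n" z for n by (rule B)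
  have essA: "l \<in> essential_spectrum H A \<longleftrightarrow> (\<forall>d>0. infinite_dimensional (P {l - d<..<l + d} ` H))" for l
    by (simp add: essential_spectrum_def P_def)
  have essB: "l \<in> essential_spectrum (Hn n) (An n) \<longleftrightarrow>
      (\<forall>d>0. infinite_dimensional (Q n {l - d<..<l + d} ` Hn n))" for l n
    by (simp add: essential_spectrum_def Q_def)
  obtain N where N: "N \<ge> 0" "\<And>f. f \<in> H \<Longrightarrow> norm (A.R f) \<le> N * norm f"
    using bounded_operatorsD(3)[OF A.R_bounded] by blast
  \<comment> \<open>The suprema in \<open>onorm_on\<close> yield inequalities only after crude a
    priori constants are supplied, here and for the three differences below.\<close>
  have JC: "norm (J n f) \<le> C * norm f" if f: "f \<in> H" for n f
  proof -
    obtain c where "\<And>x. x \<in> H \<Longrightarrow> norm (J n x) \<le> c * norm x"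
      using bounded_operatorsD(3)[OF assms(3)[of n]] by blast
    hence "norm (J n f) \<le> onorm_on H (J n) * norm f"
      using f by (rule onorm_on_bound)
    also have "\<dots> \<le> C * norm f"
      by (intro mult_right_mono C) simp
    finally show ?thesis .
  qed
  note adj = adjoint_on_works[OF A.hilbert assms(3), folded adj_def]
  have adjC: "norm (adj n y) \<le> C * norm y" for n y
    unfolding adj_def using C(1) by (intro adjoint_on_bound[OF A.hilbert assms(3)] JC) auto
  have JH: "J n f \<in> Hn n" if "f \<in> H" for n f
    using bounded_operatorsD(1)[OF assms(3) that] .
  have eta_bound: "norm (adj n (J n f) - f) \<le> \<eta> n * norm f" if f: "f \<in> H" for n f
    unfolding \<eta>_def
  proof (rule onorm_on_bound[OF _ f])
    fix x assume x: "x \<in> H"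
    have "norm (adj n (J n x) - x) \<le> C * (C * norm x) + norm x"
      using norm_triangle_ineq4[of "adj n (J n x)" x] adjC[of n "J n x"]
        mult_left_mono[OF JC[OF x, of n], of C] C(1) by linarith
    thus "norm (adj n (J n x) - x) \<le> (C * C + 1) * norm x"
      by (simp add: algebra_simps)
  qed
  have eta'_bound: "norm (J n (adj n y) - y) \<le> \<eta>' n * norm y" if y: "y \<in> Hn n" for n y
    unfolding \<eta>'_def
  proof (rule onorm_on_bound[OF _ y])
    fix y
    have "norm (J n (adj n y) - y) \<le> C * (C * norm y) + norm y"
      using norm_triangle_ineq4[of "J n (adj n y)" y] JC[OF adj(1), of n n y]
        mult_left_mono[OF adjC[of n y], of C] C(1) by linarith
    thus "norm (J n (adj n y) - y) \<le> (C * C + 1) * norm y"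
      by (simp add: algebra_simps)
  qed
  have rho_ex: "\<exists>c. \<forall>x\<in>H. norm (adj n (resolvent (An n) z (J n x)) - resolvent A z x) \<le> c * norm x" for n
  proof -
    obtain M where M: "M \<ge> 0" "\<And>y. y \<in> Hn n \<Longrightarrow> norm (B.R n y) \<le> M * norm y"
      using bounded_operatorsD(3)[OF B.R_bounded] by blast
    have "norm (adj n (B.R n (J n x)) - A.R x) \<le> (C * M * C + N) * norm x" if x: "x \<in> H" for x
    proof -
      have "norm (adj n (B.R n (J n x))) \<le> C * (M * (C * norm x))"
        using adjC[of n "B.R n (J n x)"]
          mult_left_mono[OF order_trans[OF M(2)[OF JH[OF x]] mult_left_mono[OF JC[OF x] M(1)]], of C] C(1)
        by (meson less_imp_le order_trans)
      thus ?thesis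
        using norm_triangle_ineq4[of "adj n (B.R n (J n x))" "A.R x"] N(2)[OF x]
        by (simp add: algebra_simps)
    qed
    thus ?thesis
      by blast
  qed
  have rho_bound: "norm (adj n (resolvent (An n) z (J n f)) - resolvent A z f) \<le> \<rho> n * norm f"
    if "f \<in> H" for n f
  proof -
    obtain c where "\<forall>x\<in>H. norm (adj n (resolvent (An n) z (J n x)) - resolvent A z x) \<le> c * norm x"
      using rho_ex[of n] by blast
    thus ?thesis
      unfolding \<rho>_def by (intro onorm_on_bound[where C = c, OF _ that]) simp
  qed
  have rho_nonneg: "\<rho> n \<ge> 0" for n
  proof -
    obtain c where "\<forall>x\<in>H. norm (adj n (resolvent (An n) z (J n x)) - resolvent A z x) \<le> c * norm x"
      using rho_ex[of n] by blast
    thus ?thesis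
      unfolding \<rho>_def by (intro onorm_on_nonneg[where c = c, OF A.H_zero]) simp
  qed
  have pair: "almost_unitary H (Hn n) (J n) A P (An n) (Q n) z C (\<eta> n) (\<eta>' n) (\<rho> n)"
    if "\<eta> n < 1/2" "\<eta>' n < 1/2" for n
    using A B assms(3) C(1) JC eta_bound eta'_bound rho_bound rho_nonneg that
    by (intro almost_unitary.intro) (auto simp: adj_def)
  have small: "\<forall>\<^sub>F n in sequentially. \<eta> n < 1/2" "\<forall>\<^sub>F n in sequentially. \<eta>' n < 1/2"
    by (rule order_tendstoD(2)[OF eta(1)], simp) (rule order_tendstoD(2)[OF eta(2)], simp)
  show ?thesis
  proof (intro subset_antisym subsetI)
    fix l assume l: "l \<in> essential_spectrum H A"
    let ?w = "cmod (complex_of_real l - z)"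
    show "l \<in> lim_sets (\<lambda>n. essential_spectrum (Hn n) (An n))"
    proof (rule lim_setsI)
      fix e :: real assume e: "e > 0"
      \<comment> \<open>The right side of the inequality in \<open>gap_forward\<close>, with half
        the width \<open>e\<close> so that the argument can use a closed interval.\<close>
      have "(\<lambda>n. 2 * (1 + ?w / (e/2)) * (?w * (2 * (\<rho> n + \<eta> n * N)))) \<longlonglongrightarrow>
          2 * (1 + ?w / (e/2)) * (?w * (2 * (0 + 0 * N)))"
        by (intro tendsto_intros eta rho)
      hence "\<forall>\<^sub>F n in sequentially. 2 * (1 + ?w / (e/2)) * (?w * (2 * (\<rho> n + \<eta> n * N))) < 1"
        by (rule order_tendstoD(2)) simp
      with small show "\<forall>\<^sub>F n in sequentially. \<exists>t\<in>essential_spectrum (Hn n) (An n). \<bar>l - t\<bar> < e"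
      proof eventually_elim
        case (elim n)
        interpret almost_unitary H "Hn n" "J n" A P "An n" "Q n" z C "\<eta> n" "\<eta>' n" "\<rho> n"
          by (rule pair) (use elim in auto)
        show ?case
        proof (rule ccontr)
          assume no: "\<not> ?case"
          \<comment> \<open>Each point of the closed interval is closer than \<open>e\<close> to
            \<open>l\<close>, hence not in the essential spectrum of \<open>An n\<close>;
            compactness then gives finite rank.\<close>
          have "\<not> infinite_dimensional (Q n {l - e/2<..<l + e/2} ` Hn n)"
          proof (rule B.finite_dim_interval)
            fix t assume "t \<in> {l - e/2..l + e/2}"
            hence "\<bar>l - t\<bar> < e"
              using e by auto
            hence "t \<notin> essential_spectrum (Hn n) (An n)"
              using no by blast
            thus "\<exists>d>0. \<not> infinite_dimensional (Q n {t - d<..<t + d} ` Hn n)"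
              unfolding essB by blast
          qed
          from gap_forward[OF N(2,1) _ this] show False
            using l e elim(3) unfolding essA by auto
        qed
      qed
    qed
  next
    fix l assume "l \<in> lim_sets (\<lambda>n. essential_spectrum (Hn n) (An n))"
    then obtain s where s: "\<forall>\<^sub>F n in sequentially. s n \<in> essential_spectrum (Hn n) (An n)" "s \<longlonglongrightarrow> l"
      by (auto simp: lim_sets_def)
    let ?w = "cmod (complex_of_real l - z)"
    show "l \<in> essential_spectrum H A"
    proof (rule ccontr)
      assume "l \<notin> essential_spectrum H A"
      then obtain e where e: "e > 0" "\<not> infinite_dimensional (P {l - e<..<l + e} ` H)"
        unfolding essA by blast
      \<comment> \<open>The bound of \<open>norm_resolvent_B\<close> with \<open>\<rho> n\<close>
        replaced by 1, which makes it uniform for large \<open>n\<close>.\<close>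
      define M where "M = 4 * ((N + 1) * C)"
      have M0: "M \<ge> 0"
        using N(1) C(1) by (simp add: M_def)
      have "(\<lambda>n. 2 * (1 + ?w / e) * (C * (M * \<bar>l - s n\<bar>) + ?w * (\<rho> n * C + C * M * \<eta>' n))) \<longlonglongrightarrow>
          2 * (1 + ?w / e) * (C * (M * \<bar>l - l\<bar>) + ?w * (0 * C + C * M * 0))"
        by (intro tendsto_intros eta rho s)
      hence "\<forall>\<^sub>F n in sequentially.
          2 * (1 + ?w / e) * (C * (M * \<bar>l - s n\<bar>) + ?w * (\<rho> n * C + C * M * \<eta>' n)) < 1"
        by (rule order_tendstoD(2)) simp
      moreover have "\<forall>\<^sub>F n in sequentially. \<rho> n < 1"
        using rho by (rule order_tendstoD(2)) simp
      moreover have "(\<lambda>n. 2 * C * \<eta>' n) \<longlonglongrightarrow> 2 * C * 0"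
        by (intro tendsto_intros eta)
      hence "\<forall>\<^sub>F n in sequentially. 2 * C * \<eta>' n < 1/2"
        by (rule order_tendstoD(2)) simp
      \<comment> \<open>A single large index contradicts \<open>gap_backward\<close>; since the
        sequential filter is nontrivial, an eventually false statement is absurd.\<close>
      ultimately have "\<forall>\<^sub>F n in sequentially. False"
        using small s(1)
      proof eventually_elim
        case (elim n)
        interpret almost_unitary H "Hn n" "J n" A P "An n" "Q n" z C "\<eta> n" "\<eta>' n" "\<rho> n"
          by (rule pair) (use elim in auto)
        have M: "norm (B.R n y) \<le> M * norm y" if y: "y \<in> Hn n" for y
        proof -
          have "(N + \<rho> n) * C \<le> (N + 1) * C"
            using elim(2) C(1) by (intro mult_right_mono) auto
          hence "4 * ((N + \<rho> n) * C) * norm y \<le> M * norm y"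
            unfolding M_def by (intro mult_right_mono) auto
          with norm_resolvent_B[OF N(2,1) _ y] elim(3) show ?thesis
            by fastforce
        qed
        from gap_backward[OF M M0 _ e(2,1), of "s n"] elim(1,6) show False
          unfolding essB by fastforce
      qed
      thus False
        by simp
    qed
  qed
qed

end
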